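(* Consider the uniform model with the factorial profile: $a_j=1/j!$ and $v(j)=\log(j!)$, $j\ge1$, with the notation of the context. Let \[ q^*(j)=2^{-j}\ (j\ge1),\qquad \rho^*=\sum_{m\ge1}2^{-m}\log m=0.507834\ldots. \] The critical canonical law is $q_c=q^*$, the critical profile rate is $\rho_c=\rho^*$, and the critical support fraction is $\alpha_c=1/2$. Let $\alpha^*(\rho)=\lim_{n\to\infty}k_n(\rho)/n$ denote the limiting optimal support fraction, $\rho\ge0$. One has $\alpha^*(0)=1$, and $\alpha^*$ decreases strictly on $[0,\rho^*]$. Moreover, as $n\to\infty$: (i) for each $\rho\in(0,\rho^* )$ there is a unique $\gamma<1$ with $\rho_\gamma=\rho$, and $\alpha^*(\rho)=\alpha_\gamma$. Moreover, for every fixed $r\ge1$, \[ \left|\frac{k_n(\rho)}n-\alpha_\gamma\right|=O_\rho(n^{-1/2}),\qquad d_{\mathrm{TV}}(\mu^{\rho,[r]}_{n,k_n(\rho)},q_\gamma^{\otimes r})=O_{\rho,r}\!\left((\log n/n)^{1/2}\right); \] (ii) at $\rho=\rho^*$ one has $\alpha^*(\rho^* )=1/2$ and $q_c=q^*$, and both the support error $|k_n(\rho^* )/n-1/2|$ and, for every fixed $r$, the total-variation error $d_{\mathrm{TV}}(\mu^{\rho^*,[r]}_{n,k_n(\rho^* )},(q^* )^{\otimes r})$ are $O_r((\log n/n)^{1/2})$; (iii) for every $\rho>\rho^*$ one has $\alpha^*(\rho)=1/2$, and for every fixed $r$, \[ \left|\frac{k_n(\rho)}n-\frac12\right|+d_{\mathrm{TV}}(\mu^{\rho,[r]}_{n,k_n(\rho)},(q^*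 )^{\otimes r})=O_{\rho,r}((\log n)^{-1/2}), \] while a vanishing fraction of symbols carries the excess $(\rho-\rho^* )n$ in $V_k$: with $k=k_n(\rho)$ and $(J_1,\dots,J_k)\sim\mu^\rho_{n,k}$, there is a deterministic sequence $M_n\to\infty$ such that $I_n=\{i:J_i>M_n\}$ satisfies $\mathbb E\,|I_n|/k=o(1)$ and $\mathbb E\bigl|\frac1n\sum_{i\in I_n}v(J_i)-(\rho-\rho^* )\bigr|=o(1)$.
   Context: For $a_j=1/j!$, $v(j)=\log(j!)$ and $x>0$, $\gamma\in\mathbb R$, let $Z_\gamma(x)=\sum_{j\ge1}a_jx^je^{\gamma v(j)}=\sum_{j\ge1}x^j(j!)^{\gamma-1}$. Let $\gamma_c=\lim_{j\to\infty}[-\log a_j]/v(j)$, which here equals $1$. For every $\gamma\le\gamma_c$ the equation $Z_\gamma(x)=1$ has a unique solution $x_\gamma>0$; let $q_\gamma(j)=x_\gamma^j(j!)^{\gamma-1}$, a probability law on $\{1,2,\dots\}$, write $\mathbb E_\gamma$ for expectation when $J\sim q_\gamma$, and set \[ \alpha_\gamma=\frac1{\mathbb E_\gamma J},\qquad \rho_\gamma=\frac{\mathbb E_\gamma v(J)}{\mathbb E_\gamma J}. \] The critical quantities are $q_c=q_{\gamma_c}$, $\alpha_c=\alpha_{\gamma_c}$, $\rho_c=\rho_{\gamma_c}$. For $\rho\ge0$ and $1\le k\le n$, \[ W_{n,k}(\rho)=\sum_{\substack{j_1+\cdots+j_k=n,\ j_i\ge1\\ |\sum_i v(j_i)-\rho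 n|\le 1}}\ \prod_{i=1}^k a_{j_i}. \] Whenever $W_{n,k}(\rho)>0$, $\mu^\rho_{n,k}$ is the probability law of $(J_1,\dots,J_k)$ on the constraint set of this sum with weights proportional to $\prod_ia_{j_i}$, and $\mu^{\rho,[r]}_{n,k}$ is the joint law of its first $r$ coordinates ($1\le r\le k$). $k_n(\rho)$ is any maximizer of $k\mapsto W_{n,k}(\rho)$ over $1\le k\le n$. $V_k=\sum_{i=1}^kv(J_i)$. $d_{\mathrm{TV}}(\mu,\pi)=\frac12\sum_z|\mu(z)-\pi(z)|$. Subscripts on $O$ record the dependence of implicit constants. *)

theory Defs
  imports "HOL-Probability.Probability"
begin

definition coef :: "nat \<Rightarrow> real" where
  "coef j = 1 / fact j"

definition profile :: "nat \<Rightarrow> real" where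
  "profile j = ln (fact j)"


section \<open>Canonical laws\<close>

(* infsum is 0 on a non-summable family, so Zfun g x = 1 includes convergence of the series. *)
definition Zfun :: "real \<Rightarrow> real \<Rightarrow> real" where
  "Zfun g x = (\<Sum>\<^sub>\<infinity>j\<in>{1..}. coef j * x ^ j * exp (g * profile j))"

definition gamma_c :: real where
  "gamma_c = lim (\<lambda>j. - ln (coef j) / profile j)"

definition x_sol :: "real \<Rightarrow> real" where
  "x_sol g = (THE x. x > 0 \<and> Zfun g x = 1)"

definition qlaw :: "real \<Rightarrow> nat pmf" where
  "qlaw g = embed_pmf (\<lambda>j. if 1 \<le> j then coef j * x_sol g ^ j * exp (g * profile j) else 0)"

definition alpha_of :: "real \<Rightarrow> real" where
  "alpha_of g = 1 / measure_pmf.expectation (qlaw g) real"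

definition rho_of :: "real \<Rightarrow> real" where
  "rho_of g = measure_pmf.expectation (qlaw g) profile / measure_pmf.expectation (qlaw g) real"

abbreviation q_c :: "nat pmf" where "q_c \<equiv> qlaw gamma_c"
abbreviation alpha_c :: real where "alpha_c \<equiv> alpha_of gamma_c"
abbreviation rho_c :: real where "rho_c \<equiv> rho_of gamma_c"

definition qstar :: "nat pmf" where
  "qstar = embed_pmf (\<lambda>j. if 1 \<le> j then (1/2) ^ j else 0)"

definition rhostar :: real where
  "rhostar = (\<Sum>\<^sub>\<infinity>m\<in>{1..}. (1/2) ^ m * ln (real m))"


section \<open>The constrained model\<close>

definition configs :: "real \<Rightarrow> nat \<Rightarrow> nat \<Rightarrow> nat list set" where
  "configs \<rho> n k = {js. length js = k \<and> sum_list js = n \<and> (\<forall>j\<in>set js. 1 \<le> j) \<and>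
                        \<bar>(\<Sum>j\<leftarrow>js. profile j) - \<rho> * real n\<bar> \<le> 1}"

definition weight :: "nat list \<Rightarrow> real" where
  "weight js = (\<Prod>j\<leftarrow>js. coef j)"

definition Wpart :: "real \<Rightarrow> nat \<Rightarrow> nat \<Rightarrow> real" where
  "Wpart \<rho> n k = (\<Sum>js\<in>configs \<rho> n k. weight js)"

(* Meaningful only when Wpart \<rho> n k > 0; see pmf_mu_law. *)
definition mu_law :: "real \<Rightarrow> nat \<Rightarrow> nat \<Rightarrow> nat list pmf" where
  "mu_law \<rho> n k =
     embed_pmf (\<lambda>js. if js \<in> configs \<rho> n k then weight js / Wpart \<rho> n k else 0)"

definition mu_marg :: "real \<Rightarrow> nat \<Rightarrow> nat \<Rightarrow> nat \<Rightarrow> nat list pmf" where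
  "mu_marg \<rho> n k r = map_pmf (take r) (mu_law \<rho> n k)"

definition optimal :: "real \<Rightarrow> nat \<Rightarrow> nat \<Rightarrow> bool" where
  "optimal \<rho> n k \<longleftrightarrow> is_arg_max (Wpart \<rho> n) (\<lambda>k. k \<in> {1..n}) k"

definition optimal_seq :: "real \<Rightarrow> (nat \<Rightarrow> nat) \<Rightarrow> bool" where
  "optimal_seq \<rho> \<kappa> \<longleftrightarrow> (\<forall>n\<ge>1. optimal \<rho> n (\<kappa> n))"

(* Maximizers need not be unique, so the limit is taken along every choice of them. *)
definition alpha_star :: "real \<Rightarrow> real" where
  "alpha_star \<rho> =
     (THE a. \<forall>\<kappa>. optimal_seq \<rho> \<kappa> \<longrightarrow> (\<lambda>n. real (\<kappa> n) / real n) \<longlonglongrightarrow> a)"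

definition tv_dist :: "'a pmf \<Rightarrow> 'a pmf \<Rightarrow> real" where
  "tv_dist p q = 1/2 * (\<Sum>\<^sub>\<infinity>z. \<bar>pmf p z - pmf q z\<bar>)"


section \<open>Well-definedness\<close>

lemma gamma_c_eq: "gamma_c = 1"
proof -
  have "- ln (coef j) / profile j = 1" if "j \<ge> 2" for j
  proof -
    have "fact j \<ge> (fact 2 :: real)" using that by (rule fact_mono)
    then have "ln (fact j :: real) > 0" by simp
    then show ?thesis by (simp add: coef_def profile_def ln_div)
  qed
  then have "eventually (\<lambda>j. - ln (coef j) / profile j = 1) sequentially"
    by (rule eventually_mono[OF eventually_ge_at_top[of "2::nat"]])
  then have "(\<lambda>j. - ln (coef j) / profile j) \<longlonglongrightarrow> 1"
    by (rule tendsto_eventually)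
  then show ?thesis unfolding gamma_c_def by (rule limI)
qed

lemma finite_configs: "finite (configs \<rho> n k)"
proof (rule finite_subset)
  show "configs \<rho> n k \<subseteq> {js. set js \<subseteq> {..n} \<and> length js = k}"
    by (auto simp: configs_def dest: member_le_sum_list)
qed (simp add: finite_lists_length_eq)

lemma weight_pos: "weight js > 0"
  by (induction js) (auto simp: weight_def coef_def)

lemma pmf_mu_law:
  assumes "Wpart \<rho> n k > 0"
  shows "pmf (mu_law \<rho> n k) js =
           (if js \<in> configs \<rho> n k then weight js / Wpart \<rho> n k else 0)"
  unfolding mu_law_def
proof (rule pmf_embed_pmf)
  let ?f = "\<lambda>js. if js \<in> configs \<rho> n k then weight js / Wpart \<rho> n k else 0"
  show nonneg: "0 \<le> ?f js" for js
    using assms weight_pos[of js] by simp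
  have "(\<integral>\<^sup>+ js. ennreal (?f js) \<partial>count_space UNIV) = (\<Sum>js\<in>configs \<rho> n k. ennreal (?f js))"
    by (rule nn_integral_count_space'[OF finite_configs]) auto
  also have "\<dots> = ennreal (\<Sum>js\<in>configs \<rho> n k. ?f js)"
    using nonneg by (intro sum_ennreal) blast
  also have "(\<Sum>js\<in>configs \<rho> n k. ?f js) = 1"
    using assms by (simp add: Wpart_def flip: sum_divide_distrib)
  finally show "(\<integral>\<^sup>+ js. ennreal (?f js) \<partial>count_space UNIV) = 1" by simp
qed

lemma pmf_qstar: "pmf qstar j = (if 1 \<le> j then (1/2) ^ j else 0)"
  unfolding qstar_def
proof (rule pmf_embed_pmf)
  let ?f = "\<lambda>j::nat. if 1 \<le> j then (1/2) ^ j else (0::real)"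
  show "0 \<le> ?f j" for j by simp
  have "(\<lambda>j. ?f (Suc j)) sums 1"
    using sums_mult[OF geometric_sums[of "1/2::real"], of "1/2"] by simp
  from sums_Suc[OF this] have sums: "?f sums 1" by simp
  have "(\<integral>\<^sup>+ j. ennreal (?f j) \<partial>count_space UNIV) = (\<Sum>j. ennreal (?f j))"
    by (rule nn_integral_count_space_nat)
  also have "\<dots> = ennreal (\<Sum>j. ?f j)"
    by (rule suminf_ennreal2) (use sums in \<open>auto simp: sums_iff\<close>)
  finally show "(\<integral>\<^sup>+ j. ennreal (?f j) \<partial>count_space UNIV) = 1"
    using sums by (simp add: sums_iff)
qed

end

theory Submission
  imports Defs "HOL-Real_Asymp.Real_Asymp"
begin

text \<open>On the constraint set the weights are those of an independent sample from \<open>qlaw g\<close>, up to a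
  factor \<open>exp (\<plusminus>\<bar>g\<bar>)\<close>, so everything reduces to the probability that \<open>k\<close> independent symbols have
  sum \<open>n\<close> and total profile within \<open>1\<close> of \<open>\<rho> n\<close>. Splitting off fair choices from \<open>{1, 2}\<close> and
  \<open>{1, 3}\<close> leaves two independent binomials, and this gives matching bounds of order \<open>1 / n\<close> at the
  optimal \<open>k\<close>; away from it a second moment on one half of the sample yields the decay that locates
  the optimum within \<open>sqrt n\<close>. A lower bound \<open>exp (- L)\<close> on that probability bounds the density of
  the model by \<open>exp L\<close>, up to a constant; by Jensen's inequality applied to exponential moments of block sums,
  exchangeable marginals are then within \<open>2 * sqrt (L / number of blocks)\<close> of the product law. Above
  \<open>rhostar\<close> one symbol of size of order \<open>n / ln n\<close> absorbs the excess, hence \<open>L\<close> is of order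
  \<open>n / ln n\<close> there.\<close>

section \<open>Symmetric binomial probabilities\<close>

text \<open>The constraint has one lattice coordinate, the sum, and one real coordinate, the
  profile. A flip of the first coin moves them by \<open>(1, ln 2)\<close>, a flip of the second by
  \<open>(2, ln 6)\<close>. These vectors are independent because
  \<open>ln 6 - 2 * ln 2 = ln (3/2)\<close> is positive; as \<open>ln (3/2)\<close> lies between 1/3
  and 1/2, a window of half-width 1 can be met while the sum is kept, but only boundedly often. This
  is why binomial coefficients suffice in both directions. Up to \<open>rhostar\<close> the support
  error has order \<open>n^(-1/2)\<close> without a logarithm: the product of squared deviation and
  probability is bounded, and the probability is at least of order \<open>1 / n\<close>. The
  marginals lose a logarithm because there \<open>L\<close> is of order \<open>ln n\<close>. The
  obstacle above \<open>rhostar\<close> is that \<open>profile j\<close> grows like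
  \<open>j * ln j\<close>: for \<open>g > 1\<close> the series \<open>Zfun g x\<close> diverges at
  every \<open>x > 0\<close>, so no tilted law has a larger rate. The excess has to be bought by a
  symbol \<open>j\<close> with \<open>j * ln j\<close> of order \<open>n\<close>, at the price
  \<open>2^-j\<close>. The rate \<open>(ln n)^(-1/2)\<close> is the square root of the resulting
  \<open>L / n\<close>.\<close>

lemma central_binomial_Suc:
  "real (Suc m) * real (2 * Suc m choose Suc m) = 2 * (2 * real m + 1) * real (2 * m choose m)"
proof -
  have "Suc m * (2 * Suc m choose Suc m) = 2 * Suc m * (Suc (2 * m) choose m)"
    using Suc_times_binomial_eq[of "Suc (2*m)" m] by simp
  moreover have "Suc m * (Suc (2 * m) choose m) = Suc (2 * m) * (2 * m choose m)"
    using binomial_absorb_comp[of "Suc (2 * m)" m] by simp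
  ultimately have "Suc m * (2 * Suc m choose Suc m) = 2 * (Suc (2 * m) * (2 * m choose m))"
    by simp
  then have "real (Suc m * (2 * Suc m choose Suc m)) = real (2 * (Suc (2 * m) * (2 * m choose m)))"
    by presburger
  then show ?thesis by (simp add: algebra_simps)
qed

text \<open>Passing from \<open>m\<close> to \<open>m + 1\<close> multiplies \<open>c\<close> by
  \<open>(2 * m + 1) / (2 * m + 2)\<close>. The square of this factor lies between
  \<open>(4 * m + 1) / (4 * m + 5)\<close> and \<open>(3 * m + 1) / (3 * m + 4)\<close>, so the two
  products are monotone in opposite directions; both equal 1 at \<open>m = 0\<close>.\<close>

lemma central_binomial_bounds:
  fixes m :: nat
  defines "c \<equiv> real (2 * m choose m) / 4 ^ m"
  shows "c\<^sup>2 * (4 * real m + 1) \<ge> 1" and "c\<^sup>2 * (3 * real m + 1) \<le> 1"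
proof -
  have "1 \<le> (real (2 * m choose m) / 4 ^ m)\<^sup>2 * (4 * real m + 1) \<and>
        (real (2 * m choose m) / 4 ^ m)\<^sup>2 * (3 * real m + 1) \<le> 1"
  proof (induction m)
    case (Suc m)
    define d where "d = (real (2 * m choose m) / 4 ^ m)\<^sup>2"
    have "real (2 * Suc m choose Suc m) / 4 ^ Suc m
            = (2 * real m + 1) / (2 * real m + 2) * (real (2 * m choose m) / 4 ^ m)"
    proof -
      have "real (2 * Suc m choose Suc m) = 2 * (2 * real m + 1) * real (2 * m choose m) / real (Suc m)"
        using central_binomial_Suc[of m] by (simp add: eq_divide_eq mult.commute del: binomial_Suc_Suc mult_Suc_right)
      then have "real (2 * Suc m choose Suc m) * (2 * real m + 2) = 4 * (2 * real m + 1) * real (2 * m choose m)"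
        by (simp add: field_simps del: binomial_Suc_Suc mult_Suc_right)
      then show ?thesis by (simp add: frac_eq_eq del: binomial_Suc_Suc mult_Suc_right)
    qed
    then have eq: "(real (2 * Suc m choose Suc m) / 4 ^ Suc m)\<^sup>2
            = (2 * real m + 1)\<^sup>2 / (2 * real m + 2)\<^sup>2 * d"
      by (simp only: power_mult_distrib d_def power_divide)
    have d: "1 \<le> d * (4 * real m + 1)" "d * (3 * real m + 1) \<le> 1" "d \<ge> 0"
      using Suc unfolding d_def by auto
    have "4 * real m + 1 \<le> (2 * real m + 1)\<^sup>2 / (2 * real m + 2)\<^sup>2 * (4 * real (Suc m) + 1)"
    proof -
      have "(4 * real m + 1) * (2 * real m + 2)\<^sup>2 \<le> (2 * real m + 1)\<^sup>2 * (4 * real (Suc m) + 1)"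
        by (simp add: algebra_simps power2_eq_square)
      then show ?thesis by (simp add: pos_le_divide_eq)
    qed
    then have "1 \<le> d * ((2 * real m + 1)\<^sup>2 / (2 * real m + 2)\<^sup>2 * (4 * real (Suc m) + 1))"
      using d by (meson mult_left_mono order_trans)
    moreover have "(2 * real m + 1)\<^sup>2 / (2 * real m + 2)\<^sup>2 * (3 * real (Suc m) + 1) \<le> 3 * real m + 1"
    proof -
      have "(2 * real m + 1)\<^sup>2 * (3 * real (Suc m) + 1) \<le> (3 * real m + 1) * (2 * real m + 2)\<^sup>2"
        by (simp add: algebra_simps power2_eq_square)
      then show ?thesis by (simp add: pos_divide_le_eq)
    qed
    then have "d * ((2 * real m + 1)\<^sup>2 / (2 * real m + 2)\<^sup>2 * (3 * real (Suc m) + 1)) \<le> 1"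
      using d by (meson mult_left_mono order_trans)
    ultimately show ?case unfolding eq by (simp add: algebra_simps)
  qed simp
  then show "c\<^sup>2 * (4 * real m + 1) \<ge> 1" and "c\<^sup>2 * (3 * real m + 1) \<le> 1" by (auto simp: c_def)
qed

text \<open>Every coefficient is compared with the central one of the row
  \<open>2 * (N div 2)\<close>. For odd \<open>N\<close>, Pascal's rule gives a sum of two
  coefficients of that even row, and the additional factor 2 of the denominator absorbs
  this.\<close>

lemma binomial_prob_upper: "real (N choose b) / 2 ^ N \<le> 2 / sqrt (real N + 1)"
proof -
  define m where "m = N div 2"
  define c where "c = real (2 * m choose m) / 4 ^ m"
  have "c \<ge> 0" by (simp add: c_def)
  have "c\<^sup>2 * (real N + 1) \<le> 4 * (c\<^sup>2 * (3 * real m + 1)) / 4 + c\<^sup>2"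
  proof -
    have "real N + 1 \<le> 3 * real m + 1 + 1" unfolding m_def by linarith
    then have "c\<^sup>2 * (real N + 1) \<le> c\<^sup>2 * (3 * real m + 1 + 1)" by (intro mult_left_mono) auto
    then show ?thesis by (simp add: algebra_simps)
  qed
  also have "\<dots> \<le> 4"
  proof -
    have "c\<^sup>2 * (3 * real m + 1) \<le> 1" using central_binomial_bounds(2)[of m] by (simp add: c_def)
    moreover have "c\<^sup>2 * 1 \<le> c\<^sup>2 * (3 * real m + 1)" by (intro mult_left_mono) auto
    ultimately show ?thesis by simp
  qed
  finally have "sqrt (c\<^sup>2 * (real N + 1)) \<le> sqrt 4" by (rule real_sqrt_le_mono)
  then have c: "c \<le> 2 / sqrt (real N + 1)"
    using \<open>c \<ge> 0\<close> by (simp only: real_sqrt_mult) (simp add: field_simps)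
  have max: "real (2 * m choose i) \<le> real (2 * m choose m)" for i
    using binomial_maximum'[of m i] by simp
  show ?thesis
  proof (cases "even N")
    case True
    then have N: "N = 2 * m" by (simp add: m_def)
    have "real (N choose b) / 2 ^ N \<le> c"
      using max[of b] by (simp add: c_def N power_mult divide_right_mono)
    then show ?thesis using c by linarith
  next
    case False
    then have N: "N = Suc (2 * m)" by (simp add: m_def)
    have "real (N choose b) \<le> 2 * real (2 * m choose m)"
    proof (cases b)
      case (Suc b')
      then show ?thesis using max[of b] max[of b'] by (simp add: N)
    next
      case 0
      have "2 * m choose m \<ge> 1" using zero_less_binomial[of m "2 * m"] by linarith
      then show ?thesis using 0 by (simp add: N)
    qed
    then have "real (N choose b) / 2 ^ N \<le> 2 * real (2 * m choose m) / 2 ^ N"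
      by (rule divide_right_mono) simp
    also have "\<dots> = c" by (simp add: c_def N power_mult)
    finally have "real (N choose b) / 2 ^ N \<le> c" .
    then show ?thesis using c by linarith
  qed
qed

text \<open>Consecutive coefficients to the right of the center have ratio
  \<open>(m - i) / (m + i + 1)\<close>, at least \<open>(m - d) / (m + d)\<close> for
  \<open>i < d\<close>. Each of these \<open>d\<close> factors is at least
  \<open>exp (- 4 * d / m)\<close>, and their product gives the square of \<open>d\<close>.\<close>

lemma central_binomial_shift:
  assumes "3 * d \<le> m"
  shows "real (2 * m choose (m + d)) \<ge> real (2 * m choose m) * exp (- 4 * (real d)\<^sup>2 / real m)"
proof (cases "m = 0")
  case False
  have step: "real (2 * m choose (m + i)) \<ge> real (2 * m choose m) * ((real m - d) / (real m + d)) ^ i"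
    if "i \<le> d" for i
    using that
  proof (induction i)
    case (Suc i)
    have i: "i < m" using Suc assms by linarith
    have "Suc (m + i) * (2 * m choose Suc (m + i)) = (2 * m - (m + i)) * (2 * m choose (m + i))"
      using Suc_times_binomial_add by (metis binomial_absorption binomial_absorb_comp)
    then have "real (Suc (m + i)) * real (2 * m choose Suc (m + i))
        = real (m - i) * real (2 * m choose (m + i))"
      by (simp only: of_nat_mult[symmetric]) simp
    then have eq: "real (2 * m choose (m + Suc i))
        = (real m - i) / (real m + i + 1) * real (2 * m choose (m + i))"
      using i by (simp add: field_simps of_nat_diff)
    have "(real m - d) / (real m + d) \<le> (real m - i) / (real m + i + 1)"
      using Suc.prems i by (intro frac_le) auto
    moreover have "(real m - d) / (real m + d) \<ge> 0" using assms by auto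
    ultimately have "(real m - d) / (real m + d) * (real (2 * m choose m) * ((real m - d) / (real m + d)) ^ i)
        \<le> (real m - i) / (real m + i + 1) * real (2 * m choose (m + i))"
      using Suc by (intro mult_mono) auto
    then show ?case unfolding eq by (simp add: algebra_simps)
  qed simp
  have "exp (- 4 * real d / real m) \<le> (real m - d) / (real m + d)"
  proof -
    have "1 + 4 * real d / real m \<le> exp (4 * real d / real m)" by (rule exp_ge_add_one_self)
    then have "exp (- 4 * real d / real m) \<le> 1 / (1 + 4 * real d / real m)"
      by (simp add: exp_minus field_simps le_imp_inverse_le add_pos_nonneg)
    also have "\<dots> \<le> (real m - d) / (real m + d)"
    proof -
      have "2 * real d \<le> real m" using assms by linarith
      then have "2 * real d * (2 * real d) \<le> real m * (2 * real d)" by (intro mult_right_mono) auto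
      \<comment> \<open>The difference of the two sides is \<open>2 * d * (m - 2 * d)\<close>; this
        is where \<open>m\<close> has to be large compared with \<open>d\<close>.\<close>
      then have "real m * (real m + d) \<le> (real m - d) * (real m + 4 * d)"
        by (simp add: algebra_simps)
      moreover have "1 / (1 + 4 * real d / real m) = real m / (real m + 4 * d)"
        using False by (simp add: field_simps)
      ultimately show ?thesis using False by (simp add: frac_le_eq field_simps)
    qed
    finally show ?thesis .
  qed
  then have "exp (- 4 * real d / real m) ^ d \<le> ((real m - d) / (real m + d)) ^ d"
    by (intro power_mono) auto
  moreover have "exp (- 4 * real d / real m) ^ d = exp (- 4 * (real d)\<^sup>2 / real m)"
    by (simp add: exp_of_nat_mult[symmetric] power2_eq_square algebra_simps)
  ultimately have "real (2 * m choose m) * exp (- 4 * (real d)\<^sup>2 / real m)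
      \<le> real (2 * m choose m) * ((real m - d) / (real m + d)) ^ d"
    by (intro mult_left_mono) auto
  then show ?thesis using step[OF order_refl] by (rule order_trans)
qed (use assms in simp)

text \<open>The distance of \<open>b\<close> from \<open>N div 2\<close> is at most
  \<open>D + 1/2\<close>, and \<open>6 * D + 9 \<le> N\<close> makes three times this distance at
  most \<open>N div 2\<close>. For odd \<open>N\<close> the row \<open>N\<close> dominates the row
  \<open>N - 1\<close>, at the price of a factor 2.\<close>

lemma binomial_prob_lower:
  assumes N: "2 \<le> N" and D: "\<bar>real b - real N / 2\<bar> \<le> D" "6 * D + 9 \<le> real N"
  shows "real (N choose b) / 2 ^ N \<ge> exp (- 16 * (D + 1)\<^sup>2 / real N) / (2 * sqrt (2 * real N + 1))"
proof -
  define m where "m = N div 2"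
  define d where "d = (if b \<le> m then m - b else b - m)"
  define c where "c = real (2 * m choose m) / 4 ^ m"
  have mN: "real m \<le> real N / 2" "real N / 2 \<le> real m + 1/2" unfolding m_def by linarith+
  have d_abs: "real d = \<bar>real b - real m\<bar>" unfolding d_def by auto
  have dD: "real d \<le> D + 1 / 2" using D(1) mN unfolding d_abs by linarith
  have "3 * real d \<le> real m" using dD D(2) mN by linarith
  then have d3: "3 * d \<le> m" by linarith
  have m4: "real m \<ge> real N / 4" "real m > 0" using mN N by auto
  have ge: "real (2 * m choose b) / 4 ^ m \<ge> c * exp (- 16 * (D + 1)\<^sup>2 / real N)"
  proof -
    have "2 * m choose b = 2 * m choose (m + d)"
    proof (cases "b \<le> m")
      case True
      then have "m + d = 2 * m - b" by (simp add: d_def)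
      then show ?thesis using binomial_symmetric[of b "2 * m"] True by simp
    qed (simp add: d_def)
    then have "real (2 * m choose b) \<ge> real (2 * m choose m) * exp (- 4 * (real d)\<^sup>2 / real m)"
      using central_binomial_shift[OF d3] by simp
    moreover have "exp (- 16 * (D + 1)\<^sup>2 / real N) \<le> exp (- 4 * (real d)\<^sup>2 / real m)"
    proof -
      have "(real d)\<^sup>2 \<le> (D + 1)\<^sup>2" using dD by (intro power_mono) auto
      then have "4 * (real d)\<^sup>2 / real m \<le> 4 * (D + 1)\<^sup>2 / (real N / 4)"
        using m4 N by (intro frac_le) auto
      then show ?thesis by simp
    qed
    ultimately have "real (2 * m choose b) \<ge> real (2 * m choose m) * exp (- 16 * (D + 1)\<^sup>2 / real N)"
      by (meson mult_left_mono of_nat_0_le_iff order_trans)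
    then show ?thesis by (simp add: c_def divide_right_mono)
  qed
  have "1 \<le> c\<^sup>2 * (4 * real m + 1)" using central_binomial_bounds(1)[of m] by (simp add: c_def)
  also have "\<dots> \<le> c\<^sup>2 * (2 * real N + 1)" using mN by (intro mult_left_mono) auto
  finally have "1 \<le> sqrt (c\<^sup>2 * (2 * real N + 1))" by simp
  then have "1 \<le> c * sqrt (2 * real N + 1)" by (simp add: real_sqrt_mult c_def)
  then have c: "1 / sqrt (2 * real N + 1) \<le> c"
    by (simp add: pos_divide_le_eq)
  have "real (N choose b) / 2 ^ N \<ge> (real (2 * m choose b) / 4 ^ m) / 2"
  proof (cases "even N")
    case True
    then have "N = 2 * m" by (simp add: m_def)
    then have "real (N choose b) / 2 ^ N = real (2 * m choose b) / 4 ^ m"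
      by (simp add: power_mult)
    then show ?thesis by (simp add: field_simps)
  next
    case False
    then have N: "N = Suc (2 * m)" by (simp add: m_def)
    have "real (2 * m choose b) \<le> real (N choose b)" by (cases b) (auto simp: N)
    then have "real (2 * m choose b) / (4 ^ m * 2) \<le> real (N choose b) / (4 ^ m * 2)"
      by (rule divide_right_mono) simp
    then show ?thesis by (simp add: N power_mult)
  qed
  moreover have "exp (- 16 * (D + 1)\<^sup>2 / real N) / (2 * sqrt (2 * real N + 1))
     \<le> c * exp (- 16 * (D + 1)\<^sup>2 / real N) / 2"
    using c mult_right_mono[OF c, of "exp (- 16 * (D + 1)\<^sup>2 / real N)"] by simp
  ultimately show ?thesis using divide_right_mono[OF ge, of 2] by (meson order_trans zero_le_numeral)
qed

section \<open>Independent samples from a discrete law\<close>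

lemma nn_integral_pmf_swap:
  "(\<integral>\<^sup>+x. \<integral>\<^sup>+y. f x y \<partial>measure_pmf q \<partial>measure_pmf p) = (\<integral>\<^sup>+y. \<integral>\<^sup>+x. f x y \<partial>measure_pmf p \<partial>measure_pmf q)"
proof -
  have "(\<integral>\<^sup>+x. \<integral>\<^sup>+y. f x y \<partial>measure_pmf q \<partial>measure_pmf p) = (\<integral>\<^sup>+z. f (fst z) (snd z) \<partial>pair_pmf p q)"
    by (simp add: nn_integral_pair_pmf')
  also have "\<dots> = (\<integral>\<^sup>+z. f (snd z) (fst z) \<partial>pair_pmf q p)"
    by (subst pair_commute_pmf) (simp add: case_prod_unfold)
  also have "\<dots> = (\<integral>\<^sup>+y. \<integral>\<^sup>+x. f x y \<partial>measure_pmf p \<partial>measure_pmf q)"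
    by (simp add: nn_integral_pair_pmf')
  finally show ?thesis .
qed

lemma nn_integral_replicate_pmf_Suc:
  "(\<integral>\<^sup>+xs. f xs \<partial>replicate_pmf (Suc k) p) = (\<integral>\<^sup>+x. \<integral>\<^sup>+xs. f (x # xs) \<partial>replicate_pmf k p \<partial>p)"
  by simp

lemma nn_integral_replicate_pmf_add:
  "(\<integral>\<^sup>+xs. f xs \<partial>replicate_pmf (m + n) p)
     = (\<integral>\<^sup>+xs. \<integral>\<^sup>+ys. f (xs @ ys) \<partial>replicate_pmf n p \<partial>replicate_pmf m p)"
  by (simp add: replicate_pmf_distrib)

lemma length_replicate_pmf: "xs \<in> set_pmf (replicate_pmf k p) \<Longrightarrow> length xs = k"
  by (auto simp: set_replicate_pmf)

lemma pmf_replicate_pmf: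
  "pmf (replicate_pmf k p) xs = (if length xs = k then prod_list (map (pmf p) xs) else 0)"
proof (induction k arbitrary: xs)
  case (Suc k)
  have eq: "replicate_pmf (Suc k) p = map_pmf (\<lambda>(x, xs). x # xs) (pair_pmf p (replicate_pmf k p))"
    by (simp add: pair_pmf_def map_pmf_def bind_assoc_pmf bind_return_pmf)
  have inj: "inj (\<lambda>(x, xs). x # xs)" by (auto simp: inj_on_def)
  show ?case
  proof (cases xs)
    case Nil
    have "[] \<notin> set_pmf (replicate_pmf (Suc k) p)" using length_replicate_pmf by fastforce
    then show ?thesis using Nil by (metis length_0_conv nat.distinct(1) pmf_eq_0_set_pmf)
  next
    case (Cons y ys)
    have "pmf (replicate_pmf (Suc k) p) xs = pmf (pair_pmf p (replicate_pmf k p)) (y, ys)"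
      unfolding eq using pmf_map_inj'[OF inj, of _ "(y, ys)"] by (simp add: Cons)
    then show ?thesis using Suc[of ys] by (simp add: pmf_pair Cons)
  qed
qed (auto simp: indicator_def)

text \<open>The free offset \<open>c\<close> carries the induction: the centered value of the first
  sample is moved into \<open>c\<close>, and its cross term with \<open>c\<close> integrates to
  zero.\<close>

lemma nn_integral_sum_replicate_pmf_sq:
  fixes g :: "'a \<Rightarrow> real"
  assumes g: "integrable (measure_pmf p) g" "integrable (measure_pmf p) (\<lambda>x. (g x)\<^sup>2)"
  defines "m \<equiv> measure_pmf.expectation p g"
  shows "(\<integral>\<^sup>+xs. ennreal ((c + sum_list (map g xs) - real k * m)\<^sup>2) \<partial>replicate_pmf k p)
           = ennreal (c\<^sup>2 + real k * measure_pmf.variance p g)"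
proof (induction k arbitrary: c)
  case (Suc k)
  let ?V = "measure_pmf.variance p g"
  have V: "?V \<ge> 0" by simp
  have ig: "integrable (measure_pmf p) (\<lambda>x. (g x - m)\<^sup>2)"
    using g by (simp add: power2_diff)
  have "(\<integral>\<^sup>+xs. ennreal ((c + sum_list (map g xs) - real (Suc k) * m)\<^sup>2) \<partial>replicate_pmf (Suc k) p)
     = (\<integral>\<^sup>+x. \<integral>\<^sup>+xs. ennreal (((c + g x - m) + sum_list (map g xs) - real k * m)\<^sup>2) \<partial>replicate_pmf k p \<partial>p)"
    by (simp add: algebra_simps)
  also have "\<dots> = (\<integral>\<^sup>+x. ennreal ((c + g x - m)\<^sup>2 + real k * ?V) \<partial>p)"
    by (simp only: Suc.IH)
  also have "\<dots> = ennreal (measure_pmf.expectation p (\<lambda>x. (c + g x - m)\<^sup>2 + real k * ?V))"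
  proof (rule nn_integral_eq_integral)
    have "(\<lambda>x. (c + g x - m)\<^sup>2 + real k * ?V) = (\<lambda>x. (g x)\<^sup>2 + 2 * (c - m) * g x + ((c - m)\<^sup>2 + real k * ?V))"
      by (auto simp: power2_eq_square algebra_simps)
    then show "integrable (measure_pmf p) (\<lambda>x. (c + g x - m)\<^sup>2 + real k * ?V)"
      using g by simp
  qed (use V in auto)
  also have "measure_pmf.expectation p (\<lambda>x. (c + g x - m)\<^sup>2 + real k * ?V)
      = measure_pmf.expectation p (\<lambda>x. (g x - m)\<^sup>2 + (2 * c * (g x - m) + (c\<^sup>2 + real k * ?V)))"
    by (intro Bochner_Integration.integral_cong) (auto simp: power2_eq_square algebra_simps)
  also have "\<dots> = ?V + (2 * c * (measure_pmf.expectation p g - m) + (c\<^sup>2 + real k * ?V))"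
    using g ig unfolding m_def by (simp add: Bochner_Integration.integral_add)
  also have "\<dots> = c\<^sup>2 + real (Suc k) * ?V" by (simp add: m_def algebra_simps)
  finally show ?case .
qed simp

text \<open>Chebyshev's inequality, from the second moment with offset 0.\<close>

lemma prob_sum_replicate_pmf_deviation:
  fixes g :: "'a \<Rightarrow> real"
  assumes g: "integrable (measure_pmf p) g" "integrable (measure_pmf p) (\<lambda>x. (g x)\<^sup>2)" and a: "a > 0"
  shows "measure_pmf.prob (replicate_pmf k p)
           {xs. \<bar>sum_list (map g xs) - real k * measure_pmf.expectation p g\<bar> \<ge> a}
         \<le> real k * measure_pmf.variance p g / a\<^sup>2"
proof -
  let ?m = "measure_pmf.expectation p g" and ?V = "measure_pmf.variance p g"
  let ?A = "{xs. \<bar>sum_list (map g xs) - real k * ?m\<bar> \<ge> a}"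
  have "ennreal (a\<^sup>2) * emeasure (replicate_pmf k p) ?A = (\<integral>\<^sup>+xs. ennreal (a\<^sup>2) * indicator ?A xs \<partial>replicate_pmf k p)"
    by (simp add: nn_integral_cmult)
  also have "\<dots> \<le> (\<integral>\<^sup>+xs. ennreal ((0 + sum_list (map g xs) - real k * ?m)\<^sup>2) \<partial>replicate_pmf k p)"
  proof (rule nn_integral_mono)
    fix xs
    show "ennreal (a\<^sup>2) * indicator ?A xs \<le> ennreal ((0 + sum_list (map g xs) - real k * ?m)\<^sup>2)"
      using a by (auto simp: indicator_def abs_le_square_iff[symmetric] intro!: ennreal_leI)
  qed
  also have "\<dots> = ennreal (real k * ?V)"
    using nn_integral_sum_replicate_pmf_sq[OF g, where c = 0 and k = k] by simp
  finally have "ennreal (a\<^sup>2 * measure_pmf.prob (replicate_pmf k p) ?A) \<le> ennreal (real k * ?V)"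
    by (simp add: measure_pmf.emeasure_eq_measure ennreal_mult)
  then have "a\<^sup>2 * measure_pmf.prob (replicate_pmf k p) ?A \<le> real k * ?V"
    by (subst (asm) ennreal_le_iff) auto
  then show ?thesis using a by (simp add: field_simps)
qed

section \<open>Change of measure by Jensen's inequality\<close>

lemma exp_le_quadratic:
  fixes y :: real
  assumes "\<bar>y\<bar> \<le> 1"
  shows "exp y \<le> 1 + y + y\<^sup>2"
proof (cases "y \<ge> 0")
  case False
  define z where "z = - y"
  have z: "z \<ge> 0" using False by (simp add: z_def)
  \<comment> \<open>Multiplied by \<open>1 - z + z^2\<close>, the quadratic lower bound of
    \<open>exp z\<close> leaves only nonnegative terms beyond 1. This turns it into an upper bound
    of \<open>exp (- z)\<close>.\<close>
  have "1 \<le> (1 - z + z\<^sup>2) * (1 + z + z\<^sup>2 / 2)"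
  proof -
    have "(1 - z + z\<^sup>2) * (1 + z + z\<^sup>2 / 2) = 1 + (z\<^sup>2 + z ^ 3 + z ^ 4) / 2"
      by (simp add: field_simps power2_eq_square power3_eq_cube power4_eq_xxxx)
    then show ?thesis using z by simp
  qed
  also have "\<dots> \<le> (1 - z + z\<^sup>2) * exp z"
  proof (rule mult_left_mono)
    show "1 + z + z\<^sup>2 / 2 \<le> exp z" using exp_lower_Taylor_quadratic[OF z] by simp
    have "0 \<le> (1 - z)\<^sup>2 + z" using z by simp
    then show "0 \<le> 1 - z + z\<^sup>2" using z by (simp add: power2_eq_square algebra_simps)
  qed
  finally have "exp (- z) \<le> 1 - z + z\<^sup>2" by (simp add: exp_minus field_simps)
  then show ?thesis by (simp add: z_def)
qed (use assms exp_bound[of y] in auto)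

text \<open>A crude form of Hoeffding's lemma: since \<open>f\<close> is centered, the quadratic
  bound for \<open>exp\<close> loses its linear term under the integral. The condition on
  \<open>\<theta>\<close> keeps the argument in the range of that bound.\<close>

lemma nn_integral_exp_centered:
  fixes f :: "'a \<Rightarrow> real"
  assumes bd: "\<And>x. \<bar>f x\<bar> \<le> R" and "measure_pmf.expectation p f = 0" and "\<bar>\<theta>\<bar> * R \<le> 1"
  shows "(\<integral>\<^sup>+x. ennreal (exp (\<theta> * f x)) \<partial>measure_pmf p) \<le> ennreal (exp (\<theta>\<^sup>2 * R\<^sup>2))"
proof -
  have int: "integrable (measure_pmf p) f"
    by (rule measure_pmf.integrable_const_bound[where B = R]) (use bd in auto)
  have "(\<integral>\<^sup>+x. ennreal (exp (\<theta> * f x)) \<partial>measure_pmf p) \<le> (\<integral>\<^sup>+x. ennreal (1 + \<theta> * f x + \<theta>\<^sup>2 * R\<^sup>2) \<partial>measure_pmf p)"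
  proof (rule nn_integral_mono)
    fix x
    have "\<bar>\<theta> * f x\<bar> \<le> \<bar>\<theta>\<bar> * R" using bd[of x] by (simp add: abs_mult mult_left_mono)
    then have "exp (\<theta> * f x) \<le> 1 + \<theta> * f x + (\<theta> * f x)\<^sup>2"
      using assms(3) by (intro exp_le_quadratic) linarith
    moreover have "(f x)\<^sup>2 \<le> R\<^sup>2" using bd[of x] by (metis abs_le_square_iff abs_ge_self order_trans)
    then have "(\<theta> * f x)\<^sup>2 \<le> \<theta>\<^sup>2 * R\<^sup>2" by (simp add: power_mult_distrib mult_left_mono)
    ultimately show "ennreal (exp (\<theta> * f x)) \<le> ennreal (1 + \<theta> * f x + \<theta>\<^sup>2 * R\<^sup>2)"
      by (intro ennreal_leI) linarith
  qed
  also have "\<dots> = ennreal (measure_pmf.expectation p (\<lambda>x. 1 + \<theta> * f x + \<theta>\<^sup>2 * R\<^sup>2))"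
  proof (rule nn_integral_eq_integral)
    show "AE x in measure_pmf p. 0 \<le> 1 + \<theta> * f x + \<theta>\<^sup>2 * R\<^sup>2"
    proof (rule AE_I2)
      fix x
      have "\<bar>\<theta> * f x\<bar> \<le> \<bar>\<theta>\<bar> * R" using bd[of x] by (simp add: abs_mult mult_left_mono)
      then have "- 1 \<le> \<theta> * f x" using assms(3) by linarith
      then show "0 \<le> 1 + \<theta> * f x + \<theta>\<^sup>2 * R\<^sup>2" by (smt (verit) mult_nonneg_nonneg zero_le_power2)
    qed
  qed (use int in simp)
  also have "measure_pmf.expectation p (\<lambda>x. 1 + \<theta> * f x + \<theta>\<^sup>2 * R\<^sup>2) = 1 + \<theta>\<^sup>2 * R\<^sup>2"
    using int assms(2) by (simp add: Bochner_Integration.integral_add)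
  also have "\<dots> \<le> exp (\<theta>\<^sup>2 * R\<^sup>2)" by (rule exp_ge_add_one_self)
  finally show ?thesis by (simp add: ennreal_leI)
qed

text \<open>The tangent inequality \<open>exp y \<ge> 1 + y\<close> at
  \<open>y = X - ln (K * c)\<close> is integrated against \<open>\<mu>\<close>, whose exponential
  moment is at most \<open>K * c\<close> by domination. The density bound enters only as
  \<open>ln K\<close>, so it may be exponentially large. Finite support settles integrability under
  \<open>\<mu>\<close>.\<close>

lemma expectation_le_ln_exp_moment:
  fixes X :: "'a \<Rightarrow> real"
  assumes "finite (set_pmf \<mu>)" and K: "K > 0" "c > 0"
    and dom: "\<And>x. pmf \<mu> x \<le> K * pmf \<nu> x"
    and mom: "(\<integral>\<^sup>+x. ennreal (exp (X x)) \<partial>measure_pmf \<nu>) \<le> ennreal c"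
  shows "measure_pmf.expectation \<mu> X \<le> ln (K * c)"
proof -
  let ?L = "ln (K * c)"
  have "(\<integral>\<^sup>+x. ennreal (exp (X x)) \<partial>measure_pmf \<mu>)
      = (\<integral>\<^sup>+x. ennreal (pmf \<mu> x) * ennreal (exp (X x)) \<partial>count_space UNIV)"
    by (rule nn_integral_measure_pmf)
  also have "\<dots> \<le> (\<integral>\<^sup>+x. ennreal K * (ennreal (pmf \<nu> x) * ennreal (exp (X x))) \<partial>count_space UNIV)"
    using dom K by (intro nn_integral_mono) (auto simp: mult.assoc[symmetric] ennreal_mult[symmetric] intro!: ennreal_leI mult_right_mono)
  also have "\<dots> = ennreal K * (\<integral>\<^sup>+x. ennreal (exp (X x)) \<partial>measure_pmf \<nu>)"
    by (simp add: nn_integral_cmult nn_integral_measure_pmf)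
  also have "\<dots> \<le> ennreal K * ennreal c" by (rule mult_left_mono[OF mom]) simp
  also have "\<dots> = ennreal (K * c)" using K by (simp add: ennreal_mult)
  finally have "ennreal (measure_pmf.expectation \<mu> (\<lambda>x. exp (X x))) \<le> ennreal (K * c)"
    by (subst (asm) nn_integral_eq_integral) (auto intro: integrable_measure_pmf_finite assms)
  then have le: "measure_pmf.expectation \<mu> (\<lambda>x. exp (X x)) \<le> K * c"
    using K by (subst (asm) ennreal_le_iff) auto
  have "measure_pmf.expectation \<mu> (\<lambda>x. 1 + (X x - ?L)) \<le> measure_pmf.expectation \<mu> (\<lambda>x. exp (X x - ?L))"
    by (intro integral_mono integrable_measure_pmf_finite assms) (rule exp_ge_add_one_self)
  also have "\<dots> = measure_pmf.expectation \<mu> (\<lambda>x. exp (X x)) / (K * c)"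
    using K by (simp add: exp_diff)
  also have "\<dots> \<le> 1" using le K by simp
  finally show ?thesis
    by (simp add: Bochner_Integration.integral_add Bochner_Integration.integral_diff integrable_measure_pmf_finite assms)
qed

text \<open>The exponential of \<open>\<theta> * \<bar>X\<bar>\<close> is at most the sum of the two
  one-sided exponentials, which costs \<open>ln 2\<close>.\<close>

lemma abs_expectation_le_ln_exp_moment:
  fixes X :: "'a \<Rightarrow> real"
  assumes "finite (set_pmf \<mu>)" and "\<theta> > 0"
    and dom: "\<And>x. pmf \<mu> x \<le> exp L * pmf \<nu> x"
    and mom: "(\<integral>\<^sup>+x. ennreal (exp (\<theta> * X x)) \<partial>measure_pmf \<nu>) \<le> ennreal (exp c)"
      "(\<integral>\<^sup>+x. ennreal (exp (- \<theta> * X x)) \<partial>measure_pmf \<nu>) \<le> ennreal (exp c)"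
  shows "measure_pmf.expectation \<mu> (\<lambda>x. \<bar>X x\<bar>) \<le> (L + c + ln 2) / \<theta>"
proof -
  have "(\<integral>\<^sup>+x. ennreal (exp (\<theta> * \<bar>X x\<bar>)) \<partial>measure_pmf \<nu>)
     \<le> (\<integral>\<^sup>+x. ennreal (exp (\<theta> * X x)) + ennreal (exp (- \<theta> * X x)) \<partial>measure_pmf \<nu>)"
    by (intro nn_integral_mono) (auto simp: abs_if)
  also have "\<dots> = (\<integral>\<^sup>+x. ennreal (exp (\<theta> * X x)) \<partial>measure_pmf \<nu>) + (\<integral>\<^sup>+x. ennreal (exp (- \<theta> * X x)) \<partial>measure_pmf \<nu>)"
    by (simp add: nn_integral_add)
  also have "\<dots> \<le> ennreal (exp c) + ennreal (exp c)" using mom by (rule add_mono)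
  also have "\<dots> = ennreal (2 * exp c)" by (simp flip: ennreal_plus)
  finally have "measure_pmf.expectation \<mu> (\<lambda>x. \<theta> * \<bar>X x\<bar>) \<le> ln (exp L * (2 * exp c))"
    using assms(1) dom by (intro expectation_le_ln_exp_moment) auto
  then show ?thesis using \<open>\<theta> > 0\<close> by (simp add: ln_mult field_simps)
qed

lemma nn_integral_exp_sum_list_replicate_pmf:
  fixes f :: "'a \<Rightarrow> real"
  assumes "\<And>x. \<bar>f x\<bar> \<le> R" and "measure_pmf.expectation p f = 0" and "\<bar>\<theta>\<bar> * R \<le> 1"
  shows "(\<integral>\<^sup>+xs. ennreal (exp (\<theta> * sum_list (map f xs))) \<partial>replicate_pmf k p) \<le> ennreal (exp (real k * (\<theta>\<^sup>2 * R\<^sup>2)))"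
proof (induction k)
  case (Suc k)
  have "(\<integral>\<^sup>+xs. ennreal (exp (\<theta> * sum_list (map f xs))) \<partial>replicate_pmf (Suc k) p)
     = (\<integral>\<^sup>+x. \<integral>\<^sup>+xs. ennreal (exp (\<theta> * f x)) * ennreal (exp (\<theta> * sum_list (map f xs))) \<partial>replicate_pmf k p \<partial>p)"
    by (simp add: distrib_left exp_add ennreal_mult)
  also have "\<dots> = (\<integral>\<^sup>+x. ennreal (exp (\<theta> * f x)) \<partial>p) * (\<integral>\<^sup>+xs. ennreal (exp (\<theta> * sum_list (map f xs))) \<partial>replicate_pmf k p)"
    by (simp add: nn_integral_cmult nn_integral_multc)
  also have "\<dots> \<le> ennreal (exp (\<theta>\<^sup>2 * R\<^sup>2)) * ennreal (exp (real k * (\<theta>\<^sup>2 * R\<^sup>2)))"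
    by (intro mult_mono Suc.IH nn_integral_exp_centered assms) auto
  also have "\<dots> = ennreal (exp (real (Suc k) * (\<theta>\<^sup>2 * R\<^sup>2)))"
    by (simp add: exp_add distrib_right flip: ennreal_mult)
  finally show ?case .
qed simp

text \<open>Concentration transferred from the product law to a dominated one: \<open>L\<close> is
  the price of the change of measure, the second term is the fluctuation under independence. The
  parameter \<open>\<theta>\<close> stays free, to be balanced against a growing \<open>R\<close>
  later.\<close>

lemma expectation_abs_sum_list_le:
  fixes f :: "'a \<Rightarrow> real"
  assumes fin: "finite (set_pmf \<mu>)" and dom: "\<And>xs. pmf \<mu> xs \<le> exp L * pmf (replicate_pmf k p) xs"
    and bd: "\<And>x. \<bar>f x - measure_pmf.expectation p f\<bar> \<le> R" and "\<theta> > 0" "\<theta> * R \<le> 1"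
  shows "measure_pmf.expectation \<mu> (\<lambda>xs. \<bar>sum_list (map f xs) - real k * measure_pmf.expectation p f\<bar>)
          \<le> (L + real k * (\<theta>\<^sup>2 * R\<^sup>2) + ln 2) / \<theta>"
proof -
  let ?m = "measure_pmf.expectation p f"
  let ?g = "\<lambda>x. f x - ?m"
  have "\<bar>f x\<bar> \<le> R + \<bar>?m\<bar>" for x using bd[of x] by linarith
  then have "integrable (measure_pmf p) f"
    by (intro measure_pmf.integrable_const_bound[where B = "R + \<bar>?m\<bar>"]) auto
  then have zero: "measure_pmf.expectation p ?g = 0" by simp
  have "measure_pmf.expectation \<mu> (\<lambda>xs. \<bar>sum_list (map ?g xs)\<bar>) \<le> (L + real k * (\<theta>\<^sup>2 * R\<^sup>2) + ln 2) / \<theta>"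
    using nn_integral_exp_sum_list_replicate_pmf[OF bd zero, of \<theta> k]
      nn_integral_exp_sum_list_replicate_pmf[OF bd zero, of "- \<theta>" k] assms
    by (intro abs_expectation_le_ln_exp_moment[where \<nu> = "replicate_pmf k p"] fin) auto
  also have "measure_pmf.expectation \<mu> (\<lambda>xs. \<bar>sum_list (map ?g xs)\<bar>)
     = measure_pmf.expectation \<mu> (\<lambda>xs. \<bar>sum_list (map f xs) - real k * ?m\<bar>)"
  proof (intro integral_cong_AE)
    show "AE xs in measure_pmf \<mu>. \<bar>sum_list (map ?g xs)\<bar> = \<bar>sum_list (map f xs) - real k * ?m\<bar>"
    proof (subst AE_measure_pmf_iff, intro ballI)
      fix xs assume "xs \<in> set_pmf \<mu>"
      \<comment> \<open>Domination places the support of \<open>\<mu>\<close> on lists of length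
        \<open>k\<close>, so that centering every entry subtracts exactly \<open>k\<close> times the
        mean.\<close>
      then have "pmf \<mu> xs > 0" by (simp add: pmf_positive)
      then have "pmf (replicate_pmf k p) xs > 0"
        using dom[of xs] by (smt (verit) exp_gt_zero mult_eq_0_iff pmf_nonneg)
      then have "length xs = k" by (metis length_replicate_pmf pmf_eq_0_set_pmf less_irrefl)
      then show "\<bar>sum_list (map ?g xs)\<bar> = \<bar>sum_list (map f xs) - real k * ?m\<bar>"
        by (simp add: sum_list_subtractf sum_list_triv)
    qed
  qed auto
  finally show ?thesis .
qed

section \<open>Total variation of exchangeable marginals\<close>

text \<open>The set where \<open>p\<close> exceeds \<open>q\<close> attains the distance: both
  masses are 1, so the positive and the negative part of the difference have equal totals, and the
  factor 1/2 leaves one of them. The distance thus becomes a difference of expectations of one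
  bounded function.\<close>

lemma tv_dist_eq_prob_diff: "\<exists>A. tv_dist p q = measure_pmf.prob p A - measure_pmf.prob q A"
proof -
  define A where "A = {z. pmf p z > pmf q z}"
  have sp: "pmf p summable_on B" and sq: "pmf q summable_on B" for B :: "'a set" and p q
    using pmf_abs_summable abs_summable_equivalent abs_summable_summable by blast+
  have meas: "infsum (pmf p) B = measure_pmf.prob p B" for B :: "'a set" and p
    by (simp add: measure_pmf_conv_infsetsum infsetsum_infsum pmf_abs_summable)
  have diff: "(\<Sum>\<^sub>\<infinity>z\<in>B. pmf p z - pmf q z) = measure_pmf.prob p B - measure_pmf.prob q B" for B :: "'a set" and p q
    using infsum_add[OF sp summable_on_uminus[THEN iffD2, OF sq], where A = B]
    by (simp add: infsum_uminus meas)
  have "(\<Sum>\<^sub>\<infinity>z. \<bar>pmf p z - pmf q z\<bar>) = (\<Sum>\<^sub>\<infinity>z\<in>A. \<bar>pmf p z - pmf q z\<bar>) + (\<Sum>\<^sub>\<infinity>z\<in>-A. \<bar>pmf p z - pmf q z\<bar>)"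
  proof -
    have 1: "(\<lambda>z. pmf p z - pmf q z) summable_on A" "(\<lambda>z. pmf q z - pmf p z) summable_on -A"
      using summable_on_add[OF sp summable_on_uminus[THEN iffD2, OF sq]] summable_on_add[OF sq summable_on_uminus[THEN iffD2, OF sp]] by simp_all
    have "(\<lambda>z. \<bar>pmf p z - pmf q z\<bar>) summable_on A"
      using 1(1) by (rule summable_on_cong[THEN iffD1, rotated]) (auto simp: A_def)
    moreover have "(\<lambda>z. \<bar>pmf p z - pmf q z\<bar>) summable_on -A"
      using 1(2) by (rule summable_on_cong[THEN iffD1, rotated]) (auto simp: A_def)
    ultimately show ?thesis using infsum_Un_disjoint[of _ A "-A"] by (metis Compl_disjoint Compl_partition)
  qed
  also have "(\<Sum>\<^sub>\<infinity>z\<in>A. \<bar>pmf p z - pmf q z\<bar>) = (\<Sum>\<^sub>\<infinity>z\<in>A. pmf p z - pmf q z)"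
    by (intro infsum_cong) (auto simp: A_def)
  also have "\<dots> = measure_pmf.prob p A - measure_pmf.prob q A"
    by (rule diff)
  also have "(\<Sum>\<^sub>\<infinity>z\<in>-A. \<bar>pmf p z - pmf q z\<bar>) = (\<Sum>\<^sub>\<infinity>z\<in>-A. pmf q z - pmf p z)"
    by (intro infsum_cong) (auto simp: A_def)
  also have "\<dots> = measure_pmf.prob q (-A) - measure_pmf.prob p (-A)"
    by (rule diff)
  also have "\<dots> = measure_pmf.prob p A - measure_pmf.prob q A"
    using measure_pmf.prob_compl[of A p] measure_pmf.prob_compl[of A q] by (simp add: Compl_eq_Diff_UNIV)
  finally show ?thesis by (intro exI[of _ A]) (simp add: tv_dist_def)
qed

definition block_sum :: "('a list \<Rightarrow> real) \<Rightarrow> nat \<Rightarrow> nat \<Rightarrow> 'a list \<Rightarrow> real" where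
  "block_sum f r B xs = (\<Sum>b<B. f (take r (drop (b * r) xs)))"

text \<open>Under the product law the blocks are independent, and the first one is split off. The
  parameter \<open>s\<close> stands for the positions behind the last complete block, so the total
  length need not be a multiple of \<open>r\<close>.\<close>

lemma nn_integral_exp_block_sum:
  fixes f :: "'a list \<Rightarrow> real"
  assumes "\<And>x. \<bar>f x\<bar> \<le> 1" and "measure_pmf.expectation (replicate_pmf r p) f = 0" and "\<bar>\<theta>\<bar> \<le> 1"
  shows "(\<integral>\<^sup>+xs. ennreal (exp (\<theta> * block_sum f r B xs)) \<partial>replicate_pmf (B * r + s) p) \<le> ennreal (exp (real B * \<theta>\<^sup>2))"
proof (induction B)
  case (Suc B)
  let ?p = "\<lambda>k. replicate_pmf k p"
  have split: "block_sum f r (Suc B) (xs @ ys) = f xs + block_sum f r B ys" if "length xs = r" for xs ys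
  proof -
    have "block_sum f r (Suc B) (xs @ ys) = f (take r (xs @ ys)) + (\<Sum>b<B. f (take r (drop (Suc b * r) (xs @ ys))))"
      unfolding block_sum_def by (subst sum.lessThan_Suc_shift) simp
    then show ?thesis using that by (simp add: block_sum_def)
  qed
  have "(\<integral>\<^sup>+xs. ennreal (exp (\<theta> * block_sum f r (Suc B) xs)) \<partial>?p (Suc B * r + s))
     = (\<integral>\<^sup>+xs. \<integral>\<^sup>+ys. ennreal (exp (\<theta> * block_sum f r (Suc B) (xs @ ys))) \<partial>?p (B * r + s) \<partial>?p r)"
    using nn_integral_replicate_pmf_add[where m = r and n = "B * r + s" and p = p] by (simp add: add.assoc)
  also have "\<dots> = (\<integral>\<^sup>+xs. \<integral>\<^sup>+ys. ennreal (exp (\<theta> * f xs)) * ennreal (exp (\<theta> * block_sum f r B ys)) \<partial>?p (B * r + s) \<partial>?p r)"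
    by (intro nn_integral_cong_AE)
      (auto simp: AE_measure_pmf_iff split length_replicate_pmf distrib_left exp_add ennreal_mult)
  also have "\<dots> = (\<integral>\<^sup>+xs. ennreal (exp (\<theta> * f xs)) \<partial>?p r) * (\<integral>\<^sup>+ys. ennreal (exp (\<theta> * block_sum f r B ys)) \<partial>?p (B * r + s))"
    by (simp add: nn_integral_cmult nn_integral_multc)
  also have "\<dots> \<le> ennreal (exp (\<theta>\<^sup>2 * 1\<^sup>2)) * ennreal (exp (real B * \<theta>\<^sup>2))"
    using assms by (intro mult_mono Suc.IH nn_integral_exp_centered) auto
  also have "\<dots> = ennreal (exp (real (Suc B) * \<theta>\<^sup>2))"
    by (simp add: exp_add distrib_right flip: ennreal_mult)
  finally show ?case .
qed (simp add: block_sum_def)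

text \<open>Exchangeability enters as invariance under cyclic rotation: rotating by
  \<open>b * r\<close> brings block \<open>b\<close> to the front.\<close>

lemma expectation_block_eq:
  fixes f :: "'a list \<Rightarrow> real"
  assumes len: "\<And>xs. xs \<in> set_pmf \<mu> \<Longrightarrow> length xs = k"
    and rot: "\<And>m xs. pmf \<mu> (rotate m xs) = pmf \<mu> xs" and b: "(b + 1) * r \<le> k"
  shows "measure_pmf.expectation \<mu> (\<lambda>xs. f (take r (drop (b * r) xs)))
     = measure_pmf.expectation \<mu> (\<lambda>xs. f (take r xs))"
proof -
  have bij: "bij (rotate m :: 'a list \<Rightarrow> 'a list)" for m
    unfolding rotate_def by (intro bij_betw_funpow bij_rotate1)
  have inj: "inj (rotate m :: 'a list \<Rightarrow> 'a list)" for m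
    using bij by (rule bij_is_inj)
  have surj: "surj (rotate m :: 'a list \<Rightarrow> 'a list)" for m using bij by (rule bij_is_surj)
  have "map_pmf (rotate (b * r)) \<mu> = \<mu>"
  proof (rule pmf_eqI)
    fix xs :: "'a list"
    obtain ys where ys: "xs = rotate (b * r) ys" using surjD[OF surj, of xs "b * r"] by blast
    then show "pmf (map_pmf (rotate (b * r)) \<mu>) xs = pmf \<mu> xs"
      using pmf_map_inj'[OF inj] rot by simp
  qed
  then have "measure_pmf.expectation \<mu> (\<lambda>xs. f (take r xs))
      = measure_pmf.expectation (map_pmf (rotate (b * r)) \<mu>) (\<lambda>xs. f (take r xs))" by simp
  also have "\<dots> = measure_pmf.expectation \<mu> (\<lambda>xs. f (take r (rotate (b * r) xs)))" by simp
  also have "\<dots> = measure_pmf.expectation \<mu> (\<lambda>xs. f (take r (drop (b * r) xs)))"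
  proof (intro integral_cong_AE)
    show "AE xs in measure_pmf \<mu>. f (take r (rotate (b * r) xs)) = f (take r (drop (b * r) xs))"
    proof (subst AE_measure_pmf_iff, intro ballI)
      fix xs assume "xs \<in> set_pmf \<mu>"
      then have l: "length xs = k" by (rule len)
      have "rotate (b * r) xs = drop (b * r) xs @ take (b * r) xs"
      proof (cases "b * r < k")
        case True
        then show ?thesis using l by (simp add: rotate_drop_take)
      next
        case False
        then have "b * r = k" "r = 0" using b by auto
        then show ?thesis using l by simp
      qed
      then show "f (take r (rotate (b * r) xs)) = f (take r (drop (b * r) xs))"
        using b l by (simp add: algebra_simps)
    qed
  qed auto
  finally show ?thesis by simp
qed

text \<open>Replaces Pinsker's inequality together with superadditivity of relative entropy over blocks:
  the centered indicator of a set of \<open>r\<close>-tuples is summed over the disjoint blocks of length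
  \<open>r\<close>, and the change of measure costs \<open>L\<close> only once.\<close>

lemma tv_dist_marginal_le:
  assumes fin: "finite (set_pmf \<mu>)" and len: "\<And>xs. xs \<in> set_pmf \<mu> \<Longrightarrow> length xs = k"
    and rot: "\<And>m xs. pmf \<mu> (rotate m xs) = pmf \<mu> xs"
    and dom: "\<And>xs. pmf \<mu> xs \<le> exp L * pmf (replicate_pmf k p) xs"
    and r: "1 \<le> r" "r \<le> k" and L: "L > 0"
  shows "tv_dist (map_pmf (take r) \<mu>) (replicate_pmf r p) \<le> 2 * sqrt (L / real (k div r))"
proof -
  define B where "B = k div r"
  have B: "B \<ge> 1" using r by (simp add: B_def Suc_leI div_greater_zero_iff)
  obtain A where A: "tv_dist (map_pmf (take r) \<mu>) (replicate_pmf r p)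
      = measure_pmf.prob (map_pmf (take r) \<mu>) A - measure_pmf.prob (replicate_pmf r p) A" (is "?t = ?a - ?b")
    using tv_dist_eq_prob_diff by blast
  \<comment> \<open>The density costs \<open>L\<close> and the exponential moment
    \<open>B * \<theta>^2\<close>; this choice makes them equal. If it exceeds 1, the claimed bound
    is above 1 and therefore trivial.\<close>
  define \<theta> where "\<theta> = sqrt (L / B)"
  have \<theta>: "\<theta> > 0" using L B by (simp add: \<theta>_def)
  show ?thesis
  proof (cases "\<theta> \<le> 1")
    case False
    have "?t \<le> 1" using A measure_pmf.prob_le_1[of "map_pmf (take r) \<mu>" A] by (smt (verit) measure_nonneg)
    then show ?thesis using False unfolding \<theta>_def B_def by linarith
  next
    case True
    define f where "f = (\<lambda>xs. indicator A xs - ?b)"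
    have f1: "\<bar>f x\<bar> \<le> 1" for x
      using measure_pmf.prob_le_1[of "replicate_pmf r p" A] measure_nonneg[of "replicate_pmf r p" A]
      by (auto simp: f_def indicator_def)
    have f0: "measure_pmf.expectation (replicate_pmf r p) f = 0"
      by (simp add: f_def measure_pmf.integrable_const_bound[where B = 1])
    have k: "k = B * r + k mod r" by (simp add: B_def)
    have mom: "(\<integral>\<^sup>+xs. ennreal (exp (\<theta> * block_sum f r B xs)) \<partial>replicate_pmf k p) \<le> ennreal (exp (real B * \<theta>\<^sup>2))"
      using nn_integral_exp_block_sum[OF f1 f0, of \<theta> B "k mod r"] True \<theta> k by simp
    have "measure_pmf.expectation \<mu> (\<lambda>xs. \<theta> * block_sum f r B xs) \<le> ln (exp L * exp (real B * \<theta>\<^sup>2))"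
      by (rule expectation_le_ln_exp_moment[OF fin _ _ dom mom]) auto
    also have "\<dots> = L + real B * \<theta>\<^sup>2" by (simp flip: exp_add)
    also have "measure_pmf.expectation \<mu> (\<lambda>xs. \<theta> * block_sum f r B xs)
        = \<theta> * (\<Sum>b<B. measure_pmf.expectation \<mu> (\<lambda>xs. f (take r (drop (b * r) xs))))"
      unfolding block_sum_def by (simp add: integrable_measure_pmf_finite fin)
    also have "(\<Sum>b<B. measure_pmf.expectation \<mu> (\<lambda>xs. f (take r (drop (b * r) xs))))
        = (\<Sum>b<B. measure_pmf.expectation \<mu> (\<lambda>xs. f (take r xs)))"
    proof (intro sum.cong refl)
      fix b assume "b \<in> {..<B}"
      then have "(b + 1) * r \<le> B * r" by (intro mult_right_mono) auto
      then have "(b + 1) * r \<le> k" using k by linarith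
      then show "measure_pmf.expectation \<mu> (\<lambda>xs. f (take r (drop (b * r) xs))) = measure_pmf.expectation \<mu> (\<lambda>xs. f (take r xs))"
        by (intro expectation_block_eq[OF len rot])
    qed
    also have "measure_pmf.expectation \<mu> (\<lambda>xs. f (take r xs)) = measure_pmf.expectation (map_pmf (take r) \<mu>) f"
      by simp
    also have "\<dots> = ?a - ?b"
      unfolding f_def by (subst Bochner_Integration.integral_diff)
        (auto intro!: measure_pmf.integrable_const_bound[where B = 1])
    finally have "\<theta> * (real B * ?t) \<le> L + real B * \<theta>\<^sup>2" using A by simp
    moreover have "real B * \<theta>\<^sup>2 = L" using L B by (simp add: \<theta>_def)
    ultimately have "\<theta> * real B * ?t \<le> \<theta> * real B * (2 * \<theta>)" by (simp add: power2_eq_square algebra_simps)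
    moreover have "\<theta> * real B > 0" using \<theta> B by simp
    ultimately have "?t \<le> 2 * \<theta>" by (meson mult_le_cancel_left_pos)
    then show ?thesis by (simp add: \<theta>_def B_def)
  qed
qed

section \<open>A concentration bound and a local lower bound\<close>

lemma profile_nonneg: "profile j \<ge> 0"
  by (simp add: profile_def)

lemma profile_small: "profile 0 = 0" "profile 1 = 0" "profile (Suc 0) = 0" "profile 2 = ln 2" "profile 3 = ln 6"
  by (simp_all add: profile_def fact_numeral)

lemma profile_Suc: "profile (Suc j) = profile j + ln (real (Suc j))"
  by (simp add: profile_def ln_mult algebra_simps del: of_nat_Suc)

lemma profile_le_sq: "profile j \<le> (real j)\<^sup>2"
proof (induction j)
  case (Suc j)
  have "ln (real (Suc j)) \<le> real j" using ln_le_minus_one[of "real (Suc j)"] by simp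
  then show ?case using Suc by (simp only: profile_Suc) (simp add: power2_eq_square algebra_simps)
qed (simp add: profile_small)

text \<open>\<open>ln (3/2)\<close> is the change of the profile when one step from 1 to 3 replaces
  two steps from 1 to 2, which keeps the sum. The lower bound limits how many such exchanges fit
  into the window, the upper bound lets rounding stay inside it.\<close>

lemma ln_three_halves: "ln (3/2::real) \<ge> 1/3" "ln (3/2::real) \<le> 1/2"
proof -
  have "ln (3/2::real) = - ln (2/3)" by (simp add: ln_div)
  then show "ln (3/2::real) \<ge> 1/3" using ln_le_minus_one[of "2/3::real"] by simp
qed (use ln_le_minus_one[of "3/2::real"] in simp)

lemma integrable_pmf_nat_iff:
  fixes f :: "nat \<Rightarrow> real"
  shows "integrable (measure_pmf q) f \<longleftrightarrow> summable (\<lambda>j. pmf q j * \<bar>f j\<bar>)"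
  unfolding measure_pmf_eq_density
  by (subst integrable_density) (auto simp: integrable_count_space_nat_iff abs_mult)

lemma expectation_pmf_nat_sums:
  fixes f :: "nat \<Rightarrow> real"
  assumes "integrable (measure_pmf q) f"
  shows "(\<lambda>j. pmf q j * f j) sums measure_pmf.expectation q f"
proof -
  have "integrable (count_space UNIV) (\<lambda>j. pmf q j * f j)"
    using assms by (simp add: integrable_pmf_nat_iff integrable_count_space_nat_iff abs_mult)
  moreover have "measure_pmf.expectation q f = (\<integral>j. pmf q j * f j \<partial>count_space UNIV)"
    unfolding measure_pmf_eq_density by (subst integral_density) auto
  ultimately show ?thesis using sums_integral_count_space_nat by metis
qed

lemma pmf_nat_sums_1: "(pmf q) sums (1::real)" for q :: "nat pmf"
  using expectation_pmf_nat_sums[of q "\<lambda>_. 1"] by simp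

lemma nn_integral_pmf_nat: "(\<integral>\<^sup>+j. f j \<partial>measure_pmf q) = (\<Sum>j. ennreal (pmf q j) * f j)" for q :: "nat pmf"
  by (simp add: nn_integral_measure_pmf nn_integral_count_space_nat)

lemma half_add_half: "ennreal (1/2) * x + ennreal (1/2) * x = x"
proof -
  have "ennreal (1/2) * x + ennreal (1/2) * x = (ennreal (1/2) + ennreal (1/2)) * x"
    by (rule distrib_right[symmetric])
  also have "ennreal (1/2) + ennreal (1/2) = ennreal (1/2 + 1/2)" by (rule ennreal_plus[symmetric]) auto
  finally show ?thesis by simp
qed

text \<open>What the local estimates ask of a law: a geometric tail, which provides the moments, and
  mass at 1, 2 and 3, which provides both coins. All canonical laws with \<open>g \<le> 1\<close>
  qualify.\<close>

locale step_law =
  fixes q :: "nat pmf"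
  assumes pmf_le: "pmf q j \<le> 2 * (1/2) ^ j"
    and pmf_0: "pmf q 0 = 0"
    and pmf_123: "pmf q 1 > 0" "pmf q 2 > 0" "pmf q 3 > 0"
begin

text \<open>The exponent 4 covers the square of the profile, as \<open>profile j\<close> is at most
  the square of \<open>j\<close>.\<close>

lemma integrable_poly:
  assumes "\<And>j. \<bar>f j\<bar> \<le> real j ^ 4"
  shows "integrable (measure_pmf q) f"
proof -
  have "summable (\<lambda>j::nat. 2 * (1/2) ^ j * real j ^ 4)"
  proof (rule summable_comparison_test_bigo)
    show "summable (\<lambda>j. norm ((3/4::real) ^ j))" by (simp add: summable_geometric_iff)
    show "(\<lambda>j::nat. 2 * (1/2) ^ j * real j ^ 4) \<in> O(\<lambda>j. (3/4) ^ j)" by real_asymp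
  qed
  then have "summable (\<lambda>j. pmf q j * \<bar>f j\<bar>)"
    by (rule summable_comparison_test'[of _ 0]) (use pmf_le assms in \<open>auto intro!: mult_mono\<close>)
  then show ?thesis by (simp add: integrable_pmf_nat_iff)
qed

lemma power_le_power4: "i \<le> 4 \<Longrightarrow> i \<noteq> 0 \<Longrightarrow> real j ^ i \<le> real j ^ 4"
  by (cases "j = 0") (auto intro: power_increasing simp: power_0_left)

lemma integrable_moments:
  "integrable (measure_pmf q) real" "integrable (measure_pmf q) (\<lambda>j. (real j)\<^sup>2)"
  "integrable (measure_pmf q) profile" "integrable (measure_pmf q) (\<lambda>j. (profile j)\<^sup>2)"
proof -
  show "integrable (measure_pmf q) real" "integrable (measure_pmf q) (\<lambda>j. (real j)\<^sup>2)"
    using power_le_power4[of 1] power_le_power4[of 2] by (auto intro!: integrable_poly)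
  show "integrable (measure_pmf q) profile"
    using power_le_power4[of 2] profile_le_sq order_trans
    by (intro integrable_poly) (fastforce simp: profile_nonneg)
  have "(profile j)\<^sup>2 \<le> real j ^ 4" for j
    using power_mono[OF profile_le_sq[of j] profile_nonneg, of 2] by simp
  then show "integrable (measure_pmf q) (\<lambda>j. (profile j)\<^sup>2)"
    by (intro integrable_poly) auto
qed

text \<open>Each step is resampled in two stages: the type \<open>0\<close> stands for a fair choice from
  \<open>{1, 2}\<close>, the type \<open>1\<close> for a fair choice from \<open>{1, 3}\<close>, and the type \<open>j + 2\<close> for the
  value \<open>j\<close> itself. Given the types, all randomness sits in two independent binomials.\<close>

definition lam :: real where "lam = min (pmf q 1) (min (pmf q 2) (pmf q 3))"

text \<open>The part of \<open>q\<close> that is produced by the two coin types, each of mass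
  \<open>lam\<close>: both coins may show 1, which therefore receives \<open>lam\<close>, whereas 2
  and 3 receive \<open>lam / 2\<close>.\<close>

definition coin_part :: "nat \<Rightarrow> real" where
  "coin_part j = (if j = 1 then lam else if j = 2 \<or> j = 3 then lam / 2 else 0)"

definition types :: "nat pmf" where
  "types = embed_pmf (\<lambda>t. if t < 2 then lam else pmf q (t - 2) - coin_part (t - 2))"

definition reveal :: "nat \<Rightarrow> bool \<Rightarrow> nat" where
  "reveal t b = (if t = 0 then (if b then 2 else 1) else if t = 1 then (if b then 3 else 1) else t - 2)"

lemma lam: "lam > 0" "lam \<le> 1"
  using pmf_123 pmf_le_1[of q 1] by (auto simp: lam_def)

lemma coin_part: "0 \<le> coin_part j" "coin_part j \<le> pmf q j"
proof -
  have "lam \<le> pmf q 1" "lam \<le> pmf q 2" "lam \<le> pmf q 3" by (auto simp: lam_def)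
  then show "0 \<le> coin_part j" "coin_part j \<le> pmf q j" using lam by (auto simp: coin_part_def)
qed

lemma pmf_types: "pmf types t = (if t < 2 then lam else pmf q (t - 2) - coin_part (t - 2))"
  unfolding types_def
proof (rule pmf_embed_pmf)
  let ?f = "\<lambda>t. if t < 2 then lam else pmf q (t - 2) - coin_part (t - 2)"
  show nn: "0 \<le> ?f t" for t using lam coin_part by simp
  have "coin_part sums (\<Sum>j\<in>{1,2,3}. coin_part j)"
    by (rule sums_finite) (auto simp: coin_part_def)
  then have "coin_part sums (2 * lam)" by (simp add: coin_part_def)
  then have "(\<lambda>j. pmf q j - coin_part j) sums (1 - 2 * lam)"
    by (intro sums_diff pmf_nat_sums_1)
  then have "(\<lambda>j. ?f (Suc (Suc j))) sums (1 - 2 * lam)" by simp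
  from sums_Suc[OF sums_Suc[OF this]] have sums: "?f sums 1" by simp
  have "(\<integral>\<^sup>+ t. ennreal (?f t) \<partial>count_space UNIV) = (\<Sum>t. ennreal (?f t))"
    by (rule nn_integral_count_space_nat)
  also have "\<dots> = ennreal (\<Sum>t. ?f t)"
    by (rule suminf_ennreal2) (use sums nn in \<open>auto simp: sums_iff\<close>)
  finally show "(\<integral>\<^sup>+ t. ennreal (?f t) \<partial>count_space UNIV) = 1"
    using sums by (simp add: sums_iff)
qed

text \<open>Drawing a type and then a fair coin reproduces \<open>q\<close>. For the types from 2
  on, both sides of the coin reveal the same value and the two halves recombine; the types 0 and 1
  give back \<open>coin_part\<close>.\<close>

lemma nn_integral_types:
  "(\<integral>\<^sup>+j. f j \<partial>measure_pmf q)
     = (\<integral>\<^sup>+t. ennreal (1/2) * f (reveal t True) + ennreal (1/2) * f (reveal t False) \<partial>measure_pmf types)"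
proof -
  let ?F = "\<lambda>t. ennreal (1/2) * f (reveal t True) + ennreal (1/2) * f (reveal t False)"
  let ?r = "\<lambda>j. ennreal (pmf q j - coin_part j)"
  have half: "ennreal (1/2) * x + ennreal (1/2) * x = x" for x
    by (rule half_add_half)
  have "(\<integral>\<^sup>+j. f j \<partial>measure_pmf q) = (\<Sum>j. ?r j * f j + ennreal (coin_part j) * f j)"
    using coin_part by (simp add: nn_integral_pmf_nat distrib_right[symmetric] flip: ennreal_plus)
  also have "\<dots> = (\<Sum>j. ?r j * f j) + (\<Sum>j. ennreal (coin_part j) * f j)"
    by (intro suminf_add[symmetric]) auto
  also have "(\<Sum>j. ennreal (coin_part j) * f j) = (\<Sum>j\<in>{1,2,3}. ennreal (coin_part j) * f j)"
    by (rule suminf_finite) (auto simp: coin_part_def)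
  also have "\<dots> = ennreal lam * f 1 + (ennreal (lam/2) * f 2 + ennreal (lam/2) * f 3)"
    by (simp add: coin_part_def)
  also have "\<dots> = ennreal lam * ?F 0 + ennreal lam * ?F 1"
  proof -
    have "ennreal lam * f 1 = ennreal (lam/2) * f 1 + ennreal (lam/2) * f 1"
      using lam by (simp flip: distrib_right ennreal_plus)
    moreover have "ennreal (lam/2) = ennreal lam * ennreal (1/2)"
      using lam ennreal_mult[of lam "1/2"] by (metis less_imp_le mult.right_neutral times_divide_eq_right zero_le_divide_1_iff zero_le_numeral)
    ultimately show ?thesis
      by (simp add: reveal_def distrib_left mult.assoc add_ac)
  qed
  finally have "(\<integral>\<^sup>+j. f j \<partial>measure_pmf q) = (\<Sum>j. ?r j * f j) + (ennreal lam * ?F 0 + ennreal lam * ?F 1)" .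
  moreover have "(\<integral>\<^sup>+t. ?F t \<partial>measure_pmf types) = (\<Sum>t. ennreal (pmf types t) * ?F t)"
    by (rule nn_integral_pmf_nat)
  moreover have "\<dots> = (\<Sum>t. ennreal (pmf types (t + 2)) * ?F (t + 2)) + (\<Sum>t<2. ennreal (pmf types t) * ?F t)"
    by (rule suminf_offset) simp
  moreover have "(\<Sum>t. ennreal (pmf types (t + 2)) * ?F (t + 2)) = (\<Sum>j. ?r j * f j)"
    using half by (simp add: pmf_types reveal_def)
  moreover have "(\<Sum>t<2. ennreal (pmf types t) * ?F t) = ennreal lam * ?F 0 + ennreal lam * ?F 1"
    by (simp add: pmf_types numeral_2_eq_2)
  ultimately show ?thesis by simp
qed

text \<open>The contribution of a type to the sum, and with \<open>vbase\<close> to the profile,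
  when every coin shows its lower side 1, whose profile is 0.\<close>

definition base :: "nat \<Rightarrow> nat" where "base t = (if t < 2 then 1 else t - 2)"
definition vbase :: "nat \<Rightarrow> real" where "vbase t = (if t < 2 then 0 else profile (t - 2))"

abbreviation coin_bin :: "nat \<Rightarrow> nat list \<Rightarrow> nat pmf" where
  "coin_bin i ts \<equiv> binomial_pmf (count_list ts i) (1/2)"

lemma nn_integral_binomial_Suc:
  "(\<integral>\<^sup>+b. f b \<partial>binomial_pmf (Suc n) (1/2))
     = ennreal (1/2) * (\<integral>\<^sup>+b. f (Suc b) \<partial>binomial_pmf n (1/2)) + ennreal (1/2) * (\<integral>\<^sup>+b. f b \<partial>binomial_pmf n (1/2))"
  by (simp add: binomial_pmf_Suc mult.commute)

text \<open>Given the types, each success of the first binomial raises the sum by 1 and the profile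
  by \<open>ln 2\<close>; each success of the second raises them by 2 and \<open>ln 6\<close>. The
  function \<open>h\<close> is arbitrary so that the induction can absorb the first step into
  it.\<close>

lemma nn_integral_two_stage:
  fixes h :: "nat \<Rightarrow> real \<Rightarrow> ennreal"
  shows "(\<integral>\<^sup>+js. h (sum_list js) (sum_list (map profile js)) \<partial>replicate_pmf k q)
    = (\<integral>\<^sup>+ts. \<integral>\<^sup>+b1. \<integral>\<^sup>+b2. h (sum_list (map base ts) + b1 + 2 * b2)
          (sum_list (map vbase ts) + real b1 * ln 2 + real b2 * ln 6)
        \<partial>coin_bin 1 ts \<partial>coin_bin 0 ts \<partial>replicate_pmf k types)"
proof (induction k arbitrary: h)
  case (Suc k)
  let ?T = "\<lambda>h ts. \<integral>\<^sup>+b1. \<integral>\<^sup>+b2. h (sum_list (map base ts) + b1 + 2 * b2)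
          (sum_list (map vbase ts) + real b1 * ln 2 + real b2 * ln 6) \<partial>coin_bin 1 ts \<partial>coin_bin 0 ts"
  define G where "G = (\<lambda>j. \<integral>\<^sup>+ts. ?T (\<lambda>s v. h (j + s) (profile j + v)) ts \<partial>replicate_pmf k types)"
  have "(\<integral>\<^sup>+js. h (sum_list js) (sum_list (map profile js)) \<partial>replicate_pmf (Suc k) q)
      = (\<integral>\<^sup>+j. \<integral>\<^sup>+js. h (j + sum_list js) (profile j + sum_list (map profile js)) \<partial>replicate_pmf k q \<partial>q)"
    by simp
  also have "\<dots> = (\<integral>\<^sup>+j. G j \<partial>q)"
    using Suc.IH[of "\<lambda>s v. h (_ + s) (profile _ + v)"] unfolding G_def by (intro nn_integral_cong) simp
  also have "\<dots> = (\<integral>\<^sup>+t. ennreal (1/2) * G (reveal t True) + ennreal (1/2) * G (reveal t False) \<partial>types)"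
    by (rule nn_integral_types)
  also have "\<dots> = (\<integral>\<^sup>+t. \<integral>\<^sup>+ts. ?T h (t # ts) \<partial>replicate_pmf k types \<partial>types)"
  proof (rule nn_integral_cong)
    fix t :: nat
    have G: "G j = (\<integral>\<^sup>+ts. \<integral>\<^sup>+b1. \<integral>\<^sup>+b2. h (j + (sum_list (map base ts) + b1 + 2 * b2))
          (profile j + (sum_list (map vbase ts) + real b1 * ln 2 + real b2 * ln 6))
          \<partial>coin_bin 1 ts \<partial>coin_bin 0 ts \<partial>replicate_pmf k types)" for j
      by (simp add: G_def)
    have half: "ennreal (1/2) * x + ennreal (1/2) * x = x" for x
      by (rule half_add_half)
    consider "t = 0" | "t = 1" | "t \<ge> 2" by linarith
    then show "ennreal (1/2) * G (reveal t True) + ennreal (1/2) * G (reveal t False)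
        = (\<integral>\<^sup>+ts. ?T h (t # ts) \<partial>replicate_pmf k types)"
    proof cases
      case 1
      show ?thesis unfolding 1 G
        by (simp add: reveal_def base_def vbase_def profile_small nn_integral_binomial_Suc nn_integral_add nn_integral_cmult algebra_simps)
    next
      case 2
      have three: "j + (3 + m) = Suc (Suc (Suc (j + m)))" for j m :: nat by simp
      show ?thesis unfolding 2 G
        by (simp add: three reveal_def base_def vbase_def profile_small nn_integral_binomial_Suc nn_integral_add nn_integral_cmult algebra_simps)
    next
      case 3
      then have t: "t \<noteq> 0" "t \<noteq> Suc 0" "\<not> t < 2" by auto
      then have rev: "reveal t True = t - 2" "reveal t False = t - 2" by (auto simp: reveal_def)
      have "G (t - 2) = (\<integral>\<^sup>+ts. ?T h (t # ts) \<partial>replicate_pmf k types)"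
        using t unfolding G by (simp add: base_def vbase_def add.assoc)
      then show ?thesis unfolding rev half .
    qed
  qed
  also have "\<dots> = (\<integral>\<^sup>+ts. ?T h ts \<partial>replicate_pmf (Suc k) types)" by simp
  finally show ?case .
qed (simp add: binomial_pmf_0)

end

section \<open>Concentration: a bound of order \<open>1 / k\<close>, uniform in the target\<close>

lemma ln_6: "ln (6::real) = 2 * ln 2 + ln (3/2)"
  using ln_mult[of "4::real" "3/2"] ln_realpow[of "2::real" 2] by simp

text \<open>Length and positivity are left to the sampling law. The target \<open>w\<close> is a
  free parameter because fixing a part of the sample shifts the target of the rest.\<close>

definition near :: "nat \<Rightarrow> real \<Rightarrow> nat list set" where
  "near n w = {js. sum_list js = n \<and> \<bar>sum_list (map profile js) - w\<bar> \<le> 1}"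

abbreviation near_prob :: "nat pmf \<Rightarrow> nat \<Rightarrow> nat \<Rightarrow> real \<Rightarrow> real" where
  "near_prob p k n w \<equiv> measure_pmf.prob (replicate_pmf k p) (near n w)"

context step_law
begin

lemma count_deviation:
  assumes i: "i < 2" and k: "k \<ge> 1"
  shows "measure_pmf.prob (replicate_pmf k types) {ts. real (count_list ts i) < lam * k / 2} \<le> 4 / (lam\<^sup>2 * k)"
proof -
  let ?g = "\<lambda>t. indicator {i} t :: real"
  have cnt: "sum_list (map ?g ts) = real (count_list ts i)" for ts
    by (induction ts) auto
  have E: "measure_pmf.expectation types ?g = lam"
    using i by (simp add: measure_pmf_single pmf_types)
  have g: "integrable (measure_pmf types) ?g" "integrable (measure_pmf types) (\<lambda>x. (?g x)\<^sup>2)"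
    by (auto intro!: measure_pmf.integrable_const_bound[where B = 1] simp: indicator_def)
  have "measure_pmf.variance types ?g \<le> measure_pmf.expectation types (\<lambda>_. 1)"
  proof (intro integral_mono)
    show "(indicator {i} x - measure_pmf.expectation types ?g)\<^sup>2 \<le> (1::real)" for x
      using lam unfolding E by (auto simp: indicator_def abs_square_le_1)
    show "integrable (measure_pmf types) (\<lambda>x. (?g x - measure_pmf.expectation types ?g)\<^sup>2)"
      using g by (simp add: power2_diff)
  qed auto
  then have V: "measure_pmf.variance types ?g \<le> 1" by simp
  have pos: "lam * k / 2 > 0" using lam k by simp
  have "measure_pmf.prob (replicate_pmf k types) {ts. real (count_list ts i) < lam * k / 2}
     \<le> measure_pmf.prob (replicate_pmf k types) {ts. \<bar>sum_list (map ?g ts) - real k * measure_pmf.expectation types ?g\<bar> \<ge> lam * k / 2}"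
    unfolding cnt E by (intro measure_pmf.finite_measure_mono) (auto simp: field_simps abs_if)
  also have "\<dots> \<le> real k * measure_pmf.variance types ?g / (lam * k / 2)\<^sup>2"
    by (rule prob_sum_replicate_pmf_deviation[OF g pos])
  also have "\<dots> \<le> real k * 1 / (lam * k / 2)\<^sup>2"
    by (intro divide_right_mono mult_left_mono V) auto
  also have "\<dots> = 4 / (lam\<^sup>2 * k)" using k lam by (simp add: power2_eq_square field_simps)
  finally show ?thesis .
qed

text \<open>Where the count is at least \<open>lam * k / 2\<close> the integrand is at most
  \<open>2 / (lam * k)\<close>; elsewhere it is at most 1, on an event of probability at most
  \<open>4 / (lam^2 * k)\<close>. The sum is at most \<open>6 / (lam^2 * k)\<close>, and
  \<open>k + 1 \<le> 2 * k\<close> doubles the 6.\<close>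

lemma nn_integral_inverse_count:
  assumes i: "i < 2"
  shows "(\<integral>\<^sup>+ts. ennreal (1 / (real (count_list ts i) + 1)) \<partial>replicate_pmf k types) \<le> ennreal (12 / (lam\<^sup>2 * (real k + 1)))"
proof (cases "k = 0")
  case True
  have "lam\<^sup>2 \<le> 1" using lam by (simp add: abs_square_le_1)
  then have "1 \<le> 12 / lam\<^sup>2" using lam by (simp add: field_simps)
  then show ?thesis using True by (simp flip: ennreal_1 add: ennreal_leI)
next
  case False
  let ?A = "{ts. real (count_list ts i) < lam * k / 2}"
  let ?P = "measure_pmf.prob (replicate_pmf k types) ?A"
  have pos: "lam * k / 2 > 0" using lam False by simp
  have "(\<integral>\<^sup>+ts. ennreal (1 / (real (count_list ts i) + 1)) \<partial>replicate_pmf k types)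
     \<le> (\<integral>\<^sup>+ts. indicator ?A ts + ennreal (2 / (lam * k)) \<partial>replicate_pmf k types)"
  proof (rule nn_integral_mono)
    fix ts
    show "ennreal (1 / (real (count_list ts i) + 1)) \<le> indicator ?A ts + ennreal (2 / (lam * k))"
    proof (cases "ts \<in> ?A")
      case True
      have "ennreal (1 / (real (count_list ts i) + 1)) \<le> ennreal 1"
        by (intro ennreal_leI) (simp add: field_simps)
      then show ?thesis using True by (simp add: add_increasing2)
    next
      case False
      then have "1 / (real (count_list ts i) + 1) \<le> 1 / (lam * k / 2)"
        using pos by (intro divide_left_mono) auto
      then show ?thesis using False by (simp add: ennreal_leI)
    qed
  qed
  also have "\<dots> = ennreal (?P + 2 / (lam * k))"
    using lam by (simp add: nn_integral_add measure_pmf.emeasure_eq_measure)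
  also have "\<dots> \<le> ennreal (12 / (lam\<^sup>2 * (real k + 1)))"
  proof (rule ennreal_leI)
    have "?P \<le> 4 / (lam\<^sup>2 * k)" using count_deviation[OF i] False by simp
    moreover have "2 / (lam * k) \<le> 2 / (lam\<^sup>2 * k)"
    proof -
      have "lam\<^sup>2 * k \<le> lam * k" using lam mult_right_mono[of lam 1 "lam * k"] by (simp add: power2_eq_square)
      then show ?thesis using lam False by (intro divide_left_mono) auto
    qed
    moreover have "6 / (lam\<^sup>2 * k) = 12 / (lam\<^sup>2 * (2 * real k))" by simp
    moreover have "12 / (lam\<^sup>2 * (2 * real k)) \<le> 12 / (lam\<^sup>2 * (real k + 1))"
      using lam False by (intro divide_left_mono mult_left_mono) auto
    moreover have "4 / (lam\<^sup>2 * k) + 2 / (lam\<^sup>2 * k) = 6 / (lam\<^sup>2 * k)" by (simp flip: add_divide_distrib)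
    ultimately show "?P + 2 / (lam * k) \<le> 12 / (lam\<^sup>2 * (real k + 1))" by linarith
  qed
  finally show ?thesis .
qed

definition coin_hits :: "nat \<Rightarrow> real \<Rightarrow> nat list \<Rightarrow> (nat \<times> nat) set" where
  "coin_hits n w ts = {(b1, b2). sum_list (map base ts) + b1 + 2 * b2 = n \<and>
      \<bar>sum_list (map vbase ts) + real b1 * ln 2 + real b2 * ln 6 - w\<bar> \<le> 1}"

lemma emeasure_near:
  "emeasure (replicate_pmf k q) (near n w)
    = (\<integral>\<^sup>+ts. emeasure (pair_pmf (coin_bin 0 ts) (coin_bin 1 ts)) (coin_hits n w ts) \<partial>replicate_pmf k types)"
proof -
  let ?h = "\<lambda>s v. if s = n \<and> \<bar>v - w\<bar> \<le> 1 then 1 else 0 :: ennreal"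
  have "emeasure (replicate_pmf k q) (near n w) = (\<integral>\<^sup>+js. indicator (near n w) js \<partial>replicate_pmf k q)"
    by simp
  also have "\<dots> = (\<integral>\<^sup>+js. ?h (sum_list js) (sum_list (map profile js)) \<partial>replicate_pmf k q)"
    by (intro nn_integral_cong) (auto simp: near_def)
  also have "\<dots> = (\<integral>\<^sup>+ts. \<integral>\<^sup>+b1. \<integral>\<^sup>+b2. indicator (coin_hits n w ts) (b1, b2) \<partial>coin_bin 1 ts \<partial>coin_bin 0 ts \<partial>replicate_pmf k types)"
    by (subst nn_integral_two_stage[where h = ?h]) (intro nn_integral_cong, auto simp: coin_hits_def)
  also have "\<dots> = (\<integral>\<^sup>+ts. emeasure (pair_pmf (coin_bin 0 ts) (coin_bin 1 ts)) (coin_hits n w ts) \<partial>replicate_pmf k types)"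
    by (intro nn_integral_cong) (subst nn_integral_pair_pmf'[symmetric], simp)
  finally show ?thesis .
qed

text \<open>The prescribed sum determines \<open>b1\<close> from \<open>b2\<close>, so along the
  hits the profile is affine in \<open>b2\<close> with slope \<open>ln (3/2)\<close>.\<close>

lemma coin_hits_value:
  assumes "(b1, b2) \<in> coin_hits n w ts"
  shows "real b1 * ln 2 + real b2 * ln 6 = (real n - real (sum_list (map base ts))) * ln 2 + real b2 * ln (3/2)"
proof -
  have n: "real n = real (sum_list (map base ts)) + real b1 + 2 * real b2"
    using assms by (auto simp: coin_hits_def)
  show ?thesis unfolding n ln_6 by (simp add: algebra_simps)
qed

text \<open>The profiles of two hits differ by at most 2, and the slope in \<open>b2\<close> is at
  least 1/3. Hence the values of \<open>b2\<close> span at most 6.\<close>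

lemma coin_hits_card: "finite (coin_hits n w ts)" "card (coin_hits n w ts) \<le> 7"
proof -
  let ?Z = "coin_hits n w ts"
  have inj: "inj_on snd ?Z" by (auto simp: inj_on_def coin_hits_def)
  have gap: "b2 \<le> c2 + 6" if b: "(b1, b2) \<in> ?Z" and c: "(c1, c2) \<in> ?Z" for b1 b2 c1 c2
  proof -
    have 1: "\<bar>sum_list (map vbase ts) + (real b1 * ln 2 + real b2 * ln 6) - w\<bar> \<le> 1"
      "\<bar>sum_list (map vbase ts) + (real c1 * ln 2 + real c2 * ln 6) - w\<bar> \<le> 1"
      using b c by (auto simp: coin_hits_def add.assoc)
    have "(real b2 - real c2) * ln (3/2) \<le> 2"
      using 1 unfolding coin_hits_value[OF b] coin_hits_value[OF c] by (simp add: algebra_simps)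
    then have "(real b2 - real c2) * (1/3) \<le> 2" if "b2 > c2"
      using ln_three_halves(1) that mult_left_mono[of "1/3" "ln (3/2)" "real b2 - real c2"] by linarith
    then show ?thesis by (cases "b2 > c2") auto
  qed
  have "snd ` ?Z \<subseteq> {m..m + 6}" if "m = (LEAST m. m \<in> snd ` ?Z)" for m
  proof (intro subsetI)
    fix b assume b: "b \<in> snd ` ?Z"
    then have m: "m \<in> snd ` ?Z" "m \<le> b" unfolding that by (rule LeastI, rule Least_le)
    then show "b \<in> {m..m + 6}" using b gap by auto
  qed
  then obtain m where m: "snd ` ?Z \<subseteq> {m..m + 6}" by blast
  then have "finite (snd ` ?Z)" by (rule finite_subset) simp
  then show fin: "finite ?Z" using inj finite_imageD by blast
  have "card ?Z = card (snd ` ?Z)" using inj by (simp add: card_image)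
  also have "\<dots> \<le> card {m..m + 6}" using m by (intro card_mono) auto
  finally show "card ?Z \<le> 7" by simp
qed

lemma pmf_coin_bin: "pmf (coin_bin i ts) b = real (count_list ts i choose b) / 2 ^ count_list ts i"
proof (cases "b \<le> count_list ts i")
  case True
  have "pmf (coin_bin i ts) b = real (count_list ts i choose b) * ((1/2) ^ b * (1/2) ^ (count_list ts i - b))"
    by simp
  also have "(1/2::real) ^ b * (1/2) ^ (count_list ts i - b) = 1 / 2 ^ count_list ts i"
    unfolding power_add[symmetric] using True by (simp add: power_one_over)
  finally show ?thesis by simp
qed (simp add: binomial_eq_0)

text \<open>The number 336 is \<open>14 * (12 + 12)\<close>: at most 7 hits, each bounded by twice
  the sum of two inverse counts, and 12 from the mean of each inverse count.\<close>

definition C_conc :: real where "C_conc = 336 / lam\<^sup>2"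

text \<open>Given the types there are at most 7 hits, and each of them has a probability of the
  order of the product of the two inverse square roots of the counts. Averaging over the types gives
  \<open>1 / k\<close>.\<close>

lemma prob_near_upper: "near_prob q k n w \<le> C_conc / (real k + 1)"
proof -
  let ?c = "\<lambda>ts i. 1 / (real (count_list ts i) + 1)"
  have "emeasure (pair_pmf (coin_bin 0 ts) (coin_bin 1 ts)) (coin_hits n w ts) \<le> ennreal (14 * (?c ts 0 + ?c ts 1))" for ts
  proof -
    have "emeasure (pair_pmf (coin_bin 0 ts) (coin_bin 1 ts)) (coin_hits n w ts)
        = ennreal (\<Sum>z\<in>coin_hits n w ts. pmf (pair_pmf (coin_bin 0 ts) (coin_bin 1 ts)) z)"
      using coin_hits_card(1) by (simp add: emeasure_measure_pmf_finite)
    also have "\<dots> \<le> ennreal (14 * (?c ts 0 + ?c ts 1))"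
    proof (rule ennreal_leI)
      \<comment> \<open>The counts of the two coins are dependent; the arithmetic-geometric mean
        inequality separates them, so that the mean of a single inverse count is enough.\<close>
      have sq: "2 / sqrt (real N + 1) * (2 / sqrt (real M + 1)) \<le> 2 * (1 / (real N + 1) + 1 / (real M + 1))" for N M :: nat
      proof -
        have "0 \<le> (1 / sqrt (real N + 1) - 1 / sqrt (real M + 1))\<^sup>2" by simp
        then show ?thesis by (simp add: power2_diff power_divide)
      qed
      have "(\<Sum>z\<in>coin_hits n w ts. pmf (pair_pmf (coin_bin 0 ts) (coin_bin 1 ts)) z)
          \<le> (\<Sum>z\<in>coin_hits n w ts. 2 * (?c ts 0 + ?c ts 1))"
      proof (rule sum_mono)
        fix z :: "nat \<times> nat"
        obtain b1 b2 where z: "z = (b1, b2)" by fastforce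
        have "pmf (pair_pmf (coin_bin 0 ts) (coin_bin 1 ts)) z
            \<le> 2 / sqrt (real (count_list ts 0) + 1) * (2 / sqrt (real (count_list ts 1) + 1))"
          unfolding z pmf_pair pmf_coin_bin by (intro mult_mono binomial_prob_upper) auto
        then show "pmf (pair_pmf (coin_bin 0 ts) (coin_bin 1 ts)) z \<le> 2 * (?c ts 0 + ?c ts 1)"
          using sq order_trans by blast
      qed
      also have "\<dots> = real (card (coin_hits n w ts)) * (2 * (?c ts 0 + ?c ts 1))" by simp
      also have "\<dots> \<le> 7 * (2 * (?c ts 0 + ?c ts 1))"
        using coin_hits_card(2)[of n w ts] by (intro mult_right_mono) auto
      finally show "(\<Sum>z\<in>coin_hits n w ts. pmf (pair_pmf (coin_bin 0 ts) (coin_bin 1 ts)) z) \<le> 14 * (?c ts 0 + ?c ts 1)"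
        by simp
    qed
    finally show ?thesis .
  qed
  then have "emeasure (replicate_pmf k q) (near n w) \<le> (\<integral>\<^sup>+ts. ennreal (14 * (?c ts 0 + ?c ts 1)) \<partial>replicate_pmf k types)"
    unfolding emeasure_near by (intro nn_integral_mono)
  also have "\<dots> = (\<integral>\<^sup>+ts. ennreal 14 * (ennreal (?c ts 0) + ennreal (?c ts 1)) \<partial>replicate_pmf k types)"
    by (intro nn_integral_cong) (subst ennreal_plus[symmetric], simp, simp, subst ennreal_mult[symmetric], auto)
  also have "\<dots> = ennreal 14 * ((\<integral>\<^sup>+ts. ennreal (?c ts 0) \<partial>replicate_pmf k types) + (\<integral>\<^sup>+ts. ennreal (?c ts 1) \<partial>replicate_pmf k types))"
    by (simp add: nn_integral_cmult nn_integral_add)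
  also have "\<dots> \<le> ennreal 14 * (ennreal (12 / (lam\<^sup>2 * (real k + 1))) + ennreal (12 / (lam\<^sup>2 * (real k + 1))))"
    by (intro mult_left_mono add_mono nn_integral_inverse_count) auto
  also have "\<dots> = ennreal (C_conc / (real k + 1))"
  proof -
    define x where "x = 12 / (lam\<^sup>2 * (real k + 1))"
    have "x \<ge> 0" by (simp add: x_def)
    then have "ennreal 14 * (ennreal x + ennreal x) = ennreal (14 * (x + x))"
      by (simp only: ennreal_plus[symmetric] ennreal_mult[symmetric])
    then show ?thesis by (simp add: x_def C_conc_def)
  qed
  finally show ?thesis
    by (simp add: measure_pmf.emeasure_eq_measure C_conc_def)
qed

end

context step_law
begin

section \<open>A matching lower bound near the mean, and decay away from it\<close>

definition mean :: real where "mean = measure_pmf.expectation q real"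
definition vmean :: real where "vmean = measure_pmf.expectation q profile"

definition cond_mean :: "(nat \<Rightarrow> real) \<Rightarrow> nat \<Rightarrow> real" where
  "cond_mean f t = (f (reveal t True) + f (reveal t False)) / 2"

text \<open>The tower property for the type, with square integrability from Jensen's inequality for
  the average of two values.\<close>

lemma cond_mean:
  assumes f: "\<And>j. f j \<ge> 0" "integrable (measure_pmf q) f" "integrable (measure_pmf q) (\<lambda>j. (f j)\<^sup>2)"
  shows "integrable (measure_pmf types) (cond_mean f)" "integrable (measure_pmf types) (\<lambda>t. (cond_mean f t)\<^sup>2)"
    and "measure_pmf.expectation types (cond_mean f) = measure_pmf.expectation q f"
proof -
  have avg: "(\<integral>\<^sup>+t. ennreal (cond_mean g t) \<partial>types) = (\<integral>\<^sup>+j. ennreal (g j) \<partial>q)" if "\<And>j. g j \<ge> 0" for g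
  proof -
    have "ennreal (cond_mean g t) = ennreal (1/2) * ennreal (g (reveal t True)) + ennreal (1/2) * ennreal (g (reveal t False))" for t
    proof -
      have "ennreal (1/2) * ennreal (g (reveal t True)) + ennreal (1/2) * ennreal (g (reveal t False))
        = ennreal (1/2 * g (reveal t True)) + ennreal (1/2 * g (reveal t False))"
      proof -
        have "ennreal (1/2) * ennreal x = ennreal (1/2 * x)" if "x \<ge> 0" for x :: real
          using that by (subst ennreal_mult) auto
        then show ?thesis using that by simp
      qed
      also have "\<dots> = ennreal (1/2 * g (reveal t True) + 1/2 * g (reveal t False))"
        using that by (intro ennreal_plus[symmetric]) auto
      finally show ?thesis by (simp add: cond_mean_def add_divide_distrib)
    qed
    then show ?thesis by (simp only: nn_integral_types)
  qed
  have nn: "cond_mean f t \<ge> 0" for t using f by (simp add: cond_mean_def)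
  have fin: "(\<integral>\<^sup>+j. ennreal (f j) \<partial>q) = ennreal (measure_pmf.expectation q f)"
    using f by (intro nn_integral_eq_integral) auto
  show int: "integrable (measure_pmf types) (cond_mean f)"
    using nn fin by (intro integrableI_nonneg) (auto simp: avg f)
  have "ennreal (measure_pmf.expectation types (cond_mean f)) = ennreal (measure_pmf.expectation q f)"
    using nn_integral_eq_integral[OF int] nn avg f fin by simp
  then show "measure_pmf.expectation types (cond_mean f) = measure_pmf.expectation q f"
    using nn f(1) by (subst (asm) ennreal_inj) (auto intro!: Bochner_Integration.integral_nonneg)
  have fin2: "(\<integral>\<^sup>+j. ennreal ((f j)\<^sup>2) \<partial>q) = ennreal (measure_pmf.expectation q (\<lambda>j. (f j)\<^sup>2))"
    using f by (intro nn_integral_eq_integral) auto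
  have "(\<integral>\<^sup>+t. ennreal ((cond_mean f t)\<^sup>2) \<partial>types) \<le> (\<integral>\<^sup>+t. ennreal (cond_mean (\<lambda>j. (f j)\<^sup>2) t) \<partial>types)"
  proof (intro nn_integral_mono ennreal_leI)
    fix t
    have "0 \<le> (f (reveal t True) - f (reveal t False))\<^sup>2" by simp
    then show "(cond_mean f t)\<^sup>2 \<le> cond_mean (\<lambda>j. (f j)\<^sup>2) t"
      by (simp add: cond_mean_def power2_eq_square field_simps)
  qed
  also have "\<dots> = ennreal (measure_pmf.expectation q (\<lambda>j. (f j)\<^sup>2))" using avg fin2 by simp
  finally have "(\<integral>\<^sup>+t. ennreal ((cond_mean f t)\<^sup>2) \<partial>types) < \<infinity>"
    using order_le_less_trans ennreal_less_top by fastforce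
  then show "integrable (measure_pmf types) (\<lambda>t. (cond_mean f t)\<^sup>2)"
    by (intro integrableI_nonneg) auto
qed

lemma cond_mean_sums:
  "sum_list (map (cond_mean real) ts) = real (sum_list (map base ts)) + real (count_list ts 0) / 2 + real (count_list ts 1)"
  "sum_list (map (cond_mean profile) ts) = sum_list (map vbase ts) + real (count_list ts 0) / 2 * ln 2 + real (count_list ts 1) / 2 * ln 6"
  by (induction ts)
     (auto simp: cond_mean_def base_def vbase_def reveal_def profile_small field_simps)

text \<open>For such types both coins occur linearly often, and the centers of the two binomials
  miss a target close to the mean by at most order \<open>sqrt k\<close> in either
  coordinate.\<close>

definition typical :: "real \<Rightarrow> nat \<Rightarrow> nat list set" where
  "typical a k = {ts. \<bar>sum_list (map (cond_mean real) ts) - real k * mean\<bar> \<le> a * sqrt k \<and>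
           \<bar>sum_list (map (cond_mean profile) ts) - real k * vmean\<bar> \<le> a * sqrt k \<and>
           lam * k / 2 \<le> count_list ts 0 \<and> lam * k / 2 \<le> count_list ts 1}"

lemma typical_types:
  "\<exists>a\<ge>0. \<exists>K. \<forall>k\<ge>K. measure_pmf.prob (replicate_pmf k types) (typical a k) \<ge> 1/2"
proof -
  note cm = cond_mean[OF of_nat_0_le_iff integrable_moments(1,2)]
  note cv = cond_mean[OF profile_nonneg integrable_moments(3,4)]
  let ?V1 = "measure_pmf.variance types (cond_mean real)"
  let ?V2 = "measure_pmf.variance types (cond_mean profile)"
  \<comment> \<open>Each of the four bad events is to have probability at most 1/8. The factor 8
    arranges this for the two deviations through Chebyshev's inequality, and
    \<open>k \<ge> 32 / lam^2\<close> below for the two counts.\<close>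
  define a where "a = sqrt (8 * (?V1 + ?V2 + 1))"
  have V: "?V1 \<ge> 0" "?V2 \<ge> 0" by (auto intro!: Bochner_Integration.integral_nonneg)
  have a: "a > 0" "a\<^sup>2 = 8 * (?V1 + ?V2 + 1)" 
  proof -
    have "8 * (?V1 + ?V2 + 1) > 0"
      by (intro mult_pos_pos add_nonneg_pos add_nonneg_nonneg V) auto
    then show "a > 0" "a\<^sup>2 = 8 * (?V1 + ?V2 + 1)" unfolding a_def by (simp_all del: distrib_left_numeral)
  qed
  define K where "K = nat \<lceil>32 / lam\<^sup>2\<rceil> + 1"
  have "measure_pmf.prob (replicate_pmf k types) (typical a k) \<ge> 1/2"
    (is "measure_pmf.prob ?p ?G \<ge> _") if k: "k \<ge> K" for k
  proof -
    let ?A1 = "{ts. \<bar>sum_list (map (cond_mean real) ts) - real k * mean\<bar> \<ge> a * sqrt k}"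
    let ?A2 = "{ts. \<bar>sum_list (map (cond_mean profile) ts) - real k * vmean\<bar> \<ge> a * sqrt k}"
    let ?B = "\<lambda>i. {ts. real (count_list ts i) < lam * k / 2}"
    have k1: "k \<ge> 1" and kl: "real k \<ge> 32 / lam\<^sup>2" using k unfolding K_def by linarith+
    have pos: "a * sqrt k > 0" using a k1 by simp
    have eighth: "x / (8 * (x + y + 1)) \<le> 1/8" if "x \<ge> 0" "y \<ge> 0" for x y :: real
      using that by (simp add: field_simps)
    have "measure_pmf.prob ?p ?A1 \<le> real k * ?V1 / (a * sqrt k)\<^sup>2"
      using prob_sum_replicate_pmf_deviation[OF cm(1,2) pos, of k] by (simp only: cm(3) mean_def)
    also have "\<dots> = ?V1 / a\<^sup>2" using k1 by (simp add: power_mult_distrib)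
    also have "\<dots> \<le> 1/8" unfolding a(2) by (rule eighth[OF V])
    finally have 1: "measure_pmf.prob ?p ?A1 \<le> 1/8" .
    have "measure_pmf.prob ?p ?A2 \<le> real k * ?V2 / (a * sqrt k)\<^sup>2"
      using prob_sum_replicate_pmf_deviation[OF cv(1,2) pos, of k] by (simp only: cv(3) vmean_def)
    also have "\<dots> = ?V2 / a\<^sup>2" using k1 by (simp add: power_mult_distrib)
    also have "\<dots> \<le> 1/8" unfolding a(2) using eighth[OF V(2) V(1)] by (simp only: add.commute[of ?V1])
    finally have 2: "measure_pmf.prob ?p ?A2 \<le> 1/8" .
    have 3: "measure_pmf.prob ?p (?B i) \<le> 1/8" if "i < 2" for i
    proof -
      have "32 \<le> lam\<^sup>2 * k" using kl lam by (simp add: field_simps)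
      then have "4 / (lam\<^sup>2 * k) \<le> 4 / 32" by (intro divide_left_mono) auto
      then show ?thesis using count_deviation[OF that k1] by linarith
    qed
    have "- ?G \<subseteq> (?A1 \<union> ?A2) \<union> (?B 0 \<union> ?B 1)" by (auto simp: typical_def)
    then have "measure_pmf.prob ?p (- ?G) \<le> measure_pmf.prob ?p ((?A1 \<union> ?A2) \<union> (?B 0 \<union> ?B 1))"
      by (intro measure_pmf.finite_measure_mono) auto
    also have "\<dots> \<le> (measure_pmf.prob ?p ?A1 + measure_pmf.prob ?p ?A2) + (measure_pmf.prob ?p (?B 0) + measure_pmf.prob ?p (?B 1))"
      by (intro order_trans[OF measure_Un_le] add_mono order_refl) auto
    also have "\<dots> \<le> 1/2" using 1 2 3[of 0] 3[of 1] by simp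
    finally show ?thesis
      using measure_pmf.prob_compl[of ?G ?p] by (simp add: Compl_eq_Diff_UNIV)
  qed
  then show ?thesis using a(1) less_imp_le by blast
qed

text \<open>For typical types an explicit pair of coin counts lands in the window at distance of
  order \<open>sqrt k\<close> from both binomial centers. Each of the two counts has probability at
  least of order \<open>1 / sqrt k\<close>, and types are typical with probability at least
  1/2.\<close>

lemma prob_near_lower:
  assumes A: "A \<ge> 0"
  shows "\<exists>c>0. \<exists>K. \<forall>k\<ge>K. \<forall>n w. \<bar>real n - real k * mean\<bar> \<le> A * sqrt k \<longrightarrow> \<bar>w - real k * vmean\<bar> \<le> A * sqrt k \<longrightarrow>
           near_prob q k n w \<ge> c / real k"
proof -
  obtain a K0 where a: "a \<ge> 0" and types_prob: "\<And>k. k \<ge> K0 \<Longrightarrow> measure_pmf.prob (replicate_pmf k types) (typical a k) \<ge> 1/2"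
    using typical_types by blast
  define E where "E = A + a"
  have E: "E \<ge> 0" using A a by (simp add: E_def)
  \<comment> \<open>Lower constant for one binomial weight: below,
    \<open>D + 1 \<le> (3 + 13 * E) * sqrt k\<close> and the count is at least
    \<open>lam * k / 2\<close>, which gives the exponent; the 4 comes from
    \<open>2 * sqrt (2 * N + 1) \<le> 4 * sqrt k\<close>.\<close>
  define e where "e = exp (- 32 * (3 + 13 * E)\<^sup>2 / lam) / 4"
  have "\<exists>K1. \<forall>k\<ge>K1. 6 * (2 + 13 * E * sqrt (real k)) + 9 \<le> lam * real k / 2"
  proof -
    have "eventually (\<lambda>k::nat. 6 * (2 + 13 * E * sqrt (real k)) + 9 \<le> lam * real k / 2) sequentially"
      using lam(1) by real_asymp
    then show ?thesis by (simp add: eventually_sequentially)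
  qed
  then obtain K1 where K1: "\<And>k. k \<ge> K1 \<Longrightarrow> 6 * (2 + 13 * E * sqrt (real k)) + 9 \<le> lam * real k / 2" by blast
  have main: "near_prob q k n w \<ge> (e\<^sup>2 / 2) / real k"
    if k: "k \<ge> max K0 (max K1 1)" and n: "\<bar>real n - real k * mean\<bar> \<le> A * sqrt k" and w: "\<bar>w - real k * vmean\<bar> \<le> A * sqrt k" for k n w
  proof -
    \<comment> \<open>Permitted distance from the binomial centers: \<open>b2\<close> will be off by
      at most \<open>6 * E * sqrt k + 1\<close>, and \<open>b1\<close> by twice this plus
      \<open>E * sqrt k\<close>.\<close>
    define D where "D = 2 + 13 * E * sqrt k"
    have k1: "k \<ge> 1" "k \<ge> K0" using k by auto
    have D: "6 * D + 9 \<le> lam * real k / 2" using K1[of k] k by (simp add: D_def)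
    have D0: "D \<ge> 0" using E by (simp add: D_def)
    let ?G = "typical a k"
    have pt: "pmf (coin_bin i ts) b \<ge> e / sqrt k"
      if N: "lam * k / 2 \<le> count_list ts i" "count_list ts i \<le> k" and b: "\<bar>real b - real (count_list ts i) / 2\<bar> \<le> D" for i ts b
    proof -
      let ?N = "count_list ts i"
      have N9: "6 * D + 9 \<le> real ?N" using D N by linarith
      then have N2: "2 \<le> ?N" using D0 by linarith
      have "exp (- 16 * (D + 1)\<^sup>2 / real ?N) / (2 * sqrt (2 * real ?N + 1)) \<le> real (?N choose b) / 2 ^ ?N"
        by (rule binomial_prob_lower[OF N2 b N9])
      moreover have "e / sqrt k \<le> exp (- 16 * (D + 1)\<^sup>2 / real ?N) / (2 * sqrt (2 * real ?N + 1))"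
      proof -
        have s1: "sqrt k \<ge> 1" using k1 by simp
        have "D + 1 \<le> (3 + 13 * E) * sqrt k" using s1 E by (simp add: D_def algebra_simps)
        then have "(D + 1)\<^sup>2 \<le> ((3 + 13 * E) * sqrt k)\<^sup>2" using D0 by (intro power_mono) auto
        then have "16 * (D + 1)\<^sup>2 \<le> 16 * ((3 + 13 * E)\<^sup>2 * k)" by (simp add: power_mult_distrib)
        then have "16 * (D + 1)\<^sup>2 / real ?N \<le> 16 * ((3 + 13 * E)\<^sup>2 * k) / (lam * k / 2)"
          using N lam k1 by (intro frac_le) auto
        also have "\<dots> = 32 * (3 + 13 * E)\<^sup>2 / lam" using k1 by simp
        finally have "exp (- 32 * (3 + 13 * E)\<^sup>2 / lam) \<le> exp (- 16 * (D + 1)\<^sup>2 / real ?N)" by simp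
        moreover have "2 * sqrt (2 * real ?N + 1) \<le> 4 * sqrt k"
        proof -
          have "sqrt (2 * real ?N + 1) \<le> sqrt (4 * real k)" using N k1 by (intro real_sqrt_le_mono) auto
          then show ?thesis by (simp add: real_sqrt_mult)
        qed
        ultimately have "exp (- 32 * (3 + 13 * E)\<^sup>2 / lam) / (4 * sqrt k) \<le> exp (- 16 * (D + 1)\<^sup>2 / real ?N) / (2 * sqrt (2 * real ?N + 1))"
          by (intro frac_le) (auto simp: add_nonneg_pos)
        then show ?thesis by (simp add: e_def)
      qed
      ultimately show ?thesis unfolding pmf_coin_bin by linarith
    qed
    have hit: "emeasure (pair_pmf (coin_bin 0 ts) (coin_bin 1 ts)) (coin_hits n w ts) \<ge> ennreal (e\<^sup>2 / k)"
      if ts: "ts \<in> ?G" and len: "length ts = k" for ts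
    proof -
      define e1 where "e1 = real n - sum_list (map (cond_mean real) ts)"
      define e2 where "e2 = w - sum_list (map (cond_mean profile) ts)"
      define N1 where "N1 = real (count_list ts 0)"
      define N2 where "N2 = real (count_list ts 1)"
      have e12: "\<bar>e1\<bar> \<le> E * sqrt k" "\<bar>e2\<bar> \<le> E * sqrt k"
        using ts n w unfolding e1_def e2_def E_def typical_def by (auto simp: distrib_right abs_le_iff)
      have N: "lam * k / 2 \<le> N1" "lam * k / 2 \<le> N2" using ts by (auto simp: N1_def N2_def typical_def)
      have Nk: "count_list ts 0 \<le> k" "count_list ts 1 \<le> k" using count_le_length[of ts] len by auto
      \<comment> \<open>The displacement of \<open>b2\<close> from its center that would meet the
        profile exactly once \<open>b1\<close> is eliminated through the sum. Rounding it costs at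
        most \<open>ln (3/2)\<close>, which is below the window size 1.\<close>
      define z where "z = (e2 - e1 * ln 2) / ln (3/2)"
      have zb: "\<bar>z\<bar> \<le> 6 * E * sqrt k"
      proof -
        have "\<bar>e1 * ln 2\<bar> \<le> E * sqrt k * 1"
          unfolding abs_mult using e12 ln2_le_25_over_36 by (intro mult_mono) auto
        then have "\<bar>e2 - e1 * ln 2\<bar> \<le> 2 * E * sqrt k" using e12 by linarith
        then have "\<bar>e2 - e1 * ln 2\<bar> / ln (3/2) \<le> 2 * E * sqrt k / (1/3)"
          using ln_three_halves by (intro frac_le) auto
        then show ?thesis by (simp add: z_def)
      qed
      define y where "y = \<lfloor>N2 / 2 + z\<rfloor>"
      define \<delta> where "\<delta> = of_int y - (N2 / 2 + z)"
      have \<delta>: "\<bar>\<delta>\<bar> \<le> 1" unfolding \<delta>_def y_def by linarith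
      have yb: "\<bar>of_int y - N2 / 2\<bar> \<le> 6 * E * sqrt k + 1" using \<delta> zb unfolding \<delta>_def by linarith
      \<comment> \<open>The sum is met exactly by construction. The value is kept as an integer
        until the bound \<open>D\<close> and the linear size of the counts show that it is
        nonnegative.\<close>
      define b1' where "b1' = int n - int (sum_list (map base ts)) - 2 * y"
      have b1eq: "of_int b1' = e1 + N1 / 2 - 2 * (of_int y - N2 / 2)"
        unfolding b1'_def e1_def N1_def N2_def cond_mean_sums by simp
      have b1b: "\<bar>of_int b1' - N1 / 2\<bar> \<le> D"
      proof -
        define s where "s = E * sqrt k"
        have s: "\<bar>of_int y - N2 / 2\<bar> \<le> 6 * s + 1" "\<bar>e1\<bar> \<le> s"
          using yb e12 by (simp_all add: s_def)
        have "\<bar>e1 - 2 * (of_int y - N2 / 2)\<bar> \<le> \<bar>e1\<bar> + 2 * \<bar>of_int y - N2 / 2\<bar>"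
          using abs_triangle_ineq4[of e1 "2 * (of_int y - N2 / 2)"] by (simp only: abs_mult abs_numeral)
        also have "\<dots> \<le> s + 2 * (6 * s + 1)" by (intro add_mono mult_left_mono s) auto
        also have "\<dots> = D" by (simp add: s_def D_def)
        finally have "\<bar>e1 - 2 * (of_int y - N2 / 2)\<bar> \<le> D" .
        then show ?thesis unfolding b1eq by (simp add: algebra_simps)
      qed
      have yD: "\<bar>of_int y - N2 / 2\<bar> \<le> D"
      proof -
        have "6 * E * sqrt k + 1 \<le> D" using E by (simp add: D_def mult_right_mono)
        then show ?thesis using yb by linarith
      qed
      have "of_int y \<ge> (0::real)" "of_int b1' \<ge> (0::real)" using yD b1b N D D0 by linarith+
      then have nn: "y \<ge> 0" "b1' \<ge> 0" by simp_all
      define b1 where "b1 = nat b1'"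
      define b2 where "b2 = nat y"
      have rb: "real b1 = of_int b1'" "real b2 = of_int y" using nn by (simp_all add: b1_def b2_def)
      have in_hits: "(b1, b2) \<in> coin_hits n w ts"
      proof -
        have "int (sum_list (map base ts) + b1 + 2 * b2) = int n"
          using nn by (simp add: b1_def b2_def b1'_def)
        then have 1: "sum_list (map base ts) + b1 + 2 * b2 = n" by linarith
        have "sum_list (map vbase ts) + real b1 * ln 2 + real b2 * ln 6 - w
           = (real b1 - N1 / 2) * ln 2 + (real b2 - N2 / 2) * ln 6 - e2"
          unfolding e2_def cond_mean_sums N1_def N2_def by (simp add: algebra_simps)
        also have "\<dots> = (real b2 - N2 / 2) * ln (3/2) + e1 * ln 2 - e2"
          unfolding rb b1eq ln_6 by (simp add: algebra_simps)
        also have "\<dots> = \<delta> * ln (3/2)"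
        proof -
          have "e2 - e1 * ln 2 = z * ln (3/2)" using ln_three_halves by (simp add: z_def)
          then show ?thesis unfolding \<delta>_def rb by (simp add: algebra_simps)
        qed
        finally have "\<bar>sum_list (map vbase ts) + real b1 * ln 2 + real b2 * ln 6 - w\<bar> = \<bar>\<delta>\<bar> * \<bar>ln (3/2)\<bar>"
          by (simp add: abs_mult)
        also have "\<dots> \<le> 1 * 1" using \<delta> ln_three_halves by (intro mult_mono) auto
        finally show ?thesis using 1 by (simp add: coin_hits_def)
      qed
      have "e / sqrt k * (e / sqrt k) \<le> pmf (coin_bin 0 ts) b1 * pmf (coin_bin 1 ts) b2"
        using b1b yD N Nk unfolding N1_def N2_def
        by (intro mult_mono pt) (auto simp: rb e_def)
      then have "e\<^sup>2 / k \<le> pmf (pair_pmf (coin_bin 0 ts) (coin_bin 1 ts)) (b1, b2)"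
        using k1 by (simp add: pmf_pair power2_eq_square)
      then have "ennreal (e\<^sup>2 / k) \<le> emeasure (pair_pmf (coin_bin 0 ts) (coin_bin 1 ts)) {(b1, b2)}"
        by (simp add: emeasure_pmf_single ennreal_leI)
      also have "\<dots> \<le> emeasure (pair_pmf (coin_bin 0 ts) (coin_bin 1 ts)) (coin_hits n w ts)"
        using in_hits by (intro emeasure_mono) auto
      finally show ?thesis .
    qed
    have "ennreal (e\<^sup>2 / 2 / k) \<le> ennreal (e\<^sup>2 / k) * emeasure (replicate_pmf k types) ?G"
    proof -
      have "e\<^sup>2 / k * (1/2) \<le> e\<^sup>2 / k * measure_pmf.prob (replicate_pmf k types) ?G"
        using types_prob[OF k1(2)] by (intro mult_left_mono) auto
      then show ?thesis
        by (simp add: measure_pmf.emeasure_eq_measure ennreal_leI flip: ennreal_mult)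
    qed
    also have "\<dots> = (\<integral>\<^sup>+ts. ennreal (e\<^sup>2 / k) * indicator ?G ts \<partial>replicate_pmf k types)"
      by (simp add: nn_integral_cmult)
    also have "\<dots> \<le> emeasure (replicate_pmf k q) (near n w)"
      unfolding emeasure_near
    proof (intro nn_integral_mono_AE, subst AE_measure_pmf_iff, intro ballI)
      fix ts assume "ts \<in> set_pmf (replicate_pmf k types)"
      then show "ennreal (e\<^sup>2 / k) * indicator ?G ts \<le> emeasure (pair_pmf (coin_bin 0 ts) (coin_bin 1 ts)) (coin_hits n w ts)"
        using hit[of ts] length_replicate_pmf by (cases "ts \<in> ?G") auto
    qed
    finally show ?thesis by (simp add: measure_pmf.emeasure_eq_measure)
  qed
  have "e\<^sup>2 / 2 > 0" by (simp add: e_def)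
  then show ?thesis using main by blast
qed

text \<open>Half of the steps carries the deviation of the sum from its mean, the concentration
  bound is applied to the other half.\<close>

lemma prob_near_deviation:
  "\<exists>C. \<forall>k n w. (real n - real k * mean)\<^sup>2 * near_prob q k n w \<le> C"
proof -
  let ?V = "measure_pmf.variance q real"
  have V: "?V \<ge> 0" by (auto intro!: Bochner_Integration.integral_nonneg)
  have C: "C_conc \<ge> 0" by (simp add: C_conc_def)
  \<comment> \<open>The first \<open>k\<close> steps carry their centered square, of mean
    \<open>k * ?V\<close>; given them, concentration for the other \<open>l\<close> steps
    contributes \<open>C_conc / (l + 1)\<close>. The two halves have sizes with
    \<open>k \<le> l + 1\<close>, which cancels the growth.\<close>
  have half: "(\<integral>\<^sup>+xs. \<integral>\<^sup>+ys. ennreal ((real (sum_list xs) - real k * mean)\<^sup>2) * indicator (near (n - sum_list xs) (w - sum_list (map profile xs))) ys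
        \<partial>replicate_pmf l q \<partial>replicate_pmf k q) \<le> ennreal (?V * C_conc)" if "k \<le> l + 1" for k l n w
  proof -
    have "(\<integral>\<^sup>+xs. \<integral>\<^sup>+ys. ennreal ((real (sum_list xs) - real k * mean)\<^sup>2) * indicator (near (n - sum_list xs) (w - sum_list (map profile xs))) ys
        \<partial>replicate_pmf l q \<partial>replicate_pmf k q)
      = (\<integral>\<^sup>+xs. ennreal ((real (sum_list xs) - real k * mean)\<^sup>2) * emeasure (replicate_pmf l q) (near (n - sum_list xs) (w - sum_list (map profile xs))) \<partial>replicate_pmf k q)"
      by (simp add: nn_integral_cmult)
    also have "\<dots> \<le> (\<integral>\<^sup>+xs. ennreal ((0 + sum_list (map real xs) - real k * mean)\<^sup>2) * ennreal (C_conc / (real l + 1)) \<partial>replicate_pmf k q)"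
      unfolding measure_pmf.emeasure_eq_measure
      by (intro nn_integral_mono mult_mono ennreal_leI prob_near_upper) (auto simp: sum_list_of_nat)
    also have "\<dots> = ennreal (real k * ?V) * ennreal (C_conc / (real l + 1))"
      unfolding mean_def
      by (subst nn_integral_multc, simp, subst nn_integral_sum_replicate_pmf_sq[OF integrable_moments(1,2)]) simp
    also have "\<dots> = ennreal (real k * ?V * (C_conc / (real l + 1)))"
      by (subst ennreal_mult[symmetric]) (use V C in auto)
    also have "\<dots> \<le> ennreal (?V * C_conc)"
    proof (rule ennreal_leI)
      have "real k / (real l + 1) * (?V * C_conc) \<le> 1 * (?V * C_conc)"
        using that V C by (intro mult_right_mono) auto
      then show "real k * ?V * (C_conc / (real l + 1)) \<le> ?V * C_conc" by (simp add: algebra_simps)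
    qed
    finally show ?thesis .
  qed
  have "(real n - real k * mean)\<^sup>2 * near_prob q k n w \<le> 4 * (?V * C_conc)" for k n w
  proof -
    define k1 k2 where "k1 = k div 2" and "k2 = k - k1"
    have k: "k = k1 + k2" "k1 \<le> k2 + 1" "k2 \<le> k1 + 1" unfolding k1_def k2_def by linarith+
    let ?X = "\<lambda>k xs. ennreal ((real (sum_list xs) - real k * mean)\<^sup>2)"
    let ?I = "\<lambda>xs. indicator (near (n - sum_list xs) (w - sum_list (map profile xs)))"
    have "ennreal ((real n - real k * mean)\<^sup>2 * near_prob q k n w)
      = (\<integral>\<^sup>+xs. ennreal ((real n - real k * mean)\<^sup>2) * indicator (near n w) xs \<partial>replicate_pmf k q)"
      by (simp add: nn_integral_cmult measure_pmf.emeasure_eq_measure ennreal_mult)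
    also have "\<dots> = (\<integral>\<^sup>+xs. \<integral>\<^sup>+ys. ennreal ((real n - real k * mean)\<^sup>2) * indicator (near n w) (xs @ ys) \<partial>replicate_pmf k2 q \<partial>replicate_pmf k1 q)"
      using nn_integral_replicate_pmf_add[where m = k1 and n = k2 and p = q] k(1) by simp
    also have "\<dots> \<le> (\<integral>\<^sup>+xs. \<integral>\<^sup>+ys. ennreal 2 * (?X k1 xs * ?I xs ys) + ennreal 2 * (?X k2 ys * ?I ys xs) \<partial>replicate_pmf k2 q \<partial>replicate_pmf k1 q)"
    proof (intro nn_integral_mono)
      fix xs ys
      show "ennreal ((real n - real k * mean)\<^sup>2) * indicator (near n w) (xs @ ys) \<le> ennreal 2 * (?X k1 xs * ?I xs ys) + ennreal 2 * (?X k2 ys * ?I ys xs)"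
      proof (cases "xs @ ys \<in> near n w")
        case True
        \<comment> \<open>Membership says that \<open>n\<close> is the sum of both halves, so the
          truncated subtractions are exact here.\<close>
        then have I: "ys \<in> near (n - sum_list xs) (w - sum_list (map profile xs))"
          "xs \<in> near (n - sum_list ys) (w - sum_list (map profile ys))" and n: "n = sum_list xs + sum_list ys"
          by (auto simp: near_def algebra_simps)
        define p1 where "p1 = real (sum_list xs) - real k1 * mean"
        define p2 where "p2 = real (sum_list ys) - real k2 * mean"
        have eq: "real n - real k * mean = p1 + p2" unfolding n k(1) p1_def p2_def by (simp add: algebra_simps)
        have "0 \<le> (p1 - p2)\<^sup>2" by simp
        then have "(p1 + p2)\<^sup>2 \<le> 2 * p1\<^sup>2 + 2 * p2\<^sup>2" by (simp add: power2_eq_square algebra_simps)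
        then have "ennreal ((p1 + p2)\<^sup>2) \<le> ennreal (2 * p1\<^sup>2 + 2 * p2\<^sup>2)" by (rule ennreal_leI)
        also have "\<dots> = ennreal 2 * ennreal (p1\<^sup>2) + ennreal 2 * ennreal (p2\<^sup>2)"
          by (subst ennreal_plus, simp, simp, subst ennreal_mult, simp, simp, subst ennreal_mult) auto
        finally show ?thesis using True I unfolding eq by (simp add: p1_def p2_def)
      qed simp
    qed
    also have "\<dots> = ennreal 2 * (\<integral>\<^sup>+xs. \<integral>\<^sup>+ys. ?X k1 xs * ?I xs ys \<partial>replicate_pmf k2 q \<partial>replicate_pmf k1 q)
        + ennreal 2 * (\<integral>\<^sup>+ys. \<integral>\<^sup>+xs. ?X k2 ys * ?I ys xs \<partial>replicate_pmf k1 q \<partial>replicate_pmf k2 q)"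
      by (subst nn_integral_pmf_swap[where p = "replicate_pmf k2 q" and q = "replicate_pmf k1 q"])
        (simp add: nn_integral_add nn_integral_cmult)
    also have "\<dots> \<le> ennreal 2 * ennreal (?V * C_conc) + ennreal 2 * ennreal (?V * C_conc)"
      using k by (intro add_mono mult_left_mono half) auto
    also have "\<dots> = ennreal (4 * (?V * C_conc))"
    proof -
      have "?V * C_conc \<ge> 0" using V C by simp
      then have "ennreal 2 * ennreal (?V * C_conc) = ennreal (2 * (?V * C_conc))"
        by (subst ennreal_mult) auto
      then show ?thesis using \<open>?V * C_conc \<ge> 0\<close> by (simp add: mult.commute flip: ennreal_plus)
    qed
    finally show ?thesis using V C by (subst (asm) ennreal_le_iff) auto
  qed
  then show ?thesis by blast
qed

end

section \<open>The canonical laws\<close>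

lemma coef_eq: "coef j = exp (- profile j)"
  by (simp add: coef_def profile_def exp_minus divide_inverse)

text \<open>For \<open>j \<ge> 1\<close> this is the power \<open>g - 1\<close> of
  \<open>j!\<close>. The value 0 at \<open>j = 0\<close> turns the sum over \<open>{1..}\<close>
  into a power series over all naturals; for \<open>g \<le> 1\<close> its coefficients are at most
  1.\<close>

definition tilt :: "real \<Rightarrow> nat \<Rightarrow> real" where
  "tilt g j = (if j = 0 then 0 else exp ((g - 1) * profile j))"

lemma tilt_bounds: "g \<le> 1 \<Longrightarrow> 0 \<le> tilt g j" "g \<le> 1 \<Longrightarrow> tilt g j \<le> 1"
  by (auto simp: tilt_def mult_nonpos_nonneg profile_nonneg)

lemma Z_term: "1 \<le> j \<Longrightarrow> coef j * x ^ j * exp (g * profile j) = tilt g j * x ^ j"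
proof -
  have "exp (- profile j) * exp (g * profile j) = exp ((g - 1) * profile j)"
    unfolding exp_add[symmetric] by (simp add: algebra_simps)
  then show "coef j * x ^ j * exp (g * profile j) = tilt g j * x ^ j" if "1 \<le> j"
    using that by (simp add: coef_eq tilt_def mult_ac)
qed

lemma Zfun_sums:
  assumes g: "g \<le> 1" and x: "0 \<le> x" "x < 1"
  shows "(\<lambda>j. tilt g j * x ^ j) sums Zfun g x"
proof -
  have s: "summable (\<lambda>j. norm (tilt g j * x ^ j))"
  proof (rule summable_comparison_test'[of "\<lambda>j. x ^ j" 0])
    show "summable (\<lambda>j. x ^ j)" using x by (simp add: summable_geometric_iff)
    fix j
    have "norm (norm (tilt g j * x ^ j)) = tilt g j * x ^ j"
      using tilt_bounds(1)[OF g, of j] x by simp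
    also have "\<dots> \<le> 1 * x ^ j"
      using tilt_bounds(2)[OF g] x by (intro mult_right_mono) auto
    finally show "norm (norm (tilt g j * x ^ j)) \<le> x ^ j" by simp
  qed
  then have sums: "(\<lambda>j. tilt g j * x ^ j) sums (\<Sum>j. tilt g j * x ^ j)"
    by (rule summable_sums[OF summable_norm_cancel])
  have "((\<lambda>j. tilt g j * x ^ j) has_sum (\<Sum>j. tilt g j * x ^ j)) UNIV"
    by (rule norm_summable_imp_has_sum[OF s sums])
  then have "((\<lambda>j. coef j * x ^ j * exp (g * profile j)) has_sum (\<Sum>j. tilt g j * x ^ j)) {1..}"
    by (rule has_sum_cong_neutral[THEN iffD1, rotated -1]) (auto simp: Z_term tilt_def)
  then show ?thesis using sums by (simp add: Zfun_def infsumI)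
qed

text \<open>As \<open>j \<ge> 1\<close>, replacing \<open>x\<close> by a larger \<open>y\<close>
  multiplies each term by at least \<open>y / x\<close>, and so the whole sum. Both families are
  summable because an infinite sum with value 1 cannot be the default value 0.\<close>

lemma Zfun_eq_1_unique:
  assumes "0 < x" "Zfun g x = 1" "0 < y" "Zfun g y = 1"
  shows "x = y"
proof -
  have False if xy: "0 < x" "x < y" and Z: "Zfun g x = 1" "Zfun g y = 1" for x y
  proof -
    let ?t = "\<lambda>x j. coef j * x ^ j * exp (g * profile j)"
    have s: "?t x summable_on {1..}" "?t y summable_on {1..}"
      using Z infsum_not_exists unfolding Zfun_def by force+
    have "y / x = (\<Sum>\<^sub>\<infinity>j\<in>{1..}. y / x * ?t x j)"
      using Z s by (subst infsum_cmult_right) (auto simp: Zfun_def)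
    also have "\<dots> \<le> (\<Sum>\<^sub>\<infinity>j\<in>{1..}. ?t y j)"
    proof (rule infsum_mono)
      show "(\<lambda>j. y / x * ?t x j) summable_on {1..}" by (intro summable_on_cmult_right s)
      fix j :: nat assume "j \<in> {1..}"
      then have "(y / x) ^ 1 \<le> (y / x) ^ j" using xy by (intro power_increasing) auto
      then have "y / x * x ^ j \<le> y ^ j" using xy by (simp add: power_divide field_simps)
      then have "coef j * (y / x * x ^ j) * exp (g * profile j) \<le> coef j * y ^ j * exp (g * profile j)"
        by (intro mult_right_mono mult_left_mono) (auto simp: coef_def)
      then show "y / x * ?t x j \<le> ?t y j" by (simp add: mult_ac)
    qed (use s in auto)
    finally have "y / x \<le> 1" using Z by (simp add: Zfun_def)
    then show False using xy by simp
  qed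
  then show ?thesis using assms by (meson linorder_neqE_linordered_idom)
qed

text \<open>At 1/2 the geometric series dominates and gives at most 1. At
  \<open>b = 1 - c / 4\<close> the first two terms suffice: \<open>b + c * b^2\<close> is at least 1
  because \<open>b \<ge> 3/4\<close> makes \<open>b^2\<close> exceed 1/4. The intermediate value
  theorem does the rest.\<close>

lemma Zfun_eq_1_exists:
  assumes g: "g \<le> 1"
  shows "\<exists>x. 1/2 \<le> x \<and> x < 1 \<and> Zfun g x = 1"
proof -
  define c where "c = tilt g 2"
  have c: "0 < c" "c \<le> 1" using tilt_bounds[OF g, of 2] by (auto simp: c_def tilt_def)
  define b where "b = 1 - c / 4"
  have b: "3/4 \<le> b" "b < 1" using c by (auto simp: b_def)
  have low: "Zfun g (1/2) \<le> 1"
  proof -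
    have s1: "(\<lambda>j. if j = 0 then 0 else (1/2) ^ j :: real) sums 1"
    proof -
      have "pmf qstar = (\<lambda>j. if j = 0 then 0 else (1/2) ^ j)" by (auto simp: pmf_qstar fun_eq_iff)
      then show ?thesis using pmf_nat_sums_1[of qstar] by simp
    qed
    have s2: "(\<lambda>j. tilt g j * (1/2) ^ j) sums Zfun g (1/2)" by (rule Zfun_sums[OF g]) auto
    have le: "tilt g j * (1/2) ^ j \<le> (if j = 0 then 0 else (1/2) ^ j)" for j
      using tilt_bounds[OF g, of j] by (cases "j = 0") (auto simp: tilt_def)
    show ?thesis by (rule sums_le[OF le s2 s1])
  qed
  have high: "1 \<le> Zfun g b"
  proof -
    have Z: "(\<lambda>j. tilt g j * b ^ j) sums Zfun g b" using b by (intro Zfun_sums[OF g]) auto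
    have "(\<Sum>j\<in>{1,2}. tilt g j * b ^ j) \<le> (\<Sum>j. tilt g j * b ^ j)"
      using Z tilt_bounds[OF g] b by (intro sum_le_suminf) (auto simp: sums_iff)
    then have "b + c * b\<^sup>2 \<le> Zfun g b" using Z by (simp add: sums_iff tilt_def c_def profile_small)
    moreover have "c * (3/4)\<^sup>2 \<le> c * b\<^sup>2" using b c by (intro mult_left_mono power_mono) auto
    then have "c / 4 \<le> c * b\<^sup>2" using c by (simp add: power2_eq_square)
    ultimately show ?thesis by (simp add: b_def)
  qed
  have "\<exists>x\<ge>1/2. x \<le> b \<and> Zfun g x = 1"
  proof (rule IVT')
    show "continuous_on {1/2..b} (Zfun g)"
    proof -
      have "continuous_on {1/2..b} (\<lambda>x. \<Sum>j. tilt g j * x ^ j)"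
      proof (intro continuous_at_imp_continuous_on ballI)
        fix x assume "x \<in> {1/2..b}"
        moreover have "summable (\<lambda>j. tilt g j * ((1 + b) / 2) ^ j)"
          using b Zfun_sums[OF g, of "(1 + b) / 2"] by (simp add: sums_iff)
        ultimately show "isCont (\<lambda>x. \<Sum>j. tilt g j * x ^ j) x"
          using b by (intro isCont_powser[where K = "(1 + b) / 2"]) auto
      qed
      then show ?thesis
        by (rule continuous_on_cong[THEN iffD1, rotated -1])
          (use b Zfun_sums[OF g] in \<open>auto simp: sums_iff\<close>)
    qed
  qed (use low high b in auto)
  then show ?thesis using b by auto
qed

lemma x_sol:
  assumes "g \<le> 1"
  shows "1/2 \<le> x_sol g" "x_sol g < 1" "Zfun g (x_sol g) = 1"
proof -
  obtain x where x: "1/2 \<le> x" "x < 1" "Zfun g x = 1" using Zfun_eq_1_exists[OF assms] by blast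
  have "x_sol g = x" unfolding x_sol_def
    by (rule the_equality) (use x Zfun_eq_1_unique in auto)
  then show "1/2 \<le> x_sol g" "x_sol g < 1" "Zfun g (x_sol g) = 1" using x by auto
qed

lemma x_sol_eqI: "0 < x \<Longrightarrow> Zfun g x = 1 \<Longrightarrow> x_sol g = x"
  unfolding x_sol_def using Zfun_eq_1_unique by (intro the_equality) auto

lemma pmf_qlaw:
  assumes g: "g \<le> 1"
  shows "pmf (qlaw g) j = tilt g j * x_sol g ^ j"
proof -
  let ?f = "\<lambda>j. if 1 \<le> j then coef j * x_sol g ^ j * exp (g * profile j) else 0"
  have f: "?f j = tilt g j * x_sol g ^ j" for j by (auto simp: Z_term tilt_def)
  have sums: "?f sums 1" unfolding f using Zfun_sums[OF g, of "x_sol g"] x_sol[OF g] by simp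
  have nn: "0 \<le> ?f j" for j unfolding f using tilt_bounds[OF g] x_sol[OF g] by auto
  have "pmf (qlaw g) j = ?f j" unfolding qlaw_def
  proof (rule pmf_embed_pmf)
    show "0 \<le> ?f j" for j by (rule nn)
    have "(\<integral>\<^sup>+ j. ennreal (?f j) \<partial>count_space UNIV) = (\<Sum>j. ennreal (?f j))"
      by (rule nn_integral_count_space_nat)
    also have "\<dots> = ennreal (\<Sum>j. ?f j)"
      by (rule suminf_ennreal2[OF nn]) (use sums in \<open>auto simp: sums_iff\<close>)
    finally show "(\<integral>\<^sup>+ j. ennreal (?f j) \<partial>count_space UNIV) = 1"
      using sums by (simp add: sums_iff)
  qed
  then show ?thesis unfolding f .
qed

section \<open>Geometric domination, uniform in the tilt\<close>

lemma profile_le_mult_ln: "profile j \<le> real j * ln (real j + 1)"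
proof (induction j)
  case (Suc j)
  have "profile (Suc j) \<le> real (Suc j) * ln (real (Suc j))"
    using Suc by (simp add: profile_Suc algebra_simps)
  also have "\<dots> \<le> real (Suc j) * ln (real (Suc j) + 1)" by (intro mult_left_mono) auto
  finally show ?case .
qed (simp add: profile_small)

text \<open>\<open>profile j / j\<close> is nondecreasing, because \<open>profile j\<close> is at
  most \<open>j\<close> times the next increment \<open>ln (j + 1)\<close>. Cross-multiplying avoids
  division by zero.\<close>

lemma profile_ratio_mono:
  assumes "i \<le> j"
  shows "profile i * real j \<le> profile j * real i"
  using assms
proof (induction j rule: dec_induct)
  case (step j)
  show ?case
  proof (cases "j = 0")
    case False
    have "real j * (profile i * real (Suc j)) \<le> real (Suc j) * (profile j * real i)"
      using mult_left_mono[OF step.IH, of "real (Suc j)"] by (simp add: mult_ac)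
    also have "\<dots> \<le> real j * (profile (Suc j) * real i)"
    proof -
      have "real (Suc j) * profile j \<le> real j * profile (Suc j)"
        using profile_le_mult_ln[of j] by (simp add: profile_Suc algebra_simps)
      then show ?thesis using mult_right_mono[of _ _ "real i"] by (simp add: mult.assoc[symmetric])
    qed
    finally show ?thesis using False by (simp only: mult_le_cancel_left_pos of_nat_0_less_iff)
  qed (use step in \<open>auto simp: profile_small\<close>)
qed simp

text \<open>Let \<open>r i\<close> be the logarithm of the ratio to \<open>(1/2)^i\<close>. Then
  \<open>r i / i\<close> is nonincreasing since \<open>g \<le> 1\<close>, so \<open>r j > 0\<close>
  forces \<open>r i \<ge> 0\<close> for all \<open>0 < i \<le> j\<close>. If the claim failed at
  \<open>j\<close>, the mass of \<open>{1..j}\<close> would exceed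
  \<open>1 - (1/2)^(j-1) + 2 * (1/2)^j\<close>, which is 1.\<close>

lemma pmf_qlaw_le:
  assumes g: "g \<le> 1"
  shows "pmf (qlaw g) j \<le> 2 * (1/2) ^ j"
proof (rule ccontr)
  assume "\<not> ?thesis"
  then have j: "pmf (qlaw g) j > 2 * (1/2) ^ j" by simp
  let ?x = "x_sol g"
  note x = x_sol[OF g]
  have j0: "j > 0"
  proof (rule ccontr)
    assume "\<not> j > 0"
    then show False using j by (simp add: pmf_qlaw[OF g] tilt_def)
  qed
  define r where "r = (\<lambda>i. real i * ln (2 * ?x) + (g - 1) * profile i)"
  have pm: "pmf (qlaw g) i = (1/2) ^ i * exp (r i)" if "i > 0" for i
  proof -
    have "exp (r i) = (2 * ?x) ^ i * exp ((g - 1) * profile i)"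
      using x by (simp add: r_def exp_add exp_of_nat_mult)
    then show ?thesis using that by (simp add: pmf_qlaw[OF g] tilt_def power_mult_distrib power_one_over)
  qed
  have "(1/2) ^ j * 2 < (1/2) ^ j * exp (r j)" using j pm[OF j0] by simp
  then have rj: "exp (r j) > 2" by simp
  then have rj0: "r j > 0" by (smt (verit) exp_le_one_iff)
  have ri: "r i \<ge> 0" if "0 < i" "i \<le> j" for i
  proof -
    have "(g - 1) * (profile j * real i) \<le> (g - 1) * (profile i * real j)"
      using profile_ratio_mono[OF that(2)] g by (intro mult_left_mono_neg) auto
    then have "real i * r j \<le> real j * r i" by (simp add: r_def algebra_simps)
    moreover have "0 \<le> real i * r j" using rj0 by simp
    ultimately have "0 \<le> real j * r i" by linarith
    then show ?thesis using j0 by (simp add: zero_le_mult_iff)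
  qed
  obtain j' where j': "j = Suc j'" using j0 gr0_conv_Suc by blast
  have geo: "(\<Sum>i\<in>{1..m}. (1/2::real) ^ i) = 1 - (1/2) ^ m" for m :: nat
    by (induction m) auto
  have "1 = (\<Sum>i\<in>{1..j'}. (1/2::real) ^ i) + 2 * (1/2) ^ j"
    unfolding geo j' by simp
  also have "\<dots> < (\<Sum>i\<in>{1..j'}. pmf (qlaw g) i) + pmf (qlaw g) j"
  proof (rule add_le_less_mono[OF sum_mono j])
    fix i assume "i \<in> {1..j'}"
    then have "0 < i" "i \<le> j" using j' by auto
    then show "(1/2) ^ i \<le> pmf (qlaw g) i" using ri[of i] by (simp add: pm)
  qed
  also have "\<dots> = (\<Sum>i\<in>{1..j}. pmf (qlaw g) i)" by (simp add: j')
  also have "\<dots> = measure_pmf.prob (qlaw g) {1..j}" by (simp add: measure_measure_pmf_finite)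
  also have "\<dots> \<le> 1" by simp
  finally show False by simp
qed

lemma step_law_qlaw:
  assumes "g \<le> 1"
  shows "step_law (qlaw g)"
proof
  show "pmf (qlaw g) j \<le> 2 * (1/2) ^ j" for j by (rule pmf_qlaw_le[OF assms])
  show "pmf (qlaw g) 0 = 0" "pmf (qlaw g) 1 > 0" "pmf (qlaw g) 2 > 0" "pmf (qlaw g) 3 > 0"
    using x_sol[OF assms] by (auto simp: pmf_qlaw[OF assms] tilt_def)
qed

lemma x_sol_1: "x_sol 1 = 1/2"
proof (rule x_sol_eqI)
  have "(\<lambda>j. tilt 1 j * (1/2) ^ j) sums Zfun 1 (1/2)" by (rule Zfun_sums) auto
  moreover have "tilt 1 j * (1/2) ^ j = pmf qstar j" for j by (auto simp: tilt_def pmf_qstar)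
  ultimately show "Zfun 1 (1/2) = 1" using pmf_nat_sums_1[of qstar] sums_unique2 by simp
qed simp

lemma qlaw_1: "qlaw 1 = qstar"
  by (rule pmf_eqI) (auto simp: pmf_qlaw pmf_qstar x_sol_1 tilt_def)

section \<open>Monotone dependence on the tilt\<close>

abbreviation EJ :: "real \<Rightarrow> real" where "EJ g \<equiv> measure_pmf.expectation (qlaw g) real"
abbreviation EV :: "real \<Rightarrow> real" where "EV g \<equiv> measure_pmf.expectation (qlaw g) profile"

lemma qlaw_integrable:
  assumes "g \<le> 1"
  shows "integrable (measure_pmf (qlaw g)) real" "integrable (measure_pmf (qlaw g)) profile"
  by (rule step_law.integrable_moments[OF step_law_qlaw[OF assms]])+

lemma EJ_sums: "g \<le> 1 \<Longrightarrow> (\<lambda>j. pmf (qlaw g) j * real j) sums EJ g"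
  and EV_sums: "g \<le> 1 \<Longrightarrow> (\<lambda>j. pmf (qlaw g) j * profile j) sums EV g"
  by (auto intro!: expectation_pmf_nat_sums qlaw_integrable)

lemma EJ_ge_1:
  assumes "g \<le> 1"
  shows "EJ g \<ge> 1"
proof (rule sums_le[OF _ pmf_nat_sums_1 EJ_sums[OF assms]])
  fix j
  show "pmf (qlaw g) j \<le> pmf (qlaw g) j * real j"
  proof (cases "j = 0")
    case False
    then show ?thesis using mult_left_mono[of 1 "real j" "pmf (qlaw g) j"] by simp
  qed (simp add: pmf_qlaw[OF assms] tilt_def)
qed

lemma EV_nonneg: "EV g \<ge> 0"
  by (intro Bochner_Integration.integral_nonneg profile_nonneg)

text \<open>Times \<open>EJ g'\<close>, the right-hand side is the relative entropy of
  \<open>qlaw g'\<close> with respect to \<open>qlaw g\<close>. Geometrically,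
  \<open>- ln (x_sol g)\<close> lies strictly above its tangent of slope \<open>rho_of g'\<close> at
  \<open>g'\<close>. The monotonicity of \<open>x_sol\<close> and \<open>rho_of\<close> and their
  continuity rest on this.\<close>

lemma gibbs:
  assumes g: "g \<le> 1" "g' \<le> 1" "g \<noteq> g'"
  shows "0 < (ln (x_sol g') - ln (x_sol g)) + (g' - g) * rho_of g'"
proof -
  let ?x = "x_sol g" and ?x' = "x_sol g'" and ?q = "pmf (qlaw g)" and ?q' = "pmf (qlaw g')"
  \<comment> \<open>The terms of the relative entropy, corrected by \<open>?q j - ?q' j\<close>,
    which adds 0 to the total but makes every term nonnegative.\<close>
  define K where "K = (\<lambda>j. ?q' j * (real j * (ln ?x' - ln ?x) + (g' - g) * profile j) - ?q' j + ?q j)"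
  note x = x_sol[OF g(1)] x_sol[OF g(2)]
  have K: "K sums ((ln ?x' - ln ?x) * EJ g' + (g' - g) * EV g' - 1 + 1)"
  proof -
    have "(\<lambda>j. (ln ?x' - ln ?x) * (?q' j * real j) + (g' - g) * (?q' j * profile j) - ?q' j + ?q j) sums
        ((ln ?x' - ln ?x) * EJ g' + (g' - g) * EV g' - 1 + 1)"
      by (intro sums_add sums_diff sums_mult EJ_sums EV_sums g pmf_nat_sums_1)
    then show ?thesis by (simp add: K_def algebra_simps)
  qed
  have Kj: "K j \<ge> 0 \<and> (?q j \<noteq> ?q' j \<longrightarrow> K j > 0)" for j
  proof (cases "j = 0")
    case True
    then show ?thesis by (simp add: K_def pmf_qlaw g tilt_def)
  next
    case False
    have pos: "?q j > 0" "?q' j > 0" using False x by (simp_all add: pmf_qlaw g tilt_def)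
    have lnq: "ln (?q j) = real j * ln ?x + (g - 1) * profile j" "ln (?q' j) = real j * ln ?x' + (g' - 1) * profile j"
      using False x by (simp_all add: pmf_qlaw g tilt_def ln_mult ln_realpow)
    define y where "y = ?q j / ?q' j"
    have y: "y > 0" using pos by (simp add: y_def)
    have lny: "ln y = ln (?q j) - ln (?q' j)" using pos by (simp add: y_def ln_div)
    have "?q' j * y = ?q j" using pos by (simp add: y_def)
    then have "K j = ?q' j * (y - 1 - ln y)"
      unfolding K_def lny lnq by (simp add: algebra_simps)
    moreover have "ln y \<le> y - 1" using y by (rule ln_le_minus_one)
    moreover have "ln y < y - 1" if "?q j \<noteq> ?q' j"
    proof -
      have "y \<noteq> 1" using that pos by (simp add: y_def)
      then show ?thesis using ln_eq_minus_one[OF y] ln_le_minus_one[OF y] by fastforce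
    qed
    ultimately show ?thesis using pos by auto
  qed
  have "\<exists>j. ?q j \<noteq> ?q' j"
  proof (rule ccontr)
    assume "\<not> ?thesis"
    then have eq: "?q 1 = ?q' 1" "?q 2 = ?q' 2" by auto
    from eq(1) have "?x = ?x'" by (simp add: pmf_qlaw g tilt_def profile_small)
    with eq(2) x have "exp ((g - 1) * ln 2) = exp ((g' - 1) * ln 2)"
      by (simp add: pmf_qlaw g tilt_def profile_small)
    then show False using g by simp
  qed
  then have "suminf K > 0"
    using suminf_pos_iff[of K] K Kj by (auto simp: sums_iff)
  then have "0 < (ln ?x' - ln ?x) * EJ g' + (g' - g) * EV g'" using K by (simp add: sums_iff)
  moreover have "EJ g' > 0" using EJ_ge_1[OF g(2)] by linarith
  ultimately have "0 < ((ln ?x' - ln ?x) * EJ g' + (g' - g) * EV g') / EJ g'" by simp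
  then show ?thesis using \<open>EJ g' > 0\<close> by (simp add: rho_of_def add_divide_distrib)
qed

lemma rho_of_nonneg: "g \<le> 1 \<Longrightarrow> rho_of g \<ge> 0"
  using EJ_ge_1[of g] EV_nonneg[of g] by (simp add: rho_of_def)

text \<open>Adding the tangent inequalities at \<open>g\<close> and at \<open>g'\<close> cancels the
  logarithms.\<close>

lemma rho_of_less:
  assumes "g < g'" "g' \<le> 1"
  shows "rho_of g < rho_of g'"
proof -
  have "0 < (g' - g) * (rho_of g' - rho_of g)"
    using gibbs[of g g'] gibbs[of g' g] assms by (simp add: algebra_simps)
  then show ?thesis using assms by (simp add: zero_less_mult_iff)
qed

lemma x_sol_less:
  assumes "g < g'" "g' \<le> 1"
  shows "x_sol g' < x_sol g"
proof -
  have "0 \<le> (g' - g) * rho_of g" using assms rho_of_nonneg[of g] by simp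
  moreover have "0 < ln (x_sol g) - ln (x_sol g') + (g - g') * rho_of g"
    using gibbs[of g' g] assms by simp
  ultimately have "ln (x_sol g') < ln (x_sol g)" by (simp add: algebra_simps)
  then show ?thesis using x_sol(1)[of g] x_sol(1)[of g'] assms by simp
qed

text \<open>The ratio of two laws is monotone on the logarithmic scale up to a factor \<open>j\<close>, so the laws
  cross exactly once.\<close>

lemma EJ_less:
  assumes g: "g < g'" "g' \<le> 1"
  shows "EJ g < EJ g'"
proof -
  let ?q = "pmf (qlaw g)" and ?q' = "pmf (qlaw g')"
  have g1: "g \<le> 1" using g by simp
  note x = x_sol[OF g1] x_sol[OF g(2)] x_sol_less[OF g]
  define a where "a = ln (x_sol g) - ln (x_sol g')"
  have a: "a > 0" using x by (simp add: a_def)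
  have cross: "?q j \<le> ?q' j \<longleftrightarrow> a * real j \<le> (g' - g) * profile j" if "j > 0" for j
  proof -
    have "?q j \<le> ?q' j \<longleftrightarrow> ln (?q j) \<le> ln (?q' j)"
      using that x by (subst ln_le_cancel_iff) (simp_all add: pmf_qlaw g1 g tilt_def)
    also have "\<dots> \<longleftrightarrow> a * real j \<le> (g' - g) * profile j"
      using that x by (simp add: pmf_qlaw g1 g tilt_def ln_mult ln_realpow a_def algebra_simps)
    finally show ?thesis .
  qed
  have up: "?q k \<le> ?q' k" if "j > 0" "?q j \<le> ?q' j" "j \<le> k" for j k
  proof -
    have "real j * (a * real k) = real k * (a * real j)" by simp
    also have "\<dots> \<le> real k * ((g' - g) * profile j)" using that cross by (intro mult_left_mono) auto
    also have "\<dots> = (g' - g) * (profile j * real k)" by simp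
    also have "\<dots> \<le> (g' - g) * (profile k * real j)"
      using profile_ratio_mono[OF that(3)] g by (intro mult_left_mono) auto
    also have "\<dots> = real j * ((g' - g) * profile k)" by simp
    finally have "a * real k \<le> (g' - g) * profile k" using that(1) by simp
    then show ?thesis using cross[of k] that by simp
  qed
  have first: "?q 1 > ?q' 1" using x by (simp add: pmf_qlaw g1 g tilt_def profile_small)
  have sums1: "(\<lambda>j. ?q' j - ?q j) sums 0"
    using sums_diff[OF pmf_nat_sums_1[of "qlaw g'"] pmf_nat_sums_1[of "qlaw g"]] by simp
  have ex: "\<exists>j>0. ?q j \<le> ?q' j"
  proof (rule ccontr)
    assume neg: "\<not> ?thesis"
    have lt: "?q' j < ?q j" if "j > 0" for j using neg that by (meson not_le)
    have "0 < suminf (\<lambda>j. ?q j - ?q' j)"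
    proof (subst suminf_pos_iff)
      show "summable (\<lambda>j. ?q j - ?q' j)" using sums_minus[OF sums1] by (simp add: sums_iff)
      show "0 \<le> ?q j - ?q' j" for j using lt[of j] by (cases "j = 0") (auto simp: pmf_qlaw g1 g tilt_def)
      show "\<exists>i. 0 < ?q i - ?q' i" using first by (intro exI[of _ 1]) simp
    qed
    then show False using sums_minus[OF sums1] by (simp add: sums_iff)
  qed
  obtain j0 where j0: "j0 > 0" "?q j0 \<le> ?q' j0" and least: "\<And>j. 0 < j \<Longrightarrow> j < j0 \<Longrightarrow> \<not> ?q j \<le> ?q' j"
    using exists_least_iff[THEN iffD1, OF ex] by blast
  have j01: "j0 > 1" using j0 first by (cases "j0 = 1") auto
  \<comment> \<open>Both laws have total mass 1, so \<open>j\<close> may be replaced by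
    \<open>j - j0\<close>; this factor changes sign together with the difference of the
    laws.\<close>
  have diff: "(\<lambda>j. (real j - real j0) * (?q' j - ?q j)) sums (EJ g' - EJ g)"
  proof -
    have "(\<lambda>j. ?q' j * real j - ?q j * real j - real j0 * (?q' j - ?q j)) sums (EJ g' - EJ g - real j0 * 0)"
      by (intro sums_diff sums_mult sums1 EJ_sums g g1)
    then show ?thesis by (simp add: algebra_simps)
  qed
  have nn: "0 \<le> (real j - real j0) * (?q' j - ?q j)" for j
  proof -
    consider "j = 0" | "j \<ge> j0" | "0 < j" "j < j0" by linarith
    then show ?thesis
    proof cases
      case 1
      then show ?thesis by (simp add: pmf_qlaw g1 g tilt_def)
    next
      case 2
      then show ?thesis using up[OF j0, of j] by simp
    next
      case 3
      then show ?thesis using least[of j] by (intro mult_nonpos_nonpos) auto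
    qed
  qed
  have "0 < suminf (\<lambda>j. (real j - real j0) * (?q' j - ?q j))"
  proof (subst suminf_pos_iff)
    show "\<exists>i. 0 < (real i - real j0) * (?q' i - ?q i)"
      using first j01 by (intro exI[of _ 1]) (simp add: mult_neg_neg)
  qed (use diff nn in \<open>auto simp: sums_iff\<close>)
  then show ?thesis using diff by (simp add: sums_iff)
qed

section \<open>Continuity in the tilt\<close>

lemma summable_dominating: "summable (\<lambda>j. 2 * (1/2) ^ j * real j ^ 2)"
proof (rule summable_comparison_test_bigo)
  show "summable (\<lambda>j. norm ((3/4::real) ^ j))" by (simp add: summable_geometric_iff)
  show "(\<lambda>j::nat. 2 * (1/2) ^ j * real j ^ 2) \<in> O(\<lambda>j. (3/4) ^ j)" by real_asymp
qed

lemma rho_of_bounded: "\<exists>R>0. \<forall>g\<le>1. rho_of g \<le> R"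
proof -
  let ?R = "\<Sum>j. 2 * (1/2) ^ j * real j ^ 2 :: real"
  have "rho_of g \<le> ?R + 1" if g: "g \<le> 1" for g
  proof -
    have "rho_of g \<le> EV g"
      using EJ_ge_1[OF g] EV_nonneg[of g] unfolding rho_of_def by (simp add: divide_le_eq mult_le_cancel_left1)
    also have "\<dots> \<le> ?R"
      by (rule sums_le[OF _ EV_sums[OF g] summable_sums[OF summable_dominating]])
        (intro mult_mono pmf_qlaw_le profile_le_sq g profile_nonneg; simp)
    finally show ?thesis by simp
  qed
  moreover have "?R \<ge> 0" by (intro suminf_nonneg summable_dominating) auto
  ultimately show ?thesis by (intro exI[of _ "?R + 1"]) auto
qed

text \<open>The tangent inequalities in both orders enclose the increment, and the uniform bound on
  the slopes \<open>rho_of\<close> makes it Lipschitz.\<close>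

lemma continuous_on_ln_x_sol: "continuous_on {..1} (\<lambda>g. ln (x_sol g))"
proof -
  obtain R where R: "R > 0" "\<And>g. g \<le> 1 \<Longrightarrow> rho_of g \<le> R" using rho_of_bounded by blast
  have lip: "\<bar>ln (x_sol g') - ln (x_sol g)\<bar> \<le> R * \<bar>g' - g\<bar>" if "g \<le> 1" "g' \<le> 1" for g g'
  proof (cases "g = g'")
    case False
    have le: "\<bar>g' - g\<bar> * rho_of h \<le> R * \<bar>g' - g\<bar>" if "h \<le> 1" for h
      using mult_right_mono[OF R(2)[OF that], of "\<bar>g' - g\<bar>"] by (simp add: mult.commute)
    have ge: "(g' - g) * rho_of h \<le> \<bar>g' - g\<bar> * rho_of h" "(g - g') * rho_of h \<le> \<bar>g' - g\<bar> * rho_of h" if "h \<le> 1" for h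
      using rho_of_nonneg[OF that] by (auto intro!: mult_right_mono)
    show ?thesis
      using gibbs[OF that False] gibbs[OF that(2,1)] False le[OF that(1)] le[OF that(2)] ge[OF that(1)] ge[OF that(2)]
      by linarith
  qed simp
  show ?thesis unfolding continuous_on_iff
  proof (intro ballI allI impI)
    fix g e :: real assume g: "g \<in> {..1}" and e: "e > 0"
    show "\<exists>d>0. \<forall>g'\<in>{..1}. dist g' g < d \<longrightarrow> dist (ln (x_sol g')) (ln (x_sol g)) < e"
    proof (intro exI conjI ballI impI)
      show "e / R > 0" using e R by simp
      fix g' assume g': "g' \<in> {..1}" "dist g' g < e / R"
      then have "R * \<bar>g' - g\<bar> < e" using R by (simp add: dist_real_def field_simps)
      then show "dist (ln (x_sol g')) (ln (x_sol g)) < e"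
        using lip[of g g'] g g' by (simp add: dist_real_def)
    qed
  qed
qed

lemma continuous_on_x_sol: "continuous_on {..1} x_sol"
proof -
  have "continuous_on {..1} (\<lambda>g. exp (ln (x_sol g)))"
    by (intro continuous_intros continuous_on_ln_x_sol)
  then show ?thesis
    by (rule continuous_on_cong[THEN iffD1, rotated -1]) (use x_sol(1) in \<open>auto simp: less_le_trans[of 0 "1/2"]\<close>)
qed

text \<open>The geometric domination has a constant independent of \<open>g\<close>, so the series
  converges uniformly on \<open>{..1}\<close> by the Weierstrass M-test.\<close>

lemma continuous_on_expectation_qlaw:
  assumes f: "\<And>j. 0 \<le> f j \<and> f j \<le> real j ^ 2"
  shows "continuous_on {..1} (\<lambda>g. measure_pmf.expectation (qlaw g) f)"
proof -
  have "uniform_limit {..1} (\<lambda>n g. \<Sum>j<n. pmf (qlaw g) j * f j) (\<lambda>g. \<Sum>j. pmf (qlaw g) j * f j) sequentially"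
  proof (rule Weierstrass_m_test[OF _ summable_dominating])
    fix j g assume "g \<in> {..1::real}"
    then have "pmf (qlaw g) j * f j \<le> 2 * (1/2) ^ j * real j ^ 2"
      using f by (intro mult_mono pmf_qlaw_le) auto
    then show "norm (pmf (qlaw g) j * f j) \<le> 2 * (1/2) ^ j * real j ^ 2" using f by simp
  qed
  then have "continuous_on {..1} (\<lambda>g. \<Sum>j. pmf (qlaw g) j * f j)"
  proof (rule uniform_limit_theorem[rotated])
    show "\<forall>\<^sub>F n in sequentially. continuous_on {..1} (\<lambda>g. \<Sum>j<n. pmf (qlaw g) j * f j)"
    proof (intro always_eventually allI continuous_on_sum continuous_on_mult continuous_on_const)
      fix j
      have "continuous_on {..1} (\<lambda>g. (if j = 0 then 0 else exp ((g - 1) * profile j)) * x_sol g ^ j)"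
        by (cases "j = 0") (auto intro!: continuous_intros continuous_on_x_sol)
      then show "continuous_on {..1} (\<lambda>g. pmf (qlaw g) j)"
        by (rule continuous_on_cong[THEN iffD1, rotated -1]) (auto simp: pmf_qlaw tilt_def)
    qed
  qed simp
  moreover have "(\<Sum>j. pmf (qlaw g) j * f j) = measure_pmf.expectation (qlaw g) f" if "g \<le> 1" for g
  proof -
    have "\<bar>f j\<bar> \<le> real j ^ 4" for j
      using f[of j] step_law.power_le_power4[OF step_law_qlaw[OF that], of 2 j] by simp
    then have "integrable (measure_pmf (qlaw g)) f"
      by (rule step_law.integrable_poly[OF step_law_qlaw[OF that]])
    then show ?thesis using expectation_pmf_nat_sums sums_iff by blast
  qed
  ultimately show ?thesis by (auto intro: continuous_on_cong[THEN iffD1, rotated -1])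
qed

lemma continuous_on_rho_of: "continuous_on {..1} rho_of"
proof -
  have sq: "j \<le> j ^ 2" for j :: nat by (simp add: power2_eq_square le_square)
  have "continuous_on {..1} (\<lambda>g. EV g / EJ g)"
  proof (intro continuous_on_divide continuous_on_expectation_qlaw)
    show "\<forall>g\<in>{..1}. EJ g \<noteq> 0" using EJ_ge_1 by force
  qed (auto simp: profile_nonneg profile_le_sq sq)
  then show ?thesis by (simp add: rho_of_def[abs_def])
qed

section \<open>The critical constants\<close>

lemma rhostar_sums: "(\<lambda>j. (1/2) ^ j * ln (real j)) sums rhostar"
proof -
  have nonneg: "0 \<le> (1/2) ^ j * ln (real j)" for j by (cases j) auto
  have le: "(1/2) ^ j * ln (real j) \<le> 2 * (1/2) ^ j * real j ^ 2" for j
  proof (cases "j = 0")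
    case False
    then have "ln (real j) \<le> real j * 1" using ln_le_minus_one[of "real j"] by simp
    also have "\<dots> \<le> real j * (2 * real j)" using False by (intro mult_left_mono) auto
    finally have "(1/2) ^ j * ln (real j) \<le> (1/2) ^ j * (real j * (2 * real j))" by (intro mult_left_mono) auto
    then show ?thesis by (simp add: power2_eq_square mult_ac)
  qed simp
  have "summable (\<lambda>j. norm ((1/2) ^ j * ln (real j)))"
    by (rule summable_comparison_test'[OF summable_dominating, of 0]) (use le nonneg in simp)
  then have "((\<lambda>j. (1/2) ^ j * ln (real j)) has_sum (\<Sum>j. (1/2) ^ j * ln (real j))) UNIV"
    by (intro norm_summable_imp_has_sum summable_sums[OF summable_norm_cancel])
  then have "((\<lambda>j. (1/2) ^ j * ln (real j)) has_sum (\<Sum>j. (1/2) ^ j * ln (real j))) {1..}"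
    by (rule has_sum_cong_neutral[THEN iffD1, rotated -1]) (auto simp: Suc_le_eq)
  then have "rhostar = (\<Sum>j. (1/2) ^ j * ln (real j))" by (simp add: rhostar_def infsumI)
  then show ?thesis
    using summable_sums[OF summable_norm_cancel[OF \<open>summable (\<lambda>j. norm ((1/2) ^ j * ln (real j)))\<close>]] by simp
qed

text \<open>Shifting the index by one halves the weight, and
  \<open>profile (j + 1) = profile j + ln (j + 1)\<close>; hence
  \<open>EV 1 = EV 1 / 2 + rhostar\<close>. The same shift applied to the mean gives
  \<open>EJ 1 = 2\<close>.\<close>

lemma rho_of_1: "rho_of 1 = rhostar" and EJ_1: "EJ 1 = 2"
proof -
  have q: "pmf (qlaw 1) j = (if 1 \<le> j then (1/2) ^ j else 0)" for j
    by (simp add: qlaw_1 pmf_qstar)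
  have J: "(\<lambda>j. (1/2) ^ j * real j) sums EJ 1"
    using EJ_sums[of 1] by (rule sums_cong[THEN iffD1, rotated]) (auto simp: q)
  have V: "(\<lambda>j. (1/2) ^ j * profile j) sums EV 1"
  proof -
    have "pmf (qlaw 1) j * profile j = (1/2) ^ j * profile j" for j
      by (cases "j = 0") (simp_all add: q profile_small Suc_le_eq)
    then show ?thesis using EV_sums[of 1] by (simp only: order_refl)
  qed
  have "(\<lambda>j. (1/2) ^ Suc j * real (Suc j)) sums EJ 1"
    using J by (subst sums_Suc_iff) simp
  moreover have "(\<lambda>j. 1/2 * ((1/2) ^ j * real j) + (1/2) * (1/2) ^ j) sums (1/2 * EJ 1 + 1/2 * (1 / (1 - 1/2)))"
    by (intro sums_add sums_mult J geometric_sums) simp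
  ultimately have "EJ 1 = 1/2 * EJ 1 + 1/2 * (1 / (1 - 1/2))"
    by (intro sums_unique2) (simp_all add: algebra_simps add_divide_distrib)
  then show J2: "EJ 1 = 2" by simp
  have rs: "(\<lambda>j. (1/2) ^ Suc j * ln (real (Suc j))) sums (EV 1 - 1/2 * EV 1)"
  proof -
    have "(\<lambda>j. (1/2) ^ Suc j * profile (Suc j)) sums EV 1"
      using V by (subst sums_Suc_iff) (simp add: profile_small)
    then have "(\<lambda>j. (1/2) ^ Suc j * profile (Suc j) - 1/2 * ((1/2) ^ j * profile j)) sums (EV 1 - 1/2 * EV 1)"
      by (intro sums_diff sums_mult V)
    then show ?thesis by (simp add: profile_Suc algebra_simps add_divide_distrib del: of_nat_Suc)
  qed
  have "(\<lambda>j. (1/2) ^ j * ln (real j)) sums (EV 1 - 1/2 * EV 1)"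
    using rs by (subst (asm) sums_Suc_iff) simp
  then have "(\<lambda>j. (1/2) ^ j * ln (real j)) sums (EV 1 / 2)" by simp
  then have "rhostar = EV 1 / 2" by (rule sums_unique2[OF rhostar_sums])
  then show "rho_of 1 = rhostar" by (simp add: rho_of_def J2)
qed

text \<open>Apart from 2, each argument is a prime divided by a neighbouring number with smaller
  prime factors, or the inverse of such a quotient. Integer combinations of these logarithms give
  \<open>ln m\<close> for all \<open>m\<close> up to 25.\<close>

lemma ln_bounds:
  shows "ln (2::real) \<in> {0.69314717..0.69314719}"
    and "ln (3/2::real) \<in> {0.40546510..0.40546511}"
    and "ln (5/4::real) \<in> {0.22314355..0.22314356}"
    and "ln (8/7::real) \<in> {0.13353139..0.13353140}"
    and "ln (11/10::real) \<in> {0.09531017..0.09531019}"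
    and "ln (13/12::real) \<in> {0.08004270..0.08004271}"
    and "ln (17/16::real) \<in> {0.06062462..0.06062463}"
    and "ln (19/18::real) \<in> {0.05406722..0.05406723}"
    and "ln (24/23::real) \<in> {0.04255961..0.04255962}"
  subgoal using ln_approx_bounds[where x = "2" and n = 8] by (simp add: eval_nat_numeral)
  subgoal using ln_approx_bounds[where x = "3/2" and n = 6] by (simp add: eval_nat_numeral)
  subgoal using ln_approx_bounds[where x = "5/4" and n = 5] by (simp add: eval_nat_numeral)
  subgoal using ln_approx_bounds[where x = "8/7" and n = 4] by (simp add: eval_nat_numeral)
  subgoal using ln_approx_bounds[where x = "11/10" and n = 4] by (simp add: eval_nat_numeral)
  subgoal using ln_approx_bounds[where x = "13/12" and n = 4] by (simp add: eval_nat_numeral)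
  subgoal using ln_approx_bounds[where x = "17/16" and n = 4] by (simp add: eval_nat_numeral)
  subgoal using ln_approx_bounds[where x = "19/18" and n = 4] by (simp add: eval_nat_numeral)
  subgoal using ln_approx_bounds[where x = "24/23" and n = 4] by (simp add: eval_nat_numeral)
  done

lemma sums_half_mult: "(\<lambda>j. (1/2) ^ j * real j) sums 2"
proof -
  have "pmf (qlaw 1) j * real j = (1/2) ^ j * real j" for j
    by (cases "j = 0") (simp_all add: qlaw_1 pmf_qstar)
  then show ?thesis using EJ_sums[of 1] EJ_1 by (simp only: order_refl)
qed

lemma rhostar_numeric: "\<bar>rhostar - 0.507834\<bar> \<le> 0.0000005"
proof -
  let ?f = "\<lambda>j. (1/2) ^ j * ln (real j)"
  let ?S = "\<Sum>j<26. ?f j"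
  note f = rhostar_sums
  have nonneg: "0 \<le> ?f j" for j by (cases j) auto
  have lower: "?S \<le> rhostar"
    using f nonneg sum_le_suminf[of ?f "{..<26}"] by (simp add: sums_iff)
  \<comment> \<open>The tail from 26 on is bounded through \<open>ln (j + 26) \<le> 4 + j\<close>;
    the 4 and the final 2 belong to the sums of \<open>(1/2)^j\<close> and
    \<open>j * (1/2)^j\<close>, both equal to 2. The tail is then below
    \<open>2 / 10^7\<close>.\<close>
  have upper: "rhostar - ?S \<le> (1/2) ^ 26 * (4 * 2 + 2)"
  proof (rule sums_le)
    show "(\<lambda>j. ?f (j + 26)) sums (rhostar - ?S)" using f by (rule sums_split_initial_segment)
    have "(\<lambda>j. (1/2) ^ 26 * (4 * (1/2) ^ j + (1/2) ^ j * real j)) sums ((1/2) ^ 26 * (4 * (1 / (1 - 1/2)) + 2 :: real))"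
      by (intro sums_mult sums_add sums_half_mult geometric_sums) simp
    then show "(\<lambda>j. (1/2) ^ 26 * (4 * (1/2) ^ j + (1/2) ^ j * real j)) sums ((1/2) ^ 26 * (4 * 2 + 2 :: real))"
      by simp
    fix j
    have "ln (real (j + 26)) = ln (real (j + 26) / 26) + ln 26" by (simp add: ln_div)
    also have "ln (real (j + 26) / 26) \<le> real j"
    proof -
      have "real (j + 26) / 26 - 1 \<le> real j" by (simp add: add_divide_distrib)
      moreover have "ln (real (j + 26) / 26) \<le> real (j + 26) / 26 - 1" by (rule ln_le_minus_one) simp
      ultimately show ?thesis by linarith
    qed
    also have "ln (26::real) \<le> 4"
    proof -
      have "ln (26::real) \<le> ln (2 ^ 5)" by (subst ln_le_cancel_iff) auto
      also have "\<dots> = 5 * ln 2" by (subst ln_realpow) auto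
      also have "\<dots> \<le> 4" using ln2_le_25_over_36 by simp
      finally show ?thesis .
    qed
    finally have "ln (real (j + 26)) \<le> 4 + real j" by simp
    then have "?f (j + 26) \<le> (1/2) ^ (j + 26) * (4 + real j)" by (intro mult_left_mono) auto
    also have "\<dots> = (1/2) ^ 26 * (4 * (1/2) ^ j + (1/2) ^ j * real j)"
      unfolding power_add by (simp add: algebra_simps)
    finally show "?f (j + 26) \<le> (1/2) ^ 26 * (4 * (1/2) ^ j + (1/2) ^ j * real j)" .
  qed
  have composite: "ln (4::real) = 2 * ln 2" "ln (6::real) = ln 2 + ln 3" "ln (8::real) = 3 * ln 2" "ln (9::real) = 2 * ln 3"
      "ln (10::real) = ln 2 + ln 5" "ln (12::real) = 2 * ln 2 + ln 3" "ln (14::real) = ln 2 + ln 7" "ln (15::real) = ln 3 + ln 5"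
      "ln (16::real) = 4 * ln 2" "ln (18::real) = ln 2 + 2 * ln 3" "ln (20::real) = 2 * ln 2 + ln 5" "ln (21::real) = ln 3 + ln 7"
      "ln (22::real) = ln 2 + ln 11" "ln (24::real) = 3 * ln 2 + ln 3" "ln (25::real) = 2 * ln 5"
    using ln_mult[of 2 "2::real"] ln_mult[of 2 "3::real"] ln_mult[of 2 "4::real"] ln_mult[of 3 "3::real"] ln_mult[of 2 "5::real"]
      ln_mult[of 4 "3::real"] ln_mult[of 2 "7::real"] ln_mult[of 3 "5::real"] ln_mult[of 4 "4::real"] ln_mult[of 2 "9::real"]
      ln_mult[of 4 "5::real"] ln_mult[of 3 "7::real"] ln_mult[of 2 "11::real"] ln_mult[of 8 "3::real"] ln_mult[of 5 "5::real"] by simp_all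
  have primes: "ln (3::real) = ln 2 + ln (3/2)" "ln (5::real) = 2 * ln 2 + ln (5/4)" "ln (7::real) = 3 * ln 2 - ln (8/7)"
      "ln (11::real) = ln 10 + ln (11/10)" "ln (13::real) = ln 12 + ln (13/12)" "ln (17::real) = 4 * ln 2 + ln (17/16)"
      "ln (19::real) = ln 18 + ln (19/18)" "ln (23::real) = ln 24 - ln (24/23)"
    using composite by (simp_all add: ln_div)
  have "?S = ln 2 / 4 + ln 3 / 8 + ln 4 / 16 + ln 5 / 32 + ln 6 / 64 + ln 7 / 128 + ln 8 / 256 + ln 9 / 512 + ln 10 / 1024
      + ln 11 / 2048 + ln 12 / 4096 + ln 13 / 8192 + ln 14 / 16384 + ln 15 / 32768 + ln 16 / 65536 + ln 17 / 131072 + ln 18 / 262144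
      + ln 19 / 524288 + ln 20 / 1048576 + ln 21 / 2097152 + ln 22 / 4194304 + ln 23 / 8388608 + ln 24 / 16777216 + ln 25 / 33554432"
    by (simp add: lessThan_nat_numeral lessThan_Suc power_divide)
  \<comment> \<open>The partial sum in the chosen logarithms, over the common denominator
    \<open>2^25\<close>; both remaining estimates are linear in them.\<close>
  then have S: "?S = 21433148 / 33554432 * ln (2) + 4863382 / 33554432 * ln (3/2) + 1098794 / 33554432 * ln (5/4) - 264208 / 33554432 * ln (8/7) + 16392 / 33554432 * ln (11/10) + 4096 / 33554432 * ln (13/12) + 256 / 33554432 * ln (17/16) + 64 / 33554432 * ln (19/18) - 4 / 33554432 * ln (24/23)"
    unfolding composite primes composite by (simp add: field_simps)
  note b = ln_bounds[unfolded atLeastAtMost_iff, THEN conjunct1, simplified] ln_bounds[unfolded atLeastAtMost_iff, THEN conjunct2, simplified]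
  have "?S \<le> 507834 / 1000000" using b unfolding S by linarith
  moreover have "5078336 / 10000000 \<le> ?S" using b unfolding S by linarith
  moreover have "(1/2) ^ 26 * (4 * 2 + 2) \<le> (2 / 10000000 :: real)" by (simp add: power_divide)
  ultimately have "5078336 / 10000000 \<le> rhostar" "rhostar \<le> 507834 / 1000000 + 2 / 10000000"
    using lower upper by linarith+
  then show ?thesis by (intro abs_leI) simp_all
qed

text \<open>The tangent at \<open>g\<close> is compared with the value at 1, where
  \<open>x_sol\<close> is 1/2, and \<open>x_sol g < 1\<close>. Rates near 0 are thus reached by very
  negative \<open>g\<close>.\<close>

lemma rho_of_le: "g < 1 \<Longrightarrow> rho_of g \<le> ln 2 / (1 - g)"
proof -
  assume g: "g < 1"
  have "0 < (ln (x_sol g) - ln (1/2)) + (g - 1) * rho_of g"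
    using gibbs[of 1 g] g by (simp add: x_sol_1)
  moreover have "ln (x_sol g) < 0" using x_sol(1,2)[of g] g by simp
  ultimately have "rho_of g * (1 - g) \<le> ln 2" by (simp add: ln_div algebra_simps)
  then show ?thesis using g by (simp add: field_simps)
qed

lemma rho_of_ex1:
  assumes "0 < \<rho>" "\<rho> < rhostar"
  shows "\<exists>!g. g < 1 \<and> rho_of g = \<rho>"
proof -
  \<comment> \<open>Chosen so that the bound \<open>ln 2 / (1 - g0)\<close> equals
    \<open>\<rho>\<close>.\<close>
  define g0 where "g0 = 1 - ln 2 / \<rho>"
  have g0: "g0 < 1" "rho_of g0 \<le> \<rho>"
    using assms rho_of_le[of g0] by (auto simp: g0_def)
  have "\<exists>g\<ge>g0. g \<le> 1 \<and> rho_of g = \<rho>"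
    using g0 assms by (intro IVT' continuous_on_subset[OF continuous_on_rho_of]) (auto simp: rho_of_1)
  then obtain g where g: "g \<le> 1" "rho_of g = \<rho>" by blast
  have "g \<noteq> 1" using g assms rho_of_1 by auto
  show ?thesis
  proof (rule ex1I[of _ g])
    show "g < 1 \<and> rho_of g = \<rho>" using g \<open>g \<noteq> 1\<close> by auto
    fix h assume "h < 1 \<and> rho_of h = \<rho>"
    then show "h = g" using g rho_of_less[of h g] rho_of_less[of g h] by (cases h g rule: linorder_cases) auto
  qed
qed

lemma alpha_of_1: "alpha_of 1 = 1/2"
  by (simp add: alpha_of_def EJ_1)

lemma alpha_of_less: "g < g' \<Longrightarrow> g' \<le> 1 \<Longrightarrow> alpha_of g' < alpha_of g"
  using EJ_less[of g g'] EJ_ge_1[of g] unfolding alpha_of_def by (intro divide_strict_left_mono) auto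

lemma alpha_of_less_1:
  assumes "g \<le> 1"
  shows "alpha_of g < 1"
proof -
  have "alpha_of (g - 1) \<le> 1" using EJ_ge_1[of "g - 1"] assms by (simp add: alpha_of_def)
  then show ?thesis using alpha_of_less[of "g - 1" g] assms by simp
qed

section \<open>The constrained model as a conditioned sample\<close>

lemma weight_eq: "weight js = exp (- sum_list (map profile js))"
  by (induction js) (auto simp: weight_def coef_eq simp flip: exp_add)

lemma prod_list_qlaw:
  assumes g: "g \<le> 1" and "\<forall>j\<in>set js. 1 \<le> j"
  shows "prod_list (map (pmf (qlaw g)) js) = x_sol g ^ sum_list js * exp ((g - 1) * sum_list (map profile js))"
  using assms(2)
  by (induction js) (auto simp: pmf_qlaw[OF g] tilt_def power_add exp_add distrib_left)

text \<open>The product law charges only lists of length \<open>k\<close> without 0, where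
  \<open>near\<close> and \<open>configs\<close> coincide.\<close>

lemma prob_near_eq_configs:
  assumes g: "g \<le> 1"
  shows "near_prob (qlaw g) k n (\<rho> * real n)
    = (\<Sum>js\<in>configs \<rho> n k. pmf (replicate_pmf k (qlaw g)) js)"
proof -
  let ?p = "replicate_pmf k (qlaw g)"
  have "near n (\<rho> * real n) \<inter> set_pmf ?p \<subseteq> configs \<rho> n k"
  proof
    fix js assume js: "js \<in> near n (\<rho> * real n) \<inter> set_pmf ?p"
    have "1 \<le> j" if "j \<in> set js" for j
    proof -
      have "j \<in> set_pmf (qlaw g)" using js that by (auto simp: set_replicate_pmf)
      moreover have "0 \<notin> set_pmf (qlaw g)" by (simp add: set_pmf_iff pmf_qlaw[OF g] tilt_def)
      ultimately show ?thesis by (metis less_one not_le)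
    qed
    then show "js \<in> configs \<rho> n k"
      using js length_replicate_pmf[of js k] by (auto simp: configs_def near_def)
  qed
  moreover have "configs \<rho> n k \<subseteq> near n (\<rho> * real n)" by (auto simp: configs_def near_def)
  ultimately have "near n (\<rho> * real n) \<inter> set_pmf ?p = configs \<rho> n k \<inter> set_pmf ?p" by blast
  then have "measure_pmf.prob ?p (near n (\<rho> * real n)) = measure_pmf.prob ?p (configs \<rho> n k)"
    by (metis measure_Int_set_pmf)
  then show ?thesis by (simp add: measure_measure_pmf_finite finite_configs)
qed

lemma weight_bounds:
  assumes g: "g \<le> 1" and js: "js \<in> configs \<rho> n k"
  defines "c \<equiv> exp (- g * \<rho> * real n) / x_sol g ^ n"
  shows "weight js \<le> c * exp \<bar>g\<bar> * pmf (replicate_pmf k (qlaw g)) js"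
    and "c * exp (- \<bar>g\<bar>) * pmf (replicate_pmf k (qlaw g)) js \<le> weight js"
proof -
  let ?V = "sum_list (map profile js)"
  have V: "\<bar>?V - \<rho> * real n\<bar> \<le> 1" and j: "\<forall>j\<in>set js. 1 \<le> j" "sum_list js = n" "length js = k"
    using js by (auto simp: configs_def)
  have x: "x_sol g > 0" using x_sol(1)[OF g] by linarith
  have p: "pmf (replicate_pmf k (qlaw g)) js = x_sol g ^ n * exp ((g - 1) * ?V)"
    using prod_list_qlaw[OF g j(1)] j by (simp add: pmf_replicate_pmf)
  have d: "\<bar>g * (?V - \<rho> * real n)\<bar> \<le> \<bar>g\<bar>"
    unfolding abs_mult using V mult_left_mono[OF V, of "\<bar>g\<bar>"] by simp
  have 1: "c * exp e * pmf (replicate_pmf k (qlaw g)) js = exp (- g * \<rho> * real n + e + (g - 1) * ?V)" for e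
    unfolding p c_def exp_add using x by simp
  show "weight js \<le> c * exp \<bar>g\<bar> * pmf (replicate_pmf k (qlaw g)) js"
    unfolding 1 weight_eq using d by (simp add: algebra_simps)
  show "c * exp (- \<bar>g\<bar>) * pmf (replicate_pmf k (qlaw g)) js \<le> weight js"
    unfolding 1 weight_eq using d by (simp add: algebra_simps)
qed

text \<open>The prefactor \<open>c\<close> does not depend on \<open>k\<close>. Comparing partition
  functions for different \<open>k\<close> is therefore the same, up to constants, as comparing
  probabilities.\<close>

lemma Wpart_bounds:
  fixes \<rho> :: real and n k :: nat
  assumes g: "g \<le> 1"
  defines "c \<equiv> exp (- g * \<rho> * real n) / x_sol g ^ n"
  defines "P \<equiv> near_prob (qlaw g) k n (\<rho> * real n)"
  shows "Wpart \<rho> n k \<le> c * exp \<bar>g\<bar> * P" and "c * exp (- \<bar>g\<bar>) * P \<le> Wpart \<rho> n k" and "c > 0"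
proof -
  show "c > 0" using x_sol(1)[OF g] by (simp add: c_def)
  show "Wpart \<rho> n k \<le> c * exp \<bar>g\<bar> * P" "c * exp (- \<bar>g\<bar>) * P \<le> Wpart \<rho> n k"
    unfolding P_def prob_near_eq_configs[OF g] Wpart_def sum_distrib_left c_def
    by (intro sum_mono weight_bounds g; assumption)+
qed

lemma optimalD:
  assumes "optimal \<rho> n k"
  shows "1 \<le> k" "k \<le> n" "\<And>l. 1 \<le> l \<Longrightarrow> l \<le> n \<Longrightarrow> Wpart \<rho> n l \<le> Wpart \<rho> n k"
  using assms unfolding optimal_def is_arg_max_def by (auto simp: not_less)

text \<open>A lower bound at any single reference length \<open>l\<close> passes to the maximizer;
  the upper and the lower comparison each cost \<open>exp \<bar>g\<bar>\<close>.\<close>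

lemma optimal_prob_ge:
  assumes g: "g \<le> 1" and opt: "optimal \<rho> n k" and l: "1 \<le> l" "l \<le> n"
    and b: "b > 0" "b \<le> near_prob (qlaw g) l n (\<rho> * real n)"
  shows "exp (- 2 * \<bar>g\<bar>) * b \<le> near_prob (qlaw g) k n (\<rho> * real n)"
    and "Wpart \<rho> n k > 0"
proof -
  define c where "c = exp (- g * \<rho> * real n) / x_sol g ^ n"
  note Wb = Wpart_bounds[OF g, where \<rho> = \<rho> and n = n, folded c_def]
  let ?P = "\<lambda>k. near_prob (qlaw g) k n (\<rho> * real n)"
  have c: "c > 0" by (rule Wb(3))
  have "c * (exp (- \<bar>g\<bar>) * b) \<le> c * exp (- \<bar>g\<bar>) * ?P l"
    unfolding mult.assoc using b c by (intro mult_left_mono) auto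
  also have "\<dots> \<le> Wpart \<rho> n l" by (rule Wb(2))
  also have "\<dots> \<le> Wpart \<rho> n k" by (rule optimalD(3)[OF opt l])
  finally have 1: "c * (exp (- \<bar>g\<bar>) * b) \<le> Wpart \<rho> n k" .
  have "0 < c * (exp (- \<bar>g\<bar>) * b)" using c b by (intro mult_pos_pos) auto
  then show "Wpart \<rho> n k > 0" using 1 by linarith
  have "Wpart \<rho> n k \<le> c * (exp \<bar>g\<bar> * ?P k)" using Wb(1) by (simp only: mult.assoc)
  then have "c * (exp (- \<bar>g\<bar>) * b) \<le> c * (exp \<bar>g\<bar> * ?P k)" using 1 by linarith
  then have "exp (- \<bar>g\<bar>) * b \<le> exp \<bar>g\<bar> * ?P k" using c by (simp only: mult_le_cancel_left_pos)
  then have "exp (- \<bar>g\<bar>) * (exp (- \<bar>g\<bar>) * b) \<le> exp (- \<bar>g\<bar>) * (exp \<bar>g\<bar> * ?P k)"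
    by (intro mult_left_mono) auto
  moreover have "exp (- \<bar>g\<bar>) * (exp (- \<bar>g\<bar>) * b) = exp (- 2 * \<bar>g\<bar>) * b"
    by (simp add: mult.assoc[symmetric] flip: exp_add)
  moreover have "exp (- \<bar>g\<bar>) * (exp \<bar>g\<bar> * ?P k) = ?P k"
    by (simp add: mult.assoc[symmetric] flip: exp_add)
  ultimately show "exp (- 2 * \<bar>g\<bar>) * b \<le> ?P k" by simp
qed

lemma mu_law_set:
  assumes "Wpart \<rho> n k > 0"
  shows "set_pmf (mu_law \<rho> n k) = configs \<rho> n k"
  using assms weight_pos by (auto simp: set_pmf_eq pmf_mu_law less_imp_neq[symmetric])

text \<open>Conditioning divides by the probability of the constraint, which accounts for
  \<open>exp L\<close>; the remaining \<open>2 * \<bar>g\<bar>\<close> comes from the width of the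
  profile window, once in the weight and once in the normalization.\<close>

lemma mu_law_dominated:
  assumes g: "g \<le> 1" and W: "Wpart \<rho> n k > 0"
    and P: "exp (- L) \<le> near_prob (qlaw g) k n (\<rho> * real n)"
  shows "pmf (mu_law \<rho> n k) js \<le> exp (L + 2 * \<bar>g\<bar>) * pmf (replicate_pmf k (qlaw g)) js"
proof (cases "js \<in> configs \<rho> n k")
  case True
  define c where "c = exp (- g * \<rho> * real n) / x_sol g ^ n"
  note Wb = Wpart_bounds[OF g, where \<rho> = \<rho> and n = n, folded c_def]
  let ?p = "pmf (replicate_pmf k (qlaw g)) js"
  have c: "c > 0" by (rule Wb(3))
  have "weight js * 1 \<le> c * exp \<bar>g\<bar> * ?p * 1" using weight_bounds(1)[OF g True, folded c_def] by simp
  also have "\<dots> = (c * exp \<bar>g\<bar> * ?p) * (exp L * exp (- L))" by (simp flip: exp_add)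
  also have "\<dots> = exp (L + 2 * \<bar>g\<bar>) * ?p * (c * exp (- \<bar>g\<bar>) * exp (- L))"
  proof -
    have "exp \<bar>g\<bar> = exp (2 * \<bar>g\<bar>) * exp (- \<bar>g\<bar>)" by (simp flip: exp_add)
    then show ?thesis by (simp only: exp_add mult_ac)
  qed
  also have "\<dots> \<le> exp (L + 2 * \<bar>g\<bar>) * ?p * Wpart \<rho> n k"
  proof (rule mult_left_mono)
    have "c * exp (- \<bar>g\<bar>) * exp (- L) \<le> c * exp (- \<bar>g\<bar>) * near_prob (qlaw g) k n (\<rho> * real n)"
      using P c by (intro mult_left_mono) auto
    also have "\<dots> \<le> Wpart \<rho> n k" by (rule Wb(2))
    finally show "c * exp (- \<bar>g\<bar>) * exp (- L) \<le> Wpart \<rho> n k" .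
  qed simp
  finally show ?thesis using True W by (simp add: pmf_mu_law pos_divide_le_eq)
qed (simp add: pmf_mu_law[OF W])

lemma mset_rotate: "mset (rotate m xs) = mset xs"
proof (induction m)
  case (Suc m)
  have "mset (rotate1 ys) = mset ys" for ys :: "'a list" by (cases ys) auto
  then show ?case using Suc by (simp add: rotate_def)
qed simp

lemma configs_rotate: "rotate m js \<in> configs \<rho> n k \<longleftrightarrow> js \<in> configs \<rho> n k"
proof -
  have "sum_list (map f (rotate m js)) = sum_list (map f js)" for f :: "nat \<Rightarrow> 'b::comm_monoid_add"
    by (metis mset_map mset_rotate sum_mset_sum_list)
  from this[of "\<lambda>j. j"] this[of profile] show ?thesis by (simp add: configs_def)
qed

lemma weight_rotate: "weight (rotate m js) = weight js"
  unfolding weight_def by (metis mset_map mset_rotate prod_mset_prod_list)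

lemma tv_dist_mu_marg_le:
  assumes g: "g \<le> 1" and W: "Wpart \<rho> n k > 0"
    and P: "exp (- L) \<le> near_prob (qlaw g) k n (\<rho> * real n)"
    and r: "1 \<le> r" "r \<le> k" and L: "L + 2 * \<bar>g\<bar> > 0"
  shows "tv_dist (mu_marg \<rho> n k r) (replicate_pmf r (qlaw g)) \<le> 2 * sqrt ((L + 2 * \<bar>g\<bar>) * (2 * real r) / real k)"
proof -
  have "tv_dist (mu_marg \<rho> n k r) (replicate_pmf r (qlaw g)) \<le> 2 * sqrt ((L + 2 * \<bar>g\<bar>) / real (k div r))"
    unfolding mu_marg_def
  proof (rule tv_dist_marginal_le[OF _ _ _ mu_law_dominated[OF g W P] r L])
    show "finite (set_pmf (mu_law \<rho> n k))" by (simp add: mu_law_set[OF W] finite_configs)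
    show "length js = k" if "js \<in> set_pmf (mu_law \<rho> n k)" for js
      using that by (simp add: mu_law_set[OF W] configs_def)
    show "pmf (mu_law \<rho> n k) (rotate m js) = pmf (mu_law \<rho> n k) js" for m js
      by (simp add: pmf_mu_law[OF W] configs_rotate weight_rotate)
  qed
  also have "\<dots> \<le> 2 * sqrt ((L + 2 * \<bar>g\<bar>) * (2 * real r) / real k)"
  \<comment> \<open>Because \<open>r \<le> k\<close>, rounding loses at most a factor 2:
    \<open>k div r\<close> is at least \<open>k / (2 * r)\<close>.\<close>
  proof (intro mult_left_mono real_sqrt_le_mono)
    have d: "k div r \<ge> 1" using r by (simp add: Suc_leI div_greater_zero_iff)
    have "k = r * (k div r) + k mod r" by simp
    also have "\<dots> \<le> r * (k div r) + r * (k div r)"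
    proof -
      have "k mod r < r" using r by simp
      also have "r \<le> r * (k div r)" using d by simp
      finally show ?thesis by (intro add_left_mono less_imp_le)
    qed
    finally have "k \<le> 2 * r * (k div r)" by simp
    then have "real k \<le> 2 * real r * real (k div r)" by (metis of_nat_le_iff of_nat_mult of_nat_numeral)
    then have "1 / real (k div r) \<le> 2 * real r / real k"
      using d r by (simp add: field_simps)
    then have "(L + 2 * \<bar>g\<bar>) * (1 / real (k div r)) \<le> (L + 2 * \<bar>g\<bar>) * (2 * real r / real k)"
      using L by (intro mult_left_mono) auto
    then show "(L + 2 * \<bar>g\<bar>) / real (k div r) \<le> (L + 2 * \<bar>g\<bar>) * (2 * real r) / real k" by simp
  qed simp
  finally show ?thesis .
qed

section \<open>Subcritical and critical profile rates\<close>

context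
  fixes g :: real
  assumes g: "g \<le> 1"
begin

interpretation law: step_law "qlaw g" by (rule step_law_qlaw[OF g])

lemma vmean_eq: "law.vmean = rho_of g * law.mean" "law.mean \<ge> 1" "alpha_of g = 1 / law.mean"
  using EJ_ge_1[OF g] by (simp_all add: law.vmean_def law.mean_def rho_of_def alpha_of_def)

text \<open>The reference length is \<open>n / mean\<close> rounded down. The sum then misses
  \<open>n\<close> by less than \<open>mean\<close>, and as \<open>vmean\<close> is
  \<open>rho_of g * mean\<close>, the profile misses its target by at most
  \<open>rho_of g * mean\<close>. Both errors are within \<open>A * sqrt k\<close>.\<close>

lemma prob_near_reference:
  "\<exists>c>0. \<forall>\<^sub>F n in sequentially. \<exists>k\<in>{1..n}. c / real n \<le> near_prob (qlaw g) k n (rho_of g * real n)"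
proof -
  define A where "A = law.mean * (1 + rho_of g)"
  have rho: "rho_of g \<ge> 0" by (rule rho_of_nonneg[OF g])
  have A: "A \<ge> law.mean" "A \<ge> rho_of g * law.mean" "A \<ge> 0"
    using vmean_eq(2) rho by (auto simp: A_def algebra_simps)
  obtain c K where c: "c > 0" and low: "\<And>k n w. k \<ge> K \<Longrightarrow> \<bar>real n - real k * law.mean\<bar> \<le> A * sqrt k \<Longrightarrow>
      \<bar>w - real k * law.vmean\<bar> \<le> A * sqrt k \<Longrightarrow> near_prob (qlaw g) k n w \<ge> c / real k"
    using law.prob_near_lower[OF A(3)] by blast
  have ref: "\<exists>k\<in>{1..n}. c / real n \<le> near_prob (qlaw g) k n (rho_of g * real n)"
    if n: "real n \<ge> law.mean * (real K + 1)" for n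
  proof -
    define k where "k = nat \<lfloor>real n / law.mean\<rfloor>"
    have m: "law.mean \<ge> 1" by (rule vmean_eq)
    have nm: "real n / law.mean \<ge> real K + 1" using n m by (simp add: field_simps)
    have k: "real k \<le> real n / law.mean" "real n / law.mean < real k + 1" "real k \<ge> real K" "k \<ge> 1"
      using nm unfolding k_def by linarith+
    have km: "real k * law.mean \<le> real n" "real n < real k * law.mean + law.mean"
      using k(1,2) m by (auto simp: field_simps)
    have "real k * 1 \<le> real k * law.mean" using m by (intro mult_left_mono) auto
    then have kn: "k \<le> n" using km by linarith
    have s1: "sqrt k \<ge> 1" using k(4) by simp
    have "A * 1 \<le> A * sqrt k" using A s1 by (intro mult_left_mono) auto
    moreover have "\<bar>real n - real k * law.mean\<bar> \<le> law.mean" using km by linarith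
    moreover have "\<bar>rho_of g * real n - real k * law.vmean\<bar> \<le> rho_of g * law.mean"
    proof -
      have "rho_of g * real n - real k * law.vmean = rho_of g * (real n - real k * law.mean)"
        by (simp add: vmean_eq algebra_simps)
      then show ?thesis using km rho by (simp add: abs_mult mult_left_mono)
    qed
    ultimately have "c / real k \<le> near_prob (qlaw g) k n (rho_of g * real n)"
      using k A by (intro low) auto
    moreover have "c / real n \<le> c / real k" using kn k c by (intro divide_left_mono) auto
    ultimately show ?thesis using k kn by (intro bexI[of _ k]) auto
  qed
  have "\<forall>\<^sub>F n in sequentially. real n \<ge> law.mean * (real K + 1)" by real_asymp
  then have "\<forall>\<^sub>F n in sequentially. \<exists>k\<in>{1..n}. c / real n \<le> near_prob (qlaw g) k n (rho_of g * real n)"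
    by (rule eventually_mono) (rule ref)
  then show ?thesis using c by blast
qed

text \<open>At a maximizer the probability is at least \<open>c / n\<close>, while its product with
  the squared deviation of \<open>n\<close> from \<open>k * mean\<close> is bounded. So that
  deviation is at most of order \<open>sqrt n\<close>.\<close>

lemma optimal_support:
  "\<exists>C>0. \<exists>c>0. \<forall>\<^sub>F n in sequentially. \<forall>k. optimal (rho_of g) n k \<longrightarrow>
      \<bar>real k / real n - alpha_of g\<bar> \<le> C * real n powr (-1/2) \<and> Wpart (rho_of g) n k > 0 \<and>
      c / real n \<le> near_prob (qlaw g) k n (rho_of g * real n)"
proof -
  obtain c0 where c0: "c0 > 0" and ref: "\<forall>\<^sub>F n in sequentially. \<exists>k\<in>{1..n}. c0 / real n \<le> near_prob (qlaw g) k n (rho_of g * real n)"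
    using prob_near_reference by blast
  obtain C0 where C0: "\<And>k n w. (real n - real k * law.mean)\<^sup>2 * near_prob (qlaw g) k n w \<le> C0"
    using law.prob_near_deviation by blast
  define c where "c = exp (- 2 * \<bar>g\<bar>) * c0"
  have c: "c > 0" using c0 by (simp add: c_def)
  define C where "C = sqrt (\<bar>C0\<bar> / c) + 1"
  have C: "C > 0" using c by (simp add: C_def add_nonneg_pos)
  have "\<forall>\<^sub>F n in sequentially. \<forall>k. optimal (rho_of g) n k \<longrightarrow>
      \<bar>real k / real n - alpha_of g\<bar> \<le> C * real n powr (-1/2) \<and> Wpart (rho_of g) n k > 0 \<and>
      c / real n \<le> near_prob (qlaw g) k n (rho_of g * real n)"
    using ref eventually_gt_at_top[of 0]
  proof eventually_elim
    case (elim n)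
    show ?case
    proof (intro allI impI)
      fix k assume opt: "optimal (rho_of g) n k"
      let ?P = "\<lambda>k. near_prob (qlaw g) k n (rho_of g * real n)"
      obtain l where l: "1 \<le> l" "l \<le> n" "c0 / real n \<le> ?P l" using elim by auto
      have pos: "c0 / real n > 0" using c0 elim by simp
      note og = optimal_prob_ge[OF g opt l(1,2) pos l(3)]
      have P: "c / real n \<le> ?P k" using og(1) by (simp add: c_def)
      define D where "D = real n - real k * law.mean"
      have "D\<^sup>2 * (c / real n) \<le> D\<^sup>2 * ?P k" using P by (intro mult_left_mono) auto
      also have "\<dots> \<le> C0" using C0 by (simp add: D_def)
      also have "\<dots> \<le> \<bar>C0\<bar>" by simp
      finally have "D\<^sup>2 \<le> \<bar>C0\<bar> / c * real n" using c elim by (simp add: field_simps)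
      then have "sqrt (D\<^sup>2) \<le> sqrt (\<bar>C0\<bar> / c * real n)" by (rule real_sqrt_le_mono)
      then have "sqrt (D\<^sup>2) \<le> sqrt (\<bar>C0\<bar> / c) * sqrt n" by (simp only: real_sqrt_mult)
      then have D: "\<bar>D\<bar> \<le> sqrt (\<bar>C0\<bar> / c) * sqrt n" by (simp only: real_sqrt_abs)
      have m: "law.mean \<ge> 1" by (rule vmean_eq)
      have "real k / real n - alpha_of g = - D / (real n * law.mean)"
        using m elim by (simp add: vmean_eq(3) D_def field_simps)
      then have "\<bar>real k / real n - alpha_of g\<bar> = \<bar>D\<bar> / (real n * law.mean)"
        using m by (simp add: abs_mult)
      also have "\<dots> \<le> \<bar>D\<bar> / (real n * 1)"
        using m elim by (intro divide_left_mono mult_left_mono) auto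
      also have "\<dots> \<le> C * sqrt n / real n"
      proof -
        have "\<bar>D\<bar> \<le> C * sqrt n"
          unfolding C_def distrib_right using D by (intro add_increasing2) auto
        then show ?thesis by (simp add: divide_right_mono)
      qed
      also have "\<dots> = C * real n powr (-1/2)"
      proof -
        have "real n powr (-1/2) = 1 / sqrt n" by (simp add: powr_minus_divide powr_half_sqrt)
        moreover have "sqrt n / real n = 1 / sqrt n" using elim by (simp add: frac_eq_eq)
        ultimately have "sqrt n / real n = real n powr (-1/2)" by (simp only:)
        then show ?thesis by (simp only: times_divide_eq_right[symmetric])
      qed
      finally show "\<bar>real k / real n - alpha_of g\<bar> \<le> C * real n powr (-1/2) \<and> Wpart (rho_of g) n k > 0 \<and> c / real n \<le> ?P k"
        using P og(2) by blast
    qed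
  qed
  then show ?thesis using c C by blast
qed

text \<open>The probability of order \<open>1 / n\<close> gives \<open>L = ln n - ln c\<close>, and
  the support bound makes \<open>k\<close> at least \<open>alpha_of g * n / 2\<close>; the general
  estimate is then of the order of the square root of \<open>ln n / n\<close>.\<close>

lemma optimal_marginals:
  assumes r: "1 \<le> r"
  shows "\<exists>C. \<forall>\<^sub>F n in sequentially. \<forall>k. optimal (rho_of g) n k \<longrightarrow>
      0 < Wpart (rho_of g) n k \<and> r \<le> k \<and>
      tv_dist (mu_marg (rho_of g) n k r) (replicate_pmf r (qlaw g)) \<le> C * (ln (real n) / real n) powr (1/2)"
proof -
  obtain C c where C: "C > 0" and c: "c > 0" and ev: "\<forall>\<^sub>F n in sequentially. \<forall>k. optimal (rho_of g) n k \<longrightarrow>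
      \<bar>real k / real n - alpha_of g\<bar> \<le> C * real n powr (-1/2) \<and> Wpart (rho_of g) n k > 0 \<and>
      c / real n \<le> near_prob (qlaw g) k n (rho_of g * real n)"
    using optimal_support by blast
  define a where "a = alpha_of g"
  have a: "a > 0" using vmean_eq by (simp add: a_def)
  have e1: "\<forall>\<^sub>F n::nat in sequentially. C * real n powr (-1/2) \<le> a / 2" using C a by real_asymp
  have e2: "\<forall>\<^sub>F n::nat in sequentially. real r \<le> a / 2 * real n" using a by real_asymp
  have e3: "\<forall>\<^sub>F n::nat in sequentially. (ln (real n) - ln c) + 2 * \<bar>g\<bar> \<le> 2 * ln (real n)" by real_asymp
  have e4: "\<forall>\<^sub>F n::nat in sequentially. (ln (real n) - ln c) + 2 * \<bar>g\<bar> > 0" by real_asymp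
  have "\<forall>\<^sub>F n in sequentially. \<forall>k. optimal (rho_of g) n k \<longrightarrow>
      0 < Wpart (rho_of g) n k \<and> r \<le> k \<and>
      tv_dist (mu_marg (rho_of g) n k r) (replicate_pmf r (qlaw g)) \<le> (2 * sqrt (8 * real r / a)) * (ln (real n) / real n) powr (1/2)"
    using ev e1 e2 e3 e4 eventually_gt_at_top[of 1]
  proof eventually_elim
    case (elim n)
    show ?case
    proof (intro allI impI)
      fix k assume opt: "optimal (rho_of g) n k"
      let ?P = "near_prob (qlaw g) k n (rho_of g * real n)"
      have W: "Wpart (rho_of g) n k > 0" and P: "c / real n \<le> ?P" and k: "\<bar>real k / real n - a\<bar> \<le> a / 2"
        using elim opt unfolding a_def by force+
      have n: "n > 1" using elim by simp
      have "real k / real n \<ge> a / 2" using k by linarith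
      then have kn: "real k \<ge> a / 2 * real n" using n by (simp add: field_simps)
      then have rk: "r \<le> k" using elim by linarith
      define L where "L = ln (real n) - ln c"
      have "exp (- L) = c / real n" using c n by (simp add: L_def exp_diff)
      then have "tv_dist (mu_marg (rho_of g) n k r) (replicate_pmf r (qlaw g)) \<le> 2 * sqrt ((L + 2 * \<bar>g\<bar>) * (2 * real r) / real k)"
        using P elim by (intro tv_dist_mu_marg_le[OF g W _ r rk]) (auto simp: L_def)
      also have "\<dots> \<le> 2 * sqrt ((2 * ln (real n)) * (2 * real r) / (a / 2 * real n))"
        using elim kn a n by (intro mult_left_mono real_sqrt_le_mono frac_le mult_right_mono) (auto simp: L_def)
      also have "(2 * ln (real n)) * (2 * real r) / (a / 2 * real n) = (8 * real r / a) * (ln (real n) / real n)"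
        using a n by (simp add: field_simps)
      also have "2 * sqrt (\<dots>) = (2 * sqrt (8 * real r / a)) * (ln (real n) / real n) powr (1/2)"
      proof -
        have "sqrt ((8 * real r / a) * (ln (real n) / real n)) = sqrt (8 * real r / a) * sqrt (ln (real n) / real n)"
          by (rule real_sqrt_mult)
        moreover have "(ln (real n) / real n) powr (1/2) = sqrt (ln (real n) / real n)"
          using n by (intro powr_half_sqrt) simp
        ultimately show ?thesis by simp
      qed
      finally show "0 < Wpart (rho_of g) n k \<and> r \<le> k \<and>
         tv_dist (mu_marg (rho_of g) n k r) (replicate_pmf r (qlaw g)) \<le> (2 * sqrt (8 * real r / a)) * (ln (real n) / real n) powr (1/2)"
        using W rk by blast
    qed
  qed
  then show ?thesis by blast
qed

end

section \<open>Supercritical profile rates\<close>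

lemma nn_integral_power_qstar:
  assumes z: "0 < z" "z < 2"
  shows "(\<integral>\<^sup>+js. ennreal (z ^ sum_list js) \<partial>replicate_pmf k qstar) = ennreal ((z / (2 - z)) ^ k)"
proof (induction k)
  case (Suc k)
  have one: "(\<integral>\<^sup>+j. ennreal (z ^ j) \<partial>qstar) = ennreal (z / (2 - z))"
  proof -
    have "(\<lambda>j. (z / 2) ^ Suc j) sums (z / 2 * (1 / (1 - z / 2)))"
      using sums_mult[OF geometric_sums[of "z / 2"], of "z / 2"] z by simp
    moreover have "z / 2 * (1 / (1 - z / 2)) = z / (2 - z)" using z by (simp add: field_simps)
    ultimately have "(\<lambda>j. (\<lambda>i. pmf qstar i * z ^ i) (Suc j)) sums (z / (2 - z))"
      by (simp add: pmf_qstar power_divide)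
    from sums_Suc[OF this] have s: "(\<lambda>i. pmf qstar i * z ^ i) sums (z / (2 - z))" by (simp add: pmf_qstar)
    have "(\<integral>\<^sup>+j. ennreal (z ^ j) \<partial>qstar) = (\<Sum>j. ennreal (pmf qstar j * z ^ j))"
      using z by (simp add: nn_integral_pmf_nat ennreal_mult)
    also have "\<dots> = ennreal (\<Sum>j. pmf qstar j * z ^ j)"
      by (rule suminf_ennreal2) (use s z in \<open>auto simp: sums_iff\<close>)
    finally show ?thesis using s by (simp add: sums_iff)
  qed
  have "(\<integral>\<^sup>+js. ennreal (z ^ sum_list js) \<partial>replicate_pmf (Suc k) qstar)
     = (\<integral>\<^sup>+j. \<integral>\<^sup>+js. ennreal (z ^ j) * ennreal (z ^ sum_list js) \<partial>replicate_pmf k qstar \<partial>qstar)"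
    using z by (simp add: power_add ennreal_mult)
  also have "\<dots> = (\<integral>\<^sup>+j. ennreal (z ^ j) \<partial>qstar) * (\<integral>\<^sup>+js. ennreal (z ^ sum_list js) \<partial>replicate_pmf k qstar)"
    by (simp add: nn_integral_cmult nn_integral_multc)
  also have "\<dots> = ennreal ((z / (2 - z)) ^ Suc k)"
    unfolding one Suc.IH using z by (simp flip: ennreal_mult)
  finally show ?case .
qed simp

text \<open>Chernoff's bound with the generating function \<open>z / (2 - z)\<close> of
  \<open>qstar\<close>. The probability to be compared with is only known to be at least
  \<open>exp (- C * n / ln n)\<close>, so the decay has to be exponential, beyond what a second
  moment gives.\<close>

lemma prob_sum_qstar_le:
  assumes k: "k \<le> n" and n: "n \<ge> 1"
  shows "measure_pmf.prob (replicate_pmf k qstar) {js. sum_list js = n} \<le> exp (- (real n - 2 * real k)\<^sup>2 / (8 * real n))"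
proof -
  \<comment> \<open>The minimizer of \<open>2 * n * y^2 - (n - 2 * k) * y\<close>, to which the
    exponent is reduced below.\<close>
  define y where "y = (real n - 2 * real k) / (4 * real n)"
  let ?P = "measure_pmf.prob (replicate_pmf k qstar) {js. sum_list js = n}"
  have y: "\<bar>y\<bar> \<le> 1/2" using k n by (simp add: y_def abs_le_iff field_simps)
  have y': "1 + y > 0" "1 - y > 0" using y by (auto simp: abs_le_iff)
  have "ennreal ((1 + y) ^ n) * emeasure (replicate_pmf k qstar) {js. sum_list js = n}
      = (\<integral>\<^sup>+js. ennreal ((1 + y) ^ n) * indicator {js. sum_list js = n} js \<partial>replicate_pmf k qstar)"
    by (simp add: nn_integral_cmult)
  also have "\<dots> \<le> (\<integral>\<^sup>+js. ennreal ((1 + y) ^ sum_list js) \<partial>replicate_pmf k qstar)"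
    by (intro nn_integral_mono) (auto simp: indicator_def)
  also have "\<dots> = ennreal (((1 + y) / (1 - y)) ^ k)"
    using nn_integral_power_qstar[of "1 + y" k] y' by simp
  finally have "ennreal ((1 + y) ^ n * ?P) \<le> ennreal (((1 + y) / (1 - y)) ^ k)"
    using y' by (simp add: measure_pmf.emeasure_eq_measure ennreal_mult)
  then have "(1 + y) ^ n * ?P \<le> ((1 + y) / (1 - y)) ^ k"
    using y' by (subst (asm) ennreal_le_iff) auto
  then have "?P \<le> ((1 + y) / (1 - y)) ^ k / (1 + y) ^ n"
    using y' by (simp add: pos_le_divide_eq mult.commute)
  also have "\<dots> = exp (real k * (ln (1 + y) - ln (1 - y)) - real n * ln (1 + y))"
    using y' by (simp add: exp_diff exp_of_nat_mult power_divide)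
  also have "\<dots> \<le> exp (- (real n - 2 * real k)\<^sup>2 / (8 * real n))"
  proof -
    have l1: "ln (1 + y) \<ge> y - 2 * y\<^sup>2" and l2: "ln (1 - y) \<ge> - y - 2 * y\<^sup>2"
      using abs_ln_one_plus_x_minus_x_bound[of y] abs_ln_one_plus_x_minus_x_bound[of "- y"] y by (auto simp: abs_le_iff)
    \<comment> \<open>Regrouped with the nonnegative weights \<open>n - k\<close> and
      \<open>k\<close>, so that lower bounds of both logarithms suffice.\<close>
    have "real k * (ln (1 + y) - ln (1 - y)) - real n * ln (1 + y)
       = - ((real n - real k) * ln (1 + y)) - real k * ln (1 - y)" by (simp add: algebra_simps)
    also have "\<dots> \<le> - ((real n - real k) * (y - 2 * y\<^sup>2)) - real k * (- y - 2 * y\<^sup>2)"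
    proof -
      have "(real n - real k) * (y - 2 * y\<^sup>2) \<le> (real n - real k) * ln (1 + y)"
        using k l1 by (intro mult_left_mono) auto
      moreover have "real k * (- y - 2 * y\<^sup>2) \<le> real k * ln (1 - y)" using l2 by (intro mult_left_mono) auto
      ultimately show ?thesis by linarith
    qed
    also have "\<dots> = - ((real n - 2 * real k) * y) + 2 * real n * y\<^sup>2" by (simp add: algebra_simps)
    also have "\<dots> = - (real n - 2 * real k)\<^sup>2 / (8 * real n)"
      using n by (simp add: y_def power_divide power2_eq_square field_simps)
    finally show ?thesis by simp
  qed
  finally show ?thesis .
qed

section \<open>One large symbol carrying the excess profile\<close>

lemma prob_near_Suc_ge:
  assumes "j \<le> n"
  shows "pmf q j * near_prob q k (n - j) (w - profile j)
    \<le> near_prob q (Suc k) n w"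
proof -
  let ?P = "near_prob q k (n - j) (w - profile j)"
  have "ennreal (pmf q j * ?P) = emeasure q {j} * emeasure (replicate_pmf k q) (near (n - j) (w - profile j))"
    by (simp add: measure_pmf.emeasure_eq_measure measure_pmf_single ennreal_mult)
  also have "\<dots> = (\<integral>\<^sup>+i. indicator {j} i * emeasure (replicate_pmf k q) (near (n - j) (w - profile j)) \<partial>q)"
    by (simp add: nn_integral_multc)
  also have "\<dots> \<le> (\<integral>\<^sup>+i. \<integral>\<^sup>+js. indicator (near n w) (i # js) \<partial>replicate_pmf k q \<partial>q)"
  proof (rule nn_integral_mono)
    fix i
    show "indicator {j} i * emeasure (replicate_pmf k q) (near (n - j) (w - profile j))
        \<le> (\<integral>\<^sup>+js. indicator (near n w) (i # js) \<partial>replicate_pmf k q)"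
    proof (cases "i = j")
      case True
      have "emeasure (replicate_pmf k q) (near (n - j) (w - profile j))
          = (\<integral>\<^sup>+js. indicator (near (n - j) (w - profile j)) js \<partial>replicate_pmf k q)" by simp
      also have "\<dots> \<le> (\<integral>\<^sup>+js. indicator (near n w) (j # js) \<partial>replicate_pmf k q)"
        using assms by (intro nn_integral_mono) (auto simp: indicator_def near_def algebra_simps)
      finally show ?thesis using True by simp
    qed simp
  qed
  also have "\<dots> = (\<integral>\<^sup>+js. indicator (near n w) js \<partial>replicate_pmf (Suc k) q)"
    by (rule nn_integral_replicate_pmf_Suc[symmetric])
  finally have "ennreal (pmf q j * ?P) \<le> ennreal (near_prob q (Suc k) n w)"
    by (simp only: nn_integral_indicator sets_measure_pmf UNIV_I measure_pmf.emeasure_eq_measure)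
  then show ?thesis by (subst (asm) ennreal_le_iff) auto
qed

lemma profile_ge: "profile j \<ge> real j * ln (real j) - real j"
proof (induction j)
  case (Suc j)
  show ?case
  proof (cases "j = 0")
    case False
    have "ln (real (Suc j) / real j) \<le> real (Suc j) / real j - 1" using False by (intro ln_le_minus_one) simp
    also have "\<dots> = 1 / real j" using False by (simp add: field_simps)
    finally have "ln (real (Suc j)) - ln (real j) \<le> 1 / real j" using False by (simp add: ln_div del: of_nat_Suc)
    then have "real j * (ln (real (Suc j)) - ln (real j)) \<le> real j * (1 / real j)" by (intro mult_left_mono) auto
    then have "real j * ln (real (Suc j)) \<le> real j * ln (real j) + 1" using False by (simp add: algebra_simps del: of_nat_Suc)
    moreover have "real (Suc j) * ln (real (Suc j)) = real j * ln (real (Suc j)) + ln (real (Suc j))"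
      by (subst of_nat_Suc) (simp add: algebra_simps del: of_nat_Suc)
    ultimately show ?thesis using Suc unfolding profile_Suc by simp
  qed (simp add: profile_small)
qed (simp add: profile_small)

lemma rhostar_nonneg: "rhostar > 0"
proof -
  have "- (rhostar - 0.507834) \<le> 0.0000005" using rhostar_numeric by (rule abs_le_D2)
  then show ?thesis by simp
qed

text \<open>One symbol \<open>j\<close> is made to carry a surplus
  \<open>profile j - rhostar * j\<close> close to the excess \<open>(\<rho> - rhostar) * n\<close>.
  The remaining sum \<open>n - j\<close> is then split into \<open>(n - j) div 2\<close> symbols,
  typical for \<open>qstar\<close> because its mean is 2 and its profile rate
  \<open>rhostar\<close>. The price is \<open>(1/2)^j\<close> times a factor of order
  \<open>1 / n\<close>.\<close>

lemma prob_near_one_big: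
  assumes \<rho>: "\<rho> > rhostar"
  shows "\<exists>C>0. \<forall>\<^sub>F n in sequentially. \<exists>k\<in>{1..n}. exp (- C * real n / ln (real n)) \<le> near_prob qstar k n (\<rho> * real n)"
proof -
  interpret law: step_law qstar using step_law_qlaw[of 1] by (simp add: qlaw_1)
  have mean: "law.mean = 2" "law.vmean = 2 * rhostar"
    using EJ_1 rho_of_1 by (simp_all add: law.mean_def law.vmean_def rho_of_def qlaw_1)
  define \<delta> where "\<delta> = \<rho> - rhostar"
  have \<delta>: "\<delta> > 0" using \<rho> by (simp add: \<delta>_def)
  \<comment> \<open>For large \<open>n\<close> the surplus per unit of a symbol of size
    \<open>D * n / ln n\<close> is at least \<open>ln n / 4\<close>;
    \<open>D \<ge> 4 * \<delta>\<close> compensates the 1/4.\<close>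
  define D where "D = 4 * \<delta> + 1"
  have D: "D > 0" using \<delta> by (simp add: D_def)
  obtain c K where c: "c > 0" and low: "\<And>k n w. k \<ge> K \<Longrightarrow> \<bar>real n - real k * law.mean\<bar> \<le> 1 * sqrt k \<Longrightarrow>
      \<bar>w - real k * law.vmean\<bar> \<le> 1 * sqrt k \<Longrightarrow> near_prob qstar k n w \<ge> c / real k"
    using law.prob_near_lower[OF zero_le_one] by blast
  define J where "J = (\<lambda>n. nat \<lceil>D * real n / ln (real n)\<rceil>)"
  define C where "C = D + 1"
  have C: "C > 0" using D by (simp add: C_def)
  have rs: "rhostar > 0" by (rule rhostar_nonneg)
  have e1: "\<forall>\<^sub>F n::nat in sequentially. ln (D * real n / ln (real n)) - 1 - rhostar \<ge> 1/4 * ln (real n)" using D by real_asymp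
  have e2: "\<forall>\<^sub>F n::nat in sequentially. D * real n / ln (real n) + 1 \<le> real n / 2" using D by real_asymp
  have e3: "\<forall>\<^sub>F n::nat in sequentially. 1 + rhostar + ln (real n) \<le> sqrt (real n / 8)" by real_asymp
  have e4: "\<forall>\<^sub>F n::nat in sequentially. real n / 4 - 1 \<ge> real n / 8" by real_asymp
  have e4': "\<forall>\<^sub>F n::nat in sequentially. real n / 8 \<ge> real K + 1" by real_asymp
  have e5: "\<forall>\<^sub>F n::nat in sequentially. (D * real n / ln (real n) + 1) - ln c + ln (real n) \<le> C * real n / ln (real n)"
    using D unfolding C_def by real_asymp
  have "\<forall>\<^sub>F n in sequentially. \<exists>k\<in>{1..n}. exp (- C * real n / ln (real n)) \<le> near_prob qstar k n (\<rho> * real n)"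
    using e1 e2 e3 e4 e4' e5 eventually_gt_at_top[of 2]
  proof eventually_elim
    case (elim n)
    have n: "n > 2" using elim by simp
    have lnn: "ln (real n) > 0" using n by simp
    define x where "x = D * real n / ln (real n)"
    have x: "x > 0" using D lnn n by (simp add: x_def)
    have J: "x \<le> real (J n)" "real (J n) \<le> x + 1" using x unfolding J_def x_def[symmetric] by linarith+
    let ?\<phi> = "\<lambda>j. profile j - rhostar * real j"
    have "?\<phi> (J n) \<ge> \<delta> * real n"
    proof -
      have "\<delta> * real n \<le> D * real n / 4" unfolding D_def by (simp add: algebra_simps)
      also have "\<dots> = x * (1/4 * ln (real n))" using lnn by (simp add: x_def)
      also have "\<dots> \<le> real (J n) * (ln (real (J n)) - 1 - rhostar)"
      proof (intro mult_mono J)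
        have "ln x \<le> ln (real (J n))" using J x by simp
        then show "1/4 * ln (real n) \<le> ln (real (J n)) - 1 - rhostar" using elim unfolding x_def by linarith
      qed (use J x lnn in auto)
      also have "\<dots> \<le> ?\<phi> (J n)" using profile_ge[of "J n"] by (simp add: algebra_simps)
      finally show ?thesis .
    qed
    \<comment> \<open>The least admissible symbol overshoots by at most one increment of the
      profile, hence by at most \<open>ln n\<close>, which fits into the \<open>sqrt k\<close>
      tolerance of the local bound.\<close>
    then obtain j where j: "?\<phi> j \<ge> \<delta> * real n" and least: "\<And>i. i < j \<Longrightarrow> ?\<phi> i < \<delta> * real n" and jJ: "j \<le> J n"
      using exists_least_iff[of "\<lambda>j. ?\<phi> j \<ge> \<delta> * real n"] by (metis not_le)
    have "\<delta> * real n > 0" using \<delta> n by simp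
    then have "j \<noteq> 0" using j by (intro notI) (simp add: profile_small)
    then obtain i where i: "j = Suc i" using not0_implies_Suc by blast
    have jx: "real j \<le> x + 1" using jJ J by linarith
    then have jn: "real j \<le> real n / 2" using elim unfolding x_def by linarith
    then have jn': "j \<le> n" by linarith
    have \<phi>: "0 \<le> ?\<phi> j - \<delta> * real n" "?\<phi> j - \<delta> * real n \<le> ln (real n)"
    proof -
      have "?\<phi> j = ?\<phi> i + ln (real j) - rhostar" by (simp add: i profile_Suc algebra_simps)
      also have "\<dots> \<le> \<delta> * real n + ln (real n)"
      proof -
        have "?\<phi> i < \<delta> * real n" using least[of i] i by simp
        moreover have "ln (real j) \<le> ln (real n)" using i jn' by (subst ln_le_cancel_iff) auto
        ultimately show ?thesis using rs by linarith
      qed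
      finally show "?\<phi> j - \<delta> * real n \<le> ln (real n)" by simp
    qed (use j in simp)
    define k where "k = (n - j) div 2"
    have k: "2 * real k \<le> real n - real j" "real n - real j \<le> 2 * real k + 1"
    proof -
      have "2 * k \<le> n - j" "n - j \<le> 2 * k + 1" unfolding k_def by linarith+
      then have "real (2 * k) \<le> real (n - j)" "real (n - j) \<le> real (2 * k + 1)" by (simp_all only: of_nat_le_iff)
      then show "2 * real k \<le> real n - real j" "real n - real j \<le> 2 * real k + 1"
        using jn' by (simp_all add: of_nat_diff)
    qed
    have k8: "real k \<ge> real n / 8" using k jn elim by linarith
    then have kK: "k \<ge> K" "k > 0" using elim by linarith+
    have sk: "1 + rhostar + ln (real n) \<le> sqrt k"
      using elim k8 real_sqrt_le_mono[OF k8] by linarith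
    define w where "w = \<rho> * real n - profile j"
    have "near_prob qstar k (n - j) w \<ge> c / real k"
    proof (rule low[OF kK(1)])
      show "\<bar>real (n - j) - real k * law.mean\<bar> \<le> 1 * sqrt k"
        using k sk rs lnn jn' by (simp add: mean of_nat_diff abs_le_iff)
      have "w - real k * law.vmean = rhostar * (real n - real j - 2 * real k) - (?\<phi> j - \<delta> * real n)"
        by (simp add: w_def mean \<delta>_def algebra_simps)
      moreover have "0 \<le> rhostar * (real n - real j - 2 * real k)" using k rs by simp
      moreover have "rhostar * (real n - real j - 2 * real k) \<le> rhostar * 1" using k rs by (intro mult_left_mono) auto
      ultimately show "\<bar>w - real k * law.vmean\<bar> \<le> 1 * sqrt k"
        using \<phi> sk rs lnn by (intro abs_leI; linarith)
    qed
    moreover have "c / real n \<le> c / real k"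
      using kK k c n by (intro divide_left_mono) auto
    ultimately have P: "c / real n \<le> near_prob qstar k (n - j) w" by linarith
    have "exp (- C * real n / ln (real n)) \<le> exp (- (real j * ln 2) + ln c - ln (real n))"
    proof -
      have "real j * ln 2 \<le> real j * 1" using ln2_le_25_over_36 by (intro mult_left_mono) auto
      then have "real j * ln 2 \<le> x + 1" using jx by linarith
      then show ?thesis using elim by (simp add: x_def)
    qed
    also have "\<dots> = (1/2) ^ j * (c / real n)"
      using c n by (simp add: exp_diff exp_add exp_minus exp_of_nat_mult power_one_over)
    also have "\<dots> \<le> pmf qstar j * near_prob qstar k (n - j) (\<rho> * real n - profile j)"
    proof -
      have "pmf qstar j = (1/2) ^ j" using \<open>j \<noteq> 0\<close> by (simp add: pmf_qstar)
      then show ?thesis using mult_left_mono[OF P, of "(1/2) ^ j"] by (simp only: w_def) simp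
    qed
    also have "\<dots> \<le> near_prob qstar (Suc k) n (\<rho> * real n)"
      by (rule prob_near_Suc_ge[OF jn'])
    finally show ?case using k n \<open>j \<noteq> 0\<close> by (intro bexI[of _ "Suc k"]) auto
  qed
  then show ?thesis using C by blast
qed

text \<open>The lower bound \<open>exp (- C * n / ln n)\<close> against the decay
  \<open>exp (- (n - 2 * k)^2 / (8 * n))\<close> leaves \<open>(n - 2 * k)^2\<close> at most of
  order \<open>n^2 / ln n\<close>.\<close>

lemma supercritical_support:
  assumes \<rho>: "\<rho> > rhostar"
  shows "\<exists>C>0. \<forall>\<^sub>F n in sequentially. \<forall>k. optimal \<rho> n k \<longrightarrow> Wpart \<rho> n k > 0 \<and>
     exp (- C * real n / ln (real n)) \<le> near_prob qstar k n (\<rho> * real n) \<and>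
     \<bar>real k / real n - 1/2\<bar> \<le> C * ln (real n) powr (-1/2)"
proof -
  obtain C0 where C0: "C0 > 0" and ref: "\<forall>\<^sub>F n in sequentially. \<exists>k\<in>{1..n}. exp (- C0 * real n / ln (real n)) \<le> near_prob qstar k n (\<rho> * real n)"
    using prob_near_one_big[OF \<rho>] by blast
  \<comment> \<open>The added 2 absorbs the factor \<open>exp (- 2)\<close> lost in passing to the
    maximizer, and \<open>C \<ge> 2\<close> gives \<open>sqrt (8 * C) / 2 \<le> C\<close>, so that
    one constant serves both bounds.\<close>
  define C where "C = C0 + 2"
  have C: "C > 0" "sqrt (8 * C) / 2 \<le> C"
  proof -
    show "C > 0" using C0 by (simp add: C_def)
    have "4 * C * 2 \<le> 4 * C * C" using C0 by (intro mult_left_mono) (auto simp: C_def)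
    then have "sqrt (8 * C) \<le> sqrt ((2 * C)\<^sup>2)"
      by (intro real_sqrt_le_mono) (simp add: power2_eq_square)
    then have "sqrt (8 * C) \<le> \<bar>2 * C\<bar>" by (simp only: real_sqrt_abs)
    then show "sqrt (8 * C) / 2 \<le> C" using \<open>C > 0\<close> by linarith
  qed
  have e1: "\<forall>\<^sub>F n::nat in sequentially. C0 * real n / ln (real n) + 2 \<le> C * real n / ln (real n)"
    unfolding C_def by real_asymp
  have "\<forall>\<^sub>F n in sequentially. \<forall>k. optimal \<rho> n k \<longrightarrow> Wpart \<rho> n k > 0 \<and>
     exp (- C * real n / ln (real n)) \<le> near_prob qstar k n (\<rho> * real n) \<and>
     \<bar>real k / real n - 1/2\<bar> \<le> C * ln (real n) powr (-1/2)"
    using ref e1 eventually_gt_at_top[of 2]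
  proof eventually_elim
    case (elim n)
    show ?case
    proof (intro allI impI)
      fix k assume opt: "optimal \<rho> n k"
      let ?P = "near_prob qstar k n (\<rho> * real n)"
      have n: "n > 2" and lnn: "ln (real n) > 0" using elim by auto
      obtain l where l: "1 \<le> l" "l \<le> n" "exp (- C0 * real n / ln (real n)) \<le> near_prob qstar l n (\<rho> * real n)"
        using elim by auto
      have og: "exp (- 2) * exp (- C0 * real n / ln (real n)) \<le> ?P" "Wpart \<rho> n k > 0"
        using optimal_prob_ge[OF order_refl opt l(1,2) exp_gt_zero l(3)[folded qlaw_1]] by (simp_all add: qlaw_1)
      have "exp (- C * real n / ln (real n)) \<le> exp (- 2) * exp (- C0 * real n / ln (real n))"
        unfolding exp_add[symmetric] using elim by simp
      then have P: "exp (- C * real n / ln (real n)) \<le> ?P" using og by linarith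
      have "?P \<le> measure_pmf.prob (replicate_pmf k qstar) {js. sum_list js = n}"
        by (intro measure_pmf.finite_measure_mono) (auto simp: near_def)
      also have "\<dots> \<le> exp (- (real n - 2 * real k)\<^sup>2 / (8 * real n))"
        using optimalD(2)[OF opt] n by (intro prob_sum_qstar_le) auto
      finally have "- C * real n / ln (real n) \<le> - (real n - 2 * real k)\<^sup>2 / (8 * real n)"
        using P by (metis exp_le_cancel_iff order_trans)
      then have "(real n - 2 * real k)\<^sup>2 \<le> 8 * C * (real n)\<^sup>2 / ln (real n)"
        using n by (simp add: field_simps power2_eq_square)
      then have "sqrt ((real n - 2 * real k)\<^sup>2) \<le> sqrt (8 * C * (real n)\<^sup>2 / ln (real n))"
        by (rule real_sqrt_le_mono)
      then have d: "\<bar>real n - 2 * real k\<bar> \<le> sqrt (8 * C) * real n / sqrt (ln (real n))"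
        by (simp only: real_sqrt_abs real_sqrt_divide real_sqrt_mult abs_of_nat)
      have "real k / real n - 1/2 = - (real n - 2 * real k) / (2 * real n)" using n by (simp add: field_simps)
      then have "\<bar>real k / real n - 1/2\<bar> = \<bar>real n - 2 * real k\<bar> / (2 * real n)"
        by (simp only: abs_divide abs_minus_cancel abs_mult abs_of_nat abs_numeral)
      also have "\<dots> \<le> (sqrt (8 * C) * real n / sqrt (ln (real n))) / (2 * real n)"
        using d by (intro divide_right_mono) auto
      also have "\<dots> = (sqrt (8 * C) / 2) * (1 / sqrt (ln (real n)))" using n by simp
      also have "\<dots> \<le> C * (1 / sqrt (ln (real n)))" using C(2) lnn by (intro mult_right_mono) auto
      also have "1 / sqrt (ln (real n)) = ln (real n) powr (-1/2)"
        using lnn by (simp add: powr_minus_divide powr_half_sqrt)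
      finally show "Wpart \<rho> n k > 0 \<and> exp (- C * real n / ln (real n)) \<le> ?P \<and> \<bar>real k / real n - 1/2\<bar> \<le> C * ln (real n) powr (-1/2)"
        using P og(2) by blast
    qed
  qed
  then show ?thesis using C by blast
qed

text \<open>Here \<open>L\<close> is \<open>C * n / ln n\<close> and \<open>k \<ge> n / 4\<close>,
  so the ratio under the square root is of order \<open>1 / ln n\<close>.\<close>

lemma supercritical_marginals:
  assumes \<rho>: "\<rho> > rhostar" and r: "1 \<le> r"
  shows "\<exists>C. \<forall>\<^sub>F n in sequentially. \<forall>k. optimal \<rho> n k \<longrightarrow> 0 < Wpart \<rho> n k \<and> r \<le> k \<and>
     \<bar>real k / real n - 1/2\<bar> + tv_dist (mu_marg \<rho> n k r) (replicate_pmf r qstar) \<le> C * ln (real n) powr (-1/2)"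
proof -
  obtain C where C: "C > 0" and ev: "\<forall>\<^sub>F n in sequentially. \<forall>k. optimal \<rho> n k \<longrightarrow> Wpart \<rho> n k > 0 \<and>
     exp (- C * real n / ln (real n)) \<le> near_prob qstar k n (\<rho> * real n) \<and>
     \<bar>real k / real n - 1/2\<bar> \<le> C * ln (real n) powr (-1/2)"
    using supercritical_support[OF \<rho>] by blast
  have e1: "\<forall>\<^sub>F n::nat in sequentially. C * ln (real n) powr (-1/2) \<le> 1/4" using C by real_asymp
  have e2: "\<forall>\<^sub>F n::nat in sequentially. real r \<le> real n / 4" by real_asymp
  have e3: "\<forall>\<^sub>F n::nat in sequentially. C * real n / ln (real n) + 2 \<le> (C + 1) * real n / ln (real n)" by real_asymp
  let ?C = "C + 2 * sqrt ((C + 1) * (8 * real r))"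
  have "\<forall>\<^sub>F n in sequentially. \<forall>k. optimal \<rho> n k \<longrightarrow> 0 < Wpart \<rho> n k \<and> r \<le> k \<and>
     \<bar>real k / real n - 1/2\<bar> + tv_dist (mu_marg \<rho> n k r) (replicate_pmf r qstar) \<le> ?C * ln (real n) powr (-1/2)"
    using ev e1 e2 e3 eventually_gt_at_top[of 2]
  proof eventually_elim
    case (elim n)
    show ?case
    proof (intro allI impI)
      fix k assume opt: "optimal \<rho> n k"
      have n: "n > 2" and lnn: "ln (real n) > 0" using elim by auto
      have W: "Wpart \<rho> n k > 0" and P: "exp (- C * real n / ln (real n)) \<le> near_prob qstar k n (\<rho> * real n)"
        and s: "\<bar>real k / real n - 1/2\<bar> \<le> C * ln (real n) powr (-1/2)" using elim opt by auto
      have "real k / real n \<ge> 1/4" using s elim by linarith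
      then have kn: "real k \<ge> real n / 4" using n by (simp add: field_simps)
      then have rk: "r \<le> k" using elim by linarith
      define L where "L = C * real n / ln (real n)"
      have L: "L \<ge> 0" using C lnn by (simp add: L_def)
      have "tv_dist (mu_marg \<rho> n k r) (replicate_pmf r (qlaw 1)) \<le> 2 * sqrt ((L + 2 * \<bar>1\<bar>) * (2 * real r) / real k)"
        using P L by (intro tv_dist_mu_marg_le[OF _ W _ r rk]) (auto simp: L_def qlaw_1)
      also have "\<dots> \<le> 2 * sqrt (((C + 1) * real n / ln (real n)) * (2 * real r) / (real n / 4))"
        using elim kn n L C lnn by (intro mult_left_mono real_sqrt_le_mono frac_le mult_right_mono) (auto simp: L_def)
      also have "((C + 1) * real n / ln (real n)) * (2 * real r) / (real n / 4) = ((C + 1) * (8 * real r)) / ln (real n)"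
        using n by (simp add: field_simps)
      also have "2 * sqrt (((C + 1) * (8 * real r)) / ln (real n)) = 2 * sqrt ((C + 1) * (8 * real r)) * ln (real n) powr (-1/2)"
        using lnn by (simp only: real_sqrt_divide) (simp add: powr_minus_divide powr_half_sqrt)
      finally have tv: "tv_dist (mu_marg \<rho> n k r) (replicate_pmf r qstar) \<le> 2 * sqrt ((C + 1) * (8 * real r)) * ln (real n) powr (-1/2)"
        by (simp add: qlaw_1)
      show "0 < Wpart \<rho> n k \<and> r \<le> k \<and>
         \<bar>real k / real n - 1/2\<bar> + tv_dist (mu_marg \<rho> n k r) (replicate_pmf r qstar) \<le> ?C * ln (real n) powr (-1/2)"
        using W rk s tv by (simp add: distrib_right)
    qed
  qed
  then show ?thesis by blast
qed

text \<open>The threshold \<open>ln n powr (1/16)\<close> grows slowly enough for the truncated profile to stay below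
  \<open>ln n powr (1/8)\<close>, so that its fluctuations are negligible against the entropy cost \<open>n / ln n\<close>.\<close>

lemma supercritical_excess:
  assumes \<rho>: "\<rho> > rhostar" and opt: "optimal_seq \<rho> \<kappa>"
  defines "M \<equiv> \<lambda>n. ln (real n) powr (1/16)"
  shows "(\<lambda>n. measure_pmf.expectation (mu_law \<rho> n (\<kappa> n))
            (\<lambda>js. real (card {i. i < \<kappa> n \<and> M n < real (js ! i)})) / real (\<kappa> n)) \<longlonglongrightarrow> 0"
    and "(\<lambda>n. measure_pmf.expectation (mu_law \<rho> n (\<kappa> n))
            (\<lambda>js. \<bar>(\<Sum>i | i < \<kappa> n \<and> M n < real (js ! i). profile (js ! i)) / real n - (\<rho> - rhostar)\<bar>)) \<longlonglongrightarrow> 0"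
proof -
  interpret law: step_law qstar using step_law_qlaw[of 1] by (simp add: qlaw_1)
  let ?\<mu> = "\<lambda>n. mu_law \<rho> n (\<kappa> n)"
  let ?E = "measure_pmf.expectation qstar"
  obtain C where C: "C > 0" and sup: "\<forall>\<^sub>F n in sequentially. \<forall>k. optimal \<rho> n k \<longrightarrow> Wpart \<rho> n k > 0 \<and>
     exp (- C * real n / ln (real n)) \<le> near_prob qstar k n (\<rho> * real n) \<and>
     \<bar>real k / real n - 1/2\<bar> \<le> C * ln (real n) powr (-1/2)"
    using supercritical_support[OF \<rho>] by blast
  have opt_n: "\<forall>\<^sub>F n in sequentially. optimal \<rho> n (\<kappa> n)"
    using opt unfolding optimal_seq_def eventually_sequentially by blast
  \<comment> \<open>After division by \<open>n\<close> the change of measure contributes order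
    \<open>1 / (\<theta> * ln n)\<close>, which is \<open>(ln n)^(-1/2)\<close>, and the fluctuation
    \<open>\<theta> * R^2\<close>, which is \<open>(ln n)^(-1/4)\<close>. \<open>R\<close> is the
    square of \<open>M\<close> and thus bounds the profile of symbols up to
    \<open>M\<close>.\<close>
  define R where "R = (\<lambda>n. ln (real n) powr (1/8))"
  define \<theta> where "\<theta> = (\<lambda>n. ln (real n) powr (-1/2))"
  define B where "B = (\<lambda>n. (C * real n / ln (real n) + 2 + real n * ((\<theta> n)\<^sup>2 * (R n)\<^sup>2) + ln 2) / \<theta> n / real n)"
  have B0: "B \<longlonglongrightarrow> 0" unfolding B_def \<theta>_def R_def by real_asymp
  have M_inf: "filterlim M at_top sequentially" unfolding M_def by real_asymp
  have kn: "(\<lambda>n. real (\<kappa> n) / real n) \<longlonglongrightarrow> 1/2"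
  proof (rule LIM_zero_cancel, rule Lim_null_comparison)
    show "\<forall>\<^sub>F n in sequentially. norm (real (\<kappa> n) / real n - 1/2) \<le> C * ln (real n) powr (-1/2)"
      using sup opt_n by eventually_elim auto
    show "(\<lambda>n. C * ln (real n) powr (-1/2)) \<longlonglongrightarrow> 0" by real_asymp
  qed
  \<comment> \<open>The profile of the large symbols is never estimated directly: the constraint
    fixes the total profile, and the truncated part \<open>f\<close> is bounded and hence
    concentrates.\<close>
  define f where "f = (\<lambda>n j. if real j \<le> M n then profile j else 0)"
  define h where "h = (\<lambda>n j. if M n < real j then 1 else 0 :: real)"
  have e\<theta>: "\<forall>\<^sub>F n in sequentially. \<theta> n * R n \<le> 1" unfolding \<theta>_def R_def by real_asymp
  have eR: "\<forall>\<^sub>F n in sequentially. 1 \<le> R n" unfolding R_def by real_asymp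
  have eM: "\<forall>\<^sub>F n in sequentially. (M n)\<^sup>2 \<le> R n"
    using eventually_gt_at_top[of 2]
  proof eventually_elim
    case (elim n)
    then show ?case by (simp add: M_def R_def powr_power)
  qed
  have dev: "\<forall>\<^sub>F n in sequentially. \<forall>g. (\<forall>j. 0 \<le> g j \<and> g j \<le> R n) \<longrightarrow>
      measure_pmf.expectation (?\<mu> n) (\<lambda>js. \<bar>sum_list (map g js) - real (\<kappa> n) * ?E g\<bar>) / real n \<le> B n"
    using sup opt_n e\<theta> eventually_gt_at_top[of 2]
  proof eventually_elim
    case (elim n)
    show ?case
    proof (intro allI impI)
      fix g :: "nat \<Rightarrow> real" assume g: "\<forall>j. 0 \<le> g j \<and> g j \<le> R n"
      let ?k = "\<kappa> n"
      have n: "n > 2" and lnn: "ln (real n) > 0" using elim by auto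
      have \<theta>: "\<theta> n > 0" using lnn by (simp add: \<theta>_def)
      have R: "R n \<ge> 0" by (simp add: R_def)
      have W: "Wpart \<rho> n ?k > 0" and P: "exp (- (C * real n / ln (real n))) \<le> near_prob (qlaw 1) ?k n (\<rho> * real n)"
        using elim by (auto simp: qlaw_1)
      have kn: "real ?k \<le> real n" using optimalD(2) elim by auto
      have int: "integrable (measure_pmf qstar) g"
        using g by (intro measure_pmf.integrable_const_bound[where B = "R n"]) auto
      have "?E g \<le> ?E (\<lambda>_. R n)" using g by (intro integral_mono int) auto
      moreover have "0 \<le> ?E g" using g by (intro Bochner_Integration.integral_nonneg) auto
      ultimately have Eg: "0 \<le> ?E g" "?E g \<le> R n" by simp_all
      have "measure_pmf.expectation (?\<mu> n) (\<lambda>js. \<bar>sum_list (map g js) - real ?k * ?E g\<bar>)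
          \<le> ((C * real n / ln (real n) + 2 * \<bar>1\<bar>) + real ?k * ((\<theta> n)\<^sup>2 * (R n)\<^sup>2) + ln 2) / \<theta> n"
      proof (rule expectation_abs_sum_list_le)
        show "finite (set_pmf (?\<mu> n))" by (simp add: mu_law_set[OF W] finite_configs)
        show "pmf (?\<mu> n) js \<le> exp (C * real n / ln (real n) + 2 * \<bar>1\<bar>) * pmf (replicate_pmf ?k qstar) js" for js
          using mu_law_dominated[OF order_refl W P] by (simp add: qlaw_1)
        show "\<bar>g j - ?E g\<bar> \<le> R n" for j
          using g[rule_format, of j] Eg by (intro abs_leI; linarith)
      qed (use \<theta> elim in auto)
      also have "\<dots> \<le> (C * real n / ln (real n) + 2 + real n * ((\<theta> n)\<^sup>2 * (R n)\<^sup>2) + ln 2) / \<theta> n"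
        using \<theta> mult_right_mono[OF kn, of "(\<theta> n)\<^sup>2 * (R n)\<^sup>2"] by (intro divide_right_mono) simp_all
      finally show "measure_pmf.expectation (?\<mu> n) (\<lambda>js. \<bar>sum_list (map g js) - real ?k * ?E g\<bar>) / real n \<le> B n"
        unfolding B_def by (rule divide_right_mono) simp
    qed
  qed
  have M_pos: "\<forall>\<^sub>F n in sequentially. M n > 0" using M_inf unfolding filterlim_at_top_dense by blast
  have int3: "integrable (measure_pmf qstar) (\<lambda>j. real j ^ 3)"
    by (rule law.integrable_poly) (use law.power_le_power4[of 3] in simp)
  let ?E3 = "?E (\<lambda>j. real j ^ 3)"
  have int_h: "integrable (measure_pmf qstar) (h n)" for n
    by (rule measure_pmf.integrable_const_bound[where B = 1]) (auto simp: h_def)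
  have int_f: "integrable (measure_pmf qstar) (f n)" for n
  proof (rule Bochner_Integration.integrable_bound[OF law.integrable_moments(3)])
    show "AE j in measure_pmf qstar. norm (f n j) \<le> norm (profile j)" by (auto simp: f_def)
  qed simp
  \<comment> \<open>Beyond \<open>M\<close> both the indicator and the profile are at most
    \<open>j^3 / M\<close>, so one third moment controls both truncation errors.\<close>
  have Eh: "\<forall>\<^sub>F n in sequentially. norm (?E (h n)) \<le> ?E3 / M n"
    using M_pos
  proof eventually_elim
    case (elim n)
    have "?E (h n) \<le> ?E (\<lambda>j. real j ^ 3 / M n)"
    proof (intro integral_mono int_h)
      show "integrable (measure_pmf qstar) (\<lambda>j. real j ^ 3 / M n)" using int3 by simp
      show "h n j \<le> real j ^ 3 / M n" for j
      proof (cases "M n < real j")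
        case True
        then have "real j ^ 1 \<le> real j ^ 3" using elim by (intro power_increasing) auto
        then have "M n \<le> real j ^ 3" using True unfolding power_one_right by linarith
        then show ?thesis using True elim by (simp add: h_def)
      qed (use elim in \<open>simp add: h_def\<close>)
    qed
    moreover have "0 \<le> ?E (h n)" by (intro Bochner_Integration.integral_nonneg) (simp add: h_def)
    ultimately show ?case by simp
  qed
  have E3M: "(\<lambda>n. ?E3 / M n) \<longlonglongrightarrow> 0"
    by (rule tendsto_divide_0[OF tendsto_const filterlim_at_top_imp_at_infinity[OF M_inf]])
  have Eh0: "(\<lambda>n. ?E (h n)) \<longlonglongrightarrow> 0" by (rule Lim_null_comparison[OF Eh E3M])
  have Ef: "\<forall>\<^sub>F n in sequentially. norm (?E (f n) - 2 * rhostar) \<le> ?E3 / M n"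
    using M_pos
  proof eventually_elim
    case (elim n)
    have "EV 1 / EJ 1 = rhostar" using rho_of_1 unfolding rho_of_def .
    then have "EV 1 = 2 * rhostar" unfolding EJ_1 by linarith
    then have vm: "?E profile = 2 * rhostar" unfolding qlaw_1 .
    have "?E profile - ?E (f n) = ?E (\<lambda>j. profile j - f n j)"
      by (rule Bochner_Integration.integral_diff[symmetric, OF law.integrable_moments(3) int_f])
    also have "\<dots> \<le> ?E (\<lambda>j. real j ^ 3 / M n)"
    proof (intro integral_mono)
      show "integrable (measure_pmf qstar) (\<lambda>j. profile j - f n j)"
        by (rule Bochner_Integration.integrable_diff[OF law.integrable_moments(3) int_f])
      show "integrable (measure_pmf qstar) (\<lambda>j. real j ^ 3 / M n)" using int3 by simp
      show "profile j - f n j \<le> real j ^ 3 / M n" for j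
      proof (cases "M n < real j")
        case True
        have "profile j * M n \<le> real j ^ 2 * real j"
          by (intro mult_mono profile_le_sq) (use True elim in auto)
        then show ?thesis using True elim by (simp add: f_def pos_le_divide_eq power2_eq_square power3_eq_cube)
      qed (use elim in \<open>simp add: f_def\<close>)
    qed
    finally have "?E profile - ?E (f n) \<le> ?E3 / M n" by simp
    moreover have "?E (f n) \<le> ?E profile"
      by (intro integral_mono int_f law.integrable_moments) (simp add: f_def profile_nonneg)
    ultimately show ?case unfolding vm by simp
  qed
  have Ef0: "(\<lambda>n. ?E (f n)) \<longlonglongrightarrow> 2 * rhostar"
    by (rule LIM_zero_cancel[OF Lim_null_comparison[OF Ef E3M]])
  have tri: "\<bar>a - b - c\<bar> \<le> \<bar>a\<bar> + \<bar>b\<bar> + \<bar>c\<bar>" for a b c :: real by linarith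
  have nth_sum: "(\<Sum>i | i < k \<and> M n < real (js ! i). g (js ! i)) = (\<Sum>j\<leftarrow>js. if M n < real j then g j else 0)"
    if "length js = k" for js k n and g :: "nat \<Rightarrow> real"
  proof -
    have "(\<Sum>j\<leftarrow>js. if M n < real j then g j else 0) = (\<Sum>i<k. if M n < real (js ! i) then g (js ! i) else 0)"
      using that by (simp add: sum_list_sum_nth atLeast0LessThan)
    also have "\<dots> = (\<Sum>i | i < k \<and> M n < real (js ! i). g (js ! i))"
      by (subst sum.inter_filter[symmetric]) simp_all
    finally show ?thesis by simp
  qed
  show "(\<lambda>n. measure_pmf.expectation (?\<mu> n)
            (\<lambda>js. real (card {i. i < \<kappa> n \<and> M n < real (js ! i)})) / real (\<kappa> n)) \<longlonglongrightarrow> 0"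
  proof (rule Lim_null_comparison)
    show "(\<lambda>n. ?E (h n) + B n / (real (\<kappa> n) / real n)) \<longlonglongrightarrow> 0"
      using tendsto_add[OF Eh0 tendsto_divide[OF B0 kn]] by simp
    show "\<forall>\<^sub>F n in sequentially. norm (measure_pmf.expectation (?\<mu> n)
            (\<lambda>js. real (card {i. i < \<kappa> n \<and> M n < real (js ! i)})) / real (\<kappa> n)) \<le> ?E (h n) + B n / (real (\<kappa> n) / real n)"
      using dev sup opt_n eR eventually_gt_at_top[of 2]
    proof eventually_elim
      case (elim n)
      let ?k = "\<kappa> n"
      have W: "Wpart \<rho> n ?k > 0" using elim by auto
      have k: "?k \<ge> 1" using optimalD(1) elim by auto
      have fin: "finite (set_pmf (?\<mu> n))" by (simp add: mu_law_set[OF W] finite_configs)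
      have D: "measure_pmf.expectation (?\<mu> n) (\<lambda>js. \<bar>sum_list (map (h n) js) - real ?k * ?E (h n)\<bar>) / real n \<le> B n"
        using elim by (auto simp: h_def)
      have "measure_pmf.expectation (?\<mu> n) (\<lambda>js. real (card {i. i < ?k \<and> M n < real (js ! i)}))
          \<le> measure_pmf.expectation (?\<mu> n) (\<lambda>js. real ?k * ?E (h n) + \<bar>sum_list (map (h n) js) - real ?k * ?E (h n)\<bar>)"
      proof (rule integral_mono_AE)
        show "AE js in measure_pmf (?\<mu> n). real (card {i. i < ?k \<and> M n < real (js ! i)})
            \<le> real ?k * ?E (h n) + \<bar>sum_list (map (h n) js) - real ?k * ?E (h n)\<bar>"
        proof (subst AE_measure_pmf_iff, intro ballI)
          fix js assume "js \<in> set_pmf (?\<mu> n)"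
          then have len: "length js = ?k" by (simp add: mu_law_set[OF W] configs_def)
          have "real (card {i. i < ?k \<and> M n < real (js ! i)}) = sum_list (map (h n) js)"
            using nth_sum[OF len, of "\<lambda>_. 1" n] by (simp add: h_def)
          then show "real (card {i. i < ?k \<and> M n < real (js ! i)})
            \<le> real ?k * ?E (h n) + \<bar>sum_list (map (h n) js) - real ?k * ?E (h n)\<bar>" by linarith
        qed
      qed (intro integrable_measure_pmf_finite fin)+
      also have "\<dots> = real ?k * ?E (h n) + measure_pmf.expectation (?\<mu> n) (\<lambda>js. \<bar>sum_list (map (h n) js) - real ?k * ?E (h n)\<bar>)"
        by (simp add: Bochner_Integration.integral_add integrable_measure_pmf_finite fin)
      also have "\<dots> \<le> real ?k * ?E (h n) + B n * real n"
        using D elim by (simp add: pos_divide_le_eq)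
      finally have "measure_pmf.expectation (?\<mu> n) (\<lambda>js. real (card {i. i < ?k \<and> M n < real (js ! i)})) / real ?k
          \<le> (real ?k * ?E (h n) + B n * real n) / real ?k"
        by (rule divide_right_mono) simp
      also have "\<dots> = ?E (h n) + B n / (real ?k / real n)" using k by (simp add: add_divide_distrib)
      finally have "measure_pmf.expectation (?\<mu> n) (\<lambda>js. real (card {i. i < ?k \<and> M n < real (js ! i)})) / real ?k
          \<le> ?E (h n) + B n / (real ?k / real n)" .
      moreover have "0 \<le> measure_pmf.expectation (?\<mu> n) (\<lambda>js. real (card {i. i < ?k \<and> M n < real (js ! i)})) / real ?k"
        by (intro divide_nonneg_nonneg Bochner_Integration.integral_nonneg) simp_all
      ultimately show ?case by (simp only: real_norm_def abs_of_nonneg)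
    qed
  qed
  show "(\<lambda>n. measure_pmf.expectation (?\<mu> n)
            (\<lambda>js. \<bar>(\<Sum>i | i < \<kappa> n \<and> M n < real (js ! i). profile (js ! i)) / real n - (\<rho> - rhostar)\<bar>)) \<longlonglongrightarrow> 0"
  proof (rule Lim_null_comparison)
    let ?r = "\<lambda>n. 1 / real n + \<bar>real (\<kappa> n) / real n * ?E (f n) - rhostar\<bar>"
    show "(\<lambda>n. ?r n + B n) \<longlonglongrightarrow> 0"
    proof -
      have "(\<lambda>n. real (\<kappa> n) / real n * ?E (f n) - rhostar) \<longlonglongrightarrow> 1/2 * (2 * rhostar) - rhostar"
        by (intro tendsto_diff tendsto_mult kn Ef0 tendsto_const)
      then have "(\<lambda>n. \<bar>real (\<kappa> n) / real n * ?E (f n) - rhostar\<bar>) \<longlonglongrightarrow> 0"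
        by (simp add: tendsto_rabs_zero_iff)
      moreover have "(\<lambda>n. 1 / real n) \<longlonglongrightarrow> 0" by real_asymp
      ultimately show ?thesis using B0 by (intro tendsto_add_zero)
    qed
    show "\<forall>\<^sub>F n in sequentially. norm (measure_pmf.expectation (?\<mu> n)
            (\<lambda>js. \<bar>(\<Sum>i | i < \<kappa> n \<and> M n < real (js ! i). profile (js ! i)) / real n - (\<rho> - rhostar)\<bar>)) \<le> ?r n + B n"
      using dev sup opt_n eM M_pos eventually_gt_at_top[of 2]
    proof eventually_elim
      case (elim n)
      let ?k = "\<kappa> n"
      have n: "real n > 0" using elim by simp
      have W: "Wpart \<rho> n ?k > 0" using elim by auto
      have fin: "finite (set_pmf (?\<mu> n))" by (simp add: mu_law_set[OF W] finite_configs)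
      have fb: "0 \<le> f n j \<and> f n j \<le> R n" for j
      proof (cases "real j \<le> M n")
        case True
        have "profile j \<le> (real j)\<^sup>2" by (rule profile_le_sq)
        also have "\<dots> \<le> (M n)\<^sup>2" using True by (intro power_mono) auto
        finally show ?thesis using True elim by (auto simp: f_def profile_nonneg)
      qed (simp add: f_def R_def)
      have D: "measure_pmf.expectation (?\<mu> n) (\<lambda>js. \<bar>sum_list (map (f n) js) - real ?k * ?E (f n)\<bar>) / real n \<le> B n"
        using elim fb by auto
      let ?X = "\<lambda>js. \<bar>(\<Sum>i | i < ?k \<and> M n < real (js ! i). profile (js ! i)) / real n - (\<rho> - rhostar)\<bar>"
      have "measure_pmf.expectation (?\<mu> n) ?X
          \<le> measure_pmf.expectation (?\<mu> n) (\<lambda>js. ?r n + \<bar>sum_list (map (f n) js) - real ?k * ?E (f n)\<bar> / real n)"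
      proof (rule integral_mono_AE)
        show "AE js in measure_pmf (?\<mu> n). ?X js \<le> ?r n + \<bar>sum_list (map (f n) js) - real ?k * ?E (f n)\<bar> / real n"
        proof (subst AE_measure_pmf_iff, intro ballI)
          fix js assume "js \<in> set_pmf (?\<mu> n)"
          then have len: "length js = ?k" and V: "\<bar>sum_list (map profile js) - \<rho> * real n\<bar> \<le> 1"
            by (auto simp: mu_law_set[OF W] configs_def)
          let ?V = "sum_list (map profile js)" and ?F = "sum_list (map (f n) js)"
          have "(\<Sum>i | i < ?k \<and> M n < real (js ! i). profile (js ! i)) = ?V - ?F"
            unfolding nth_sum[OF len]
            by (subst sum_list_subtractf[symmetric], rule arg_cong[where f = sum_list]) (auto simp: f_def)
          \<comment> \<open>Three errors: the width of the constraint window, the fluctuation of the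
            truncated profile, and its bias, which vanishes because \<open>k / n\<close> tends to
            1/2 and the mean of \<open>f\<close> to \<open>2 * rhostar\<close>.\<close>
          then have "(\<Sum>i | i < ?k \<and> M n < real (js ! i). profile (js ! i)) / real n - (\<rho> - rhostar)
             = (?V - \<rho> * real n) / real n - (?F - real ?k * ?E (f n)) / real n - (real ?k / real n * ?E (f n) - rhostar)"
            using n by (simp add: diff_divide_distrib)
          also have "\<bar>\<dots>\<bar> \<le> \<bar>(?V - \<rho> * real n) / real n\<bar> + \<bar>(?F - real ?k * ?E (f n)) / real n\<bar> + \<bar>real ?k / real n * ?E (f n) - rhostar\<bar>"
            by (rule tri)
          also have "\<dots> \<le> 1 / real n + \<bar>?F - real ?k * ?E (f n)\<bar> / real n + \<bar>real ?k / real n * ?E (f n) - rhostar\<bar>"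
            using V n by (intro add_mono) (auto simp: divide_right_mono)
          finally show "?X js \<le> ?r n + \<bar>?F - real ?k * ?E (f n)\<bar> / real n" by (simp only: add_ac)
        qed
      qed (intro integrable_measure_pmf_finite fin)+
      also have "\<dots> = ?r n + measure_pmf.expectation (?\<mu> n) (\<lambda>js. \<bar>sum_list (map (f n) js) - real ?k * ?E (f n)\<bar>) / real n"
        by (simp add: Bochner_Integration.integral_add integrable_measure_pmf_finite fin)
      also have "\<dots> \<le> ?r n + B n" using D by simp
      finally have "measure_pmf.expectation (?\<mu> n) ?X \<le> ?r n + B n" .
      moreover have "0 \<le> measure_pmf.expectation (?\<mu> n) ?X"
        by (intro Bochner_Integration.integral_nonneg) simp
      ultimately show ?case by (simp only: real_norm_def abs_of_nonneg)
    qed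
  qed
qed

section \<open>The limiting support fraction\<close>

lemma optimal_seq_exists: "\<exists>\<kappa>. optimal_seq \<rho> \<kappa>"
proof -
  have "\<exists>k. optimal \<rho> n k" if "n \<ge> 1" for n
  proof -
    have fin: "finite (Wpart \<rho> n ` {1..n})" "Wpart \<rho> n ` {1..n} \<noteq> {}" using that by auto
    obtain k where k: "k \<in> {1..n}" "Wpart \<rho> n k = Max (Wpart \<rho> n ` {1..n})" using Max_in[OF fin] by force
    have "Wpart \<rho> n l \<le> Wpart \<rho> n k" if "l \<in> {1..n}" for l
      unfolding k(2) using that by (intro Max_ge) auto
    then have "optimal \<rho> n k" using k by (auto simp: optimal_def is_arg_max_def not_less)
    then show ?thesis by blast
  qed
  then show ?thesis unfolding optimal_seq_def by (intro choice) blast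
qed

text \<open>The definite description is legitimate because some sequence of maximizers exists: the
  condition is not vacuous, and limits are unique.\<close>

lemma alpha_starI:
  assumes "\<And>\<kappa>. optimal_seq \<rho> \<kappa> \<Longrightarrow> (\<lambda>n. real (\<kappa> n) / real n) \<longlonglongrightarrow> a"
  shows "alpha_star \<rho> = a"
    and "optimal_seq \<rho> \<kappa> \<Longrightarrow> (\<lambda>n. real (\<kappa> n) / real n) \<longlonglongrightarrow> alpha_star \<rho>"
proof -
  obtain \<kappa>0 where "optimal_seq \<rho> \<kappa>0" using optimal_seq_exists by blast
  then show "alpha_star \<rho> = a"
    unfolding alpha_star_def using assms LIMSEQ_unique by (intro the_equality) blast+
  then show "optimal_seq \<rho> \<kappa> \<Longrightarrow> (\<lambda>n. real (\<kappa> n) / real n) \<longlonglongrightarrow> alpha_star \<rho>" using assms by simp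
qed

lemma support_limit:
  assumes ev: "\<forall>\<^sub>F n in sequentially. \<forall>k. optimal \<rho> n k \<longrightarrow> \<bar>real k / real n - a\<bar> \<le> e n"
    and e: "e \<longlonglongrightarrow> 0" and opt: "optimal_seq \<rho> \<kappa>"
  shows "(\<lambda>n. real (\<kappa> n) / real n) \<longlonglongrightarrow> a"
proof (rule LIM_zero_cancel, rule Lim_null_comparison[OF _ e])
  show "\<forall>\<^sub>F n in sequentially. norm (real (\<kappa> n) / real n - a) \<le> e n"
    using ev eventually_ge_at_top[of 1]
    by eventually_elim (use opt in \<open>auto simp: optimal_seq_def\<close>)
qed

lemma canonical_rate:
  assumes "g \<le> 1"
  shows "\<exists>C>0. \<forall>\<^sub>F n in sequentially. \<forall>k. optimal (rho_of g) n k \<longrightarrow> \<bar>real k / real n - alpha_of g\<bar> \<le> C * real n powr (-1/2)"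
proof -
  obtain C c where "C > 0" and "\<forall>\<^sub>F n in sequentially. \<forall>k. optimal (rho_of g) n k \<longrightarrow>
      \<bar>real k / real n - alpha_of g\<bar> \<le> C * real n powr (-1/2) \<and> Wpart (rho_of g) n k > 0 \<and>
      c / real n \<le> near_prob (qlaw g) k n (rho_of g * real n)"
    using optimal_support[OF assms] by blast
  then have "\<forall>\<^sub>F n in sequentially. \<forall>k. optimal (rho_of g) n k \<longrightarrow> \<bar>real k / real n - alpha_of g\<bar> \<le> C * real n powr (-1/2)"
    by (elim eventually_mono) blast
  then show ?thesis using \<open>C > 0\<close> by blast
qed

lemma canonical_limit:
  assumes "g \<le> 1" "optimal_seq (rho_of g) \<kappa>"
  shows "(\<lambda>n. real (\<kappa> n) / real n) \<longlonglongrightarrow> alpha_of g"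
proof -
  obtain C where "\<forall>\<^sub>F n in sequentially. \<forall>k. optimal (rho_of g) n k \<longrightarrow> \<bar>real k / real n - alpha_of g\<bar> \<le> C * real n powr (-1/2)"
    using canonical_rate[OF assms(1)] by blast
  moreover have "(\<lambda>n. C * real n powr (-1/2)) \<longlonglongrightarrow> 0" by real_asymp
  ultimately show ?thesis using assms(2) by (rule support_limit)
qed

lemma supercritical_limit:
  assumes "\<rho> > rhostar" "optimal_seq \<rho> \<kappa>"
  shows "(\<lambda>n. real (\<kappa> n) / real n) \<longlonglongrightarrow> 1/2"
proof -
  obtain C where "\<forall>\<^sub>F n in sequentially. \<forall>k. optimal \<rho> n k \<longrightarrow> Wpart \<rho> n k > 0 \<and>
     exp (- C * real n / ln (real n)) \<le> near_prob qstar k n (\<rho> * real n) \<and>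
     \<bar>real k / real n - 1/2\<bar> \<le> C * ln (real n) powr (-1/2)"
    using supercritical_support[OF assms(1)] by blast
  then have "\<forall>\<^sub>F n in sequentially. \<forall>k. optimal \<rho> n k \<longrightarrow> \<bar>real k / real n - 1/2\<bar> \<le> C * ln (real n) powr (-1/2)"
    by (elim eventually_mono) blast
  moreover have "(\<lambda>n. C * ln (real n) powr (-1/2)) \<longlonglongrightarrow> 0" by real_asymp
  ultimately show ?thesis using assms(2) by (rule support_limit)
qed

text \<open>No canonical law has rate 0, so this case is settled directly:
  \<open>profile j \<ge> (j - 1) * ln 2\<close>, hence a total profile of at most 1 leaves
  \<open>n - k \<le> 2\<close>.\<close>

lemma zero_limit:
  assumes "optimal_seq 0 \<kappa>"
  shows "(\<lambda>n. real (\<kappa> n) / real n) \<longlonglongrightarrow> 1"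
proof -
  have ge: "(real j - 1) * ln 2 \<le> profile j" if "1 \<le> j" for j
    using that
  proof (induction j rule: dec_induct)
    case (step j)
    have "ln 2 \<le> ln (real (Suc j))" using step by (subst ln_le_cancel_iff) auto
    moreover have "(real (Suc j) - 1) * ln 2 = (real j - 1) * ln 2 + ln 2" by (simp add: algebra_simps)
    ultimately show ?case using step.IH unfolding profile_Suc by linarith
  qed (simp add: profile_small)
  have bound: "\<bar>real k / real n - 1\<bar> \<le> 2 / real n" if n: "n \<ge> 1" and opt: "optimal 0 n k" for n k
  proof -
    \<comment> \<open>The all-ones configuration makes the maximum positive, so a maximizer
      \<open>k\<close> has a configuration to inspect.\<close>
    have "replicate n 1 \<in> configs 0 n n"
      by (simp add: configs_def sum_list_replicate profile_small)
    then have "0 < Wpart 0 n n"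
      unfolding Wpart_def by (intro sum_pos2[OF finite_configs _ weight_pos]) (auto intro: less_imp_le weight_pos)
    then have "0 < Wpart 0 n k" using optimalD(3)[OF opt n order_refl] by linarith
    then obtain js where js: "js \<in> configs 0 n k" unfolding Wpart_def by fastforce
    then have props: "length js = k" "sum_list js = n" "\<forall>j\<in>set js. 1 \<le> j" "sum_list (map profile js) \<le> 1"
      by (auto simp: configs_def)
    have "(real (sum_list xs) - real (length xs)) * ln 2 \<le> sum_list (map profile xs)" if "\<forall>j\<in>set xs. 1 \<le> j" for xs
      using that
    proof (induction xs)
      case (Cons j xs)
      then show ?case using ge[of j] by (simp add: algebra_simps)
    qed simp
    from this[OF props(3)] have "(real n - real k) * ln 2 \<le> 1" using props by simp
    moreover have "(1/2::real) \<le> ln 2" using ln_ge_iff[of 2 "1/2"] ln2_ge_two_thirds by simp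
    ultimately have "(real n - real k) * (1/2) \<le> 1"
      using optimalD(2)[OF opt] mult_left_mono[of "1/2" "ln 2" "real n - real k"] by simp
    moreover have "\<bar>real k / real n - 1\<bar> = (real n - real k) / real n"
      using n optimalD(2)[OF opt] by (simp add: field_simps abs_if)
    ultimately show ?thesis by (simp add: divide_right_mono)
  qed
  show ?thesis
  proof (rule support_limit[OF _ _ assms])
    show "\<forall>\<^sub>F n in sequentially. \<forall>k. optimal 0 n k \<longrightarrow> \<bar>real k / real n - 1\<bar> \<le> 2 / real n"
      using eventually_ge_at_top[of 1] by (rule eventually_mono) (use bound in blast)
    show "(\<lambda>n. 2 / real n) \<longlonglongrightarrow> 0" by real_asymp
  qed
qed

lemma rho_cases:
  assumes "0 < \<rho>" "\<rho> \<le> rhostar"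
  obtains g where "g \<le> 1" "rho_of g = \<rho>"
proof (cases "\<rho> = rhostar")
  case True
  then show ?thesis using that[of 1] rho_of_1 by simp
next
  case False
  then obtain g where "g < 1 \<and> rho_of g = \<rho>" using rho_of_ex1[of \<rho>] assms by auto
  then show ?thesis using that[of g] by simp
qed

lemma alpha_star_rho_of: "g \<le> 1 \<Longrightarrow> alpha_star (rho_of g) = alpha_of g"
  by (rule alpha_starI(1)[OF canonical_limit])

lemma alpha_star_0: "alpha_star 0 = 1"
  by (rule alpha_starI(1)[OF zero_limit])

text \<open>\<open>rho_of\<close> is strictly increasing and \<open>alpha_of\<close> strictly
  decreasing in \<open>g\<close>; at the left endpoint the value 1 exceeds every
  \<open>alpha_of g\<close>.\<close>

lemma alpha_star_decreasing: "strict_antimono_on {0..rhostar} alpha_star"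
proof (rule monotone_onI)
  fix \<rho> \<rho>' assume r: "\<rho> \<in> {0..rhostar}" "\<rho>' \<in> {0..rhostar}" "\<rho> < \<rho>'"
  obtain g' where g': "g' \<le> 1" "rho_of g' = \<rho>'" using rho_cases[of \<rho>'] r by auto
  show "alpha_star \<rho>' < alpha_star \<rho>"
  proof (cases "\<rho> = 0")
    case True
    then show ?thesis using alpha_of_less_1[OF g'(1)] alpha_star_rho_of[OF g'(1)] g' alpha_star_0 by simp
  next
    case False
    obtain g where g: "g \<le> 1" "rho_of g = \<rho>" using rho_cases[of \<rho>] r False by auto
    have "g < g'"
    proof (rule ccontr)
      assume "\<not> g < g'"
      then have "rho_of g' \<le> rho_of g" using rho_of_less[of g' g] g by (cases "g' = g") auto
      then show False using g g' r by simp
    qed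
    then show ?thesis using alpha_of_less[of g g'] g g' alpha_star_rho_of by force
  qed
qed

lemma alpha_star_limit:
  assumes "0 \<le> \<rho>" "optimal_seq \<rho> \<kappa>"
  shows "(\<lambda>n. real (\<kappa> n) / real n) \<longlonglongrightarrow> alpha_star \<rho>"
proof -
  consider "\<rho> = 0" | "0 < \<rho>" "\<rho> \<le> rhostar" | "rhostar < \<rho>" using assms by linarith
  then show ?thesis
  proof cases
    case 1
    show ?thesis using assms(2) unfolding 1 by (rule alpha_starI(2)[rotated]) (erule zero_limit)
  next
    case 2
    then obtain g where g: "g \<le> 1" "rho_of g = \<rho>" by (rule rho_cases)
    show ?thesis using assms(2) unfolding g(2)[symmetric]
      by (rule alpha_starI(2)[rotated]) (erule canonical_limit[OF g(1)])
  next
    case 3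
    show ?thesis using assms(2) by (rule alpha_starI(2)[rotated]) (erule supercritical_limit[OF 3])
  qed
qed

text \<open>All rates hold uniformly over the maximizers \<open>k\<close>. The conjuncts
  \<open>0 < Wpart\<close> and \<open>r \<le> k\<close> ensure that \<open>mu_law\<close> is the
  intended conditional law and that its first \<open>r\<close> coordinates exist. Each constant is
  chosen after the parameters on which the subscripts of \<open>O\<close> let it depend.\<close>

theorem corollary2:
  shows
    "\<bar>rhostar - 0.507834\<bar> \<le> 0.0000005
     \<and> q_c = qstar \<and> rho_c = rhostar \<and> alpha_c = 1/2
     \<and> (\<forall>\<rho>\<ge>0. \<forall>\<kappa>. optimal_seq \<rho> \<kappa> \<longrightarrow>
            (\<lambda>n. real (\<kappa> n) / real n) \<longlonglongrightarrow> alpha_star \<rho>)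
     \<and> alpha_star 0 = 1
     \<and> strict_antimono_on {0..rhostar} alpha_star
     \<and> (\<forall>\<rho>. 0 < \<rho> \<and> \<rho> < rhostar \<longrightarrow>
          (\<exists>!\<gamma>. \<gamma> < 1 \<and> rho_of \<gamma> = \<rho>)
        \<and> (\<forall>\<gamma>. \<gamma> < 1 \<and> rho_of \<gamma> = \<rho> \<longrightarrow>
              alpha_star \<rho> = alpha_of \<gamma>
            \<and> (\<exists>C. \<forall>\<^sub>F n in sequentially. \<forall>k. optimal \<rho> n k \<longrightarrow>
                  \<bar>real k / real n - alpha_of \<gamma>\<bar> \<le> C * real n powr (-1/2))
            \<and> (\<forall>r\<ge>1. \<exists>C. \<forall>\<^sub>F n in sequentially. \<forall>k. optimal \<rho> n k \<longrightarrow>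
                  0 < Wpart \<rho> n k \<and> r \<le> k
                \<and> tv_dist (mu_marg \<rho> n k r) (replicate_pmf r (qlaw \<gamma>))
                    \<le> C * (ln (real n) / real n) powr (1/2))))
     \<and> (alpha_star rhostar = 1/2 \<and> q_c = qstar
        \<and> (\<exists>C. \<forall>\<^sub>F n in sequentially. \<forall>k. optimal rhostar n k \<longrightarrow>
              \<bar>real k / real n - 1/2\<bar> \<le> C * (ln (real n) / real n) powr (1/2))
        \<and> (\<forall>r\<ge>1. \<exists>C. \<forall>\<^sub>F n in sequentially. \<forall>k. optimal rhostar n k \<longrightarrow>
              0 < Wpart rhostar n k \<and> r \<le> k
            \<and> tv_dist (mu_marg rhostar n k r) (replicate_pmf r qstar)
                \<le> C * (ln (real n) / real n) powr (1/2)))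
     \<and> (\<forall>\<rho>>rhostar.
          alpha_star \<rho> = 1/2
        \<and> (\<forall>r\<ge>1. \<exists>C. \<forall>\<^sub>F n in sequentially. \<forall>k. optimal \<rho> n k \<longrightarrow>
              0 < Wpart \<rho> n k \<and> r \<le> k
            \<and> \<bar>real k / real n - 1/2\<bar> + tv_dist (mu_marg \<rho> n k r) (replicate_pmf r qstar)
                \<le> C * ln (real n) powr (-1/2))
        \<and> (\<forall>\<kappa>. optimal_seq \<rho> \<kappa> \<longrightarrow>
            (\<exists>M :: nat \<Rightarrow> real. filterlim M at_top sequentially
              \<and> (\<lambda>n. measure_pmf.expectation (mu_law \<rho> n (\<kappa> n))
                    (\<lambda>js. real (card {i. i < \<kappa> n \<and> M n < real (js ! i)})) / real (\<kappa> n))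
                  \<longlonglongrightarrow> 0
              \<and> (\<lambda>n. measure_pmf.expectation (mu_law \<rho> n (\<kappa> n))
                    (\<lambda>js. \<bar>(\<Sum>i | i < \<kappa> n \<and> M n < real (js ! i). profile (js ! i)) / real n
                          - (\<rho> - rhostar)\<bar>))
                  \<longlonglongrightarrow> 0)))"
proof (intro conjI allI impI)
  show "\<bar>rhostar - 0.507834\<bar> \<le> 0.0000005" by (rule rhostar_numeric)
  show qc: "q_c = qstar" and "q_c = qstar" by (simp_all add: gamma_c_eq qlaw_1)
  show "rho_c = rhostar" by (simp add: gamma_c_eq rho_of_1)
  show "alpha_c = 1/2" by (simp add: gamma_c_eq alpha_of_1)
  show "(\<lambda>n. real (\<kappa> n) / real n) \<longlonglongrightarrow> alpha_star \<rho>" if "0 \<le> \<rho>" "optimal_seq \<rho> \<kappa>" for \<rho> \<kappa>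
    using that by (rule alpha_star_limit)
  show "alpha_star 0 = 1" by (rule alpha_star_0)
  show "strict_antimono_on {0..rhostar} alpha_star" by (rule alpha_star_decreasing)
next
  fix \<rho> assume "0 < \<rho> \<and> \<rho> < rhostar"
  then show "\<exists>!\<gamma>. \<gamma> < 1 \<and> rho_of \<gamma> = \<rho>" using rho_of_ex1 by blast
next
  fix \<rho> \<gamma> assume "\<gamma> < 1 \<and> rho_of \<gamma> = \<rho>"
  then have g: "\<gamma> \<le> 1" "rho_of \<gamma> = \<rho>" by auto
  show "alpha_star \<rho> = alpha_of \<gamma>" using alpha_star_rho_of g by blast
  show "\<exists>C. \<forall>\<^sub>F n in sequentially. \<forall>k. optimal \<rho> n k \<longrightarrow>
                  \<bar>real k / real n - alpha_of \<gamma>\<bar> \<le> C * real n powr (-1/2)"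
    using canonical_rate[OF g(1)] unfolding g(2) by blast
  show "\<exists>C. \<forall>\<^sub>F n in sequentially. \<forall>k. optimal \<rho> n k \<longrightarrow>
                  0 < Wpart \<rho> n k \<and> r \<le> k
                \<and> tv_dist (mu_marg \<rho> n k r) (replicate_pmf r (qlaw \<gamma>))
                    \<le> C * (ln (real n) / real n) powr (1/2)" if "1 \<le> r" for r
    using optimal_marginals[OF g(1) that] unfolding g(2) .
next
  show "alpha_star rhostar = 1/2" using alpha_star_rho_of[of 1] by (simp add: rho_of_1 alpha_of_1)
  obtain C where C: "C > 0" and ev: "\<forall>\<^sub>F n in sequentially. \<forall>k. optimal rhostar n k \<longrightarrow> \<bar>real k / real n - 1/2\<bar> \<le> C * real n powr (-1/2)"
    using canonical_rate[OF order_refl] unfolding rho_of_1 alpha_of_1 by blast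
  \<comment> \<open>The order \<open>n^(-1/2)\<close> persists at the critical rate and is weakened
    to the order claimed there.\<close>
  have "\<forall>\<^sub>F n::nat in sequentially. C * real n powr (-1/2) \<le> C * (ln (real n) / real n) powr (1/2)"
    using C by real_asymp
  with ev have "\<forall>\<^sub>F n in sequentially. \<forall>k. optimal rhostar n k \<longrightarrow> \<bar>real k / real n - 1/2\<bar> \<le> C * (ln (real n) / real n) powr (1/2)"
    by eventually_elim force
  then show "\<exists>C. \<forall>\<^sub>F n in sequentially. \<forall>k. optimal rhostar n k \<longrightarrow>
              \<bar>real k / real n - 1/2\<bar> \<le> C * (ln (real n) / real n) powr (1/2)" by blast
  show "\<exists>C. \<forall>\<^sub>F n in sequentially. \<forall>k. optimal rhostar n k \<longrightarrow>
              0 < Wpart rhostar n k \<and> r \<le> k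
            \<and> tv_dist (mu_marg rhostar n k r) (replicate_pmf r qstar)
                \<le> C * (ln (real n) / real n) powr (1/2)" if "1 \<le> r" for r
    using optimal_marginals[OF order_refl that] unfolding rho_of_1 qlaw_1 .
next
  fix \<rho> assume \<rho>: "rhostar < \<rho>"
  show "alpha_star \<rho> = 1/2" by (rule alpha_starI(1)[OF supercritical_limit[OF \<rho>]])
  show "\<exists>C. \<forall>\<^sub>F n in sequentially. \<forall>k. optimal \<rho> n k \<longrightarrow>
              0 < Wpart \<rho> n k \<and> r \<le> k
            \<and> \<bar>real k / real n - 1/2\<bar> + tv_dist (mu_marg \<rho> n k r) (replicate_pmf r qstar)
                \<le> C * ln (real n) powr (-1/2)" if "1 \<le> r" for r
    by (rule supercritical_marginals[OF \<rho> that])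
  fix \<kappa> assume opt: "optimal_seq \<rho> \<kappa>"
  show "\<exists>M :: nat \<Rightarrow> real. filterlim M at_top sequentially
              \<and> (\<lambda>n. measure_pmf.expectation (mu_law \<rho> n (\<kappa> n))
                    (\<lambda>js. real (card {i. i < \<kappa> n \<and> M n < real (js ! i)})) / real (\<kappa> n))
                  \<longlonglongrightarrow> 0
              \<and> (\<lambda>n. measure_pmf.expectation (mu_law \<rho> n (\<kappa> n))
                    (\<lambda>js. \<bar>(\<Sum>i | i < \<kappa> n \<and> M n < real (js ! i). profile (js ! i)) / real n
                          - (\<rho> - rhostar)\<bar>))
                  \<longlonglongrightarrow> 0"
  proof (intro exI conjI)
    show "filterlim (\<lambda>n. ln (real n) powr (1/16)) at_top sequentially" by real_asymp
  qed (rule supercritical_excess[OF \<rho> opt])+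
qed

end
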